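(* Let $\mathcal U\subset\mathbb R^n\times\mathbb R^n$ be open, $I\subset\mathbb R$ an open interval ($I=\mathbb R$ or $I=(0,\infty)$), and let the generating function $G:\mathcal U\times I\to\mathbb R$, with $G_z<0$, satisfy conditions G1, G2 and G1*. Let $\Omega\subset\mathcal U^{(1)}$ be a bounded domain with $\partial\Omega\in C^2$, and let $y_0\in\mathcal U^*_\Omega=\bigcap_{x\in\Omega}\mathcal U^*_x$ and $z_0\in I(\Omega,y_0)=\bigcap_{x\in\Omega}I(x,y_0)$. Then $\Omega$ is $G$-convex with respect to $(y_0,z_0)$ if and only if $$\sum_{i,j}\Big[D_i\gamma_j(x)-\sum_k G_{ij,p_k}(x,y_0,z_0)\,\gamma_k(x)\Big]\tau_i\tau_j\ \ge\ 0$$ for all $x\in\partial\Omega$, unit outer normal $\gamma$ and unit tangent vector $\tau$ to $\partial\Omega$ at $x$.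
   Context: Notation. $G=G(x,y,z)$ is smooth on $\mathcal U\times I$ (with $(x,y)\in\mathcal U$, $z\in I$) and $G_z<0$. $\mathcal U^*_x=\{y:(x,y)\in\mathcal U\}$, $\mathcal U_y=\{x:(x,y)\in\mathcal U\}$, $\mathcal U^{(1)}=\bigcup_y\mathcal U_y$, $\mathcal U^{(2)}=\bigcup_x\mathcal U^*_x$. G1: for each $(x,y)\in\mathcal U$ there is an open interval $I(x,y)\subset I$ such that for each $x\in\mathcal U^{(1)}$ the map $(y,z)\mapsto (G_x(x,y,z),G(x,y,z))$ is one-to-one on $\{(y,z):y\in\mathcal U^*_x,\ z\in I(x,y)\}$. Put $\Gamma=\{(x,y,z):(x,y)\in\mathcal U,\ z\in I(x,y)\}$. G2: $\det E\neq0$ on $\Gamma$, where $E_{i,j}=G_{x_iy_j}-(G_z)^{-1}G_{x_iz}G_{y_j}$; $[E^{i,j}]$ denotes the inverse matrix of $[E_{i,j}]$. G1*: with $Q=-G_y/G_z$, for each $y\in\mathcal U^{(2)}$ and each $z$, the map $x\mapsto Q(x,y,z)$ is one-to-one on $\{x:(x,y,z)\in\Gamma\}$. $\Omega$ is $G$-convex with respect to $(y_0,z_0)$ if $Q(\cdot,y_0,z_0)(\Omega)$ is convex in $\mathbb R^n$. $G_{ij,p_k}$ is the derivative with respect to $p_k$ of $A_{ij}(x,u,p)=G_{x_ix_j}(x,Y(x,u,p),Z(x,u,p))$, where $(Y,Z)(x,u,p)$ solves $G_x(x,Y,Z)=p$, $G(x,Y,Z)=u$; evaluated at $(x,y_0,z_0)$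 (i.e. at $u=G(x,y_0,z_0)$, $p=G_x(x,y_0,z_0)$) it is $$G_{ij,p_k}=\sum_r E^{r,k}\Big(G_{x_ix_jy_r}-\frac{G_{y_r}}{G_z}G_{x_ix_jz}\Big)(x,y_0,z_0).$$
   Formalization: The formal statement additionally assumes (x,y_0,z_0) in Γ for every x in ∂Ω; the English only requires this for x in Ω, so G_{ij,p_k}(x,y_0,z_0) may be undefined on ∂Ω (e.g. G=x·y−z, U=Ω×R^n). *)

theory Defs
  imports "HOL-Analysis.Analysis"
begin

section \<open>Partial derivatives and differentiability classes\<close>

definition pd :: "'n::finite \<Rightarrow> (real^'n \<Rightarrow> 'b::real_normed_vector) \<Rightarrow> real^'n \<Rightarrow> 'b" where
  "pd i f x = frechet_derivative f (at x) (axis i 1)"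

text \<open>
  \<open>Ck_on k f S\<close> is meant for open \<open>S\<close>: all iterated directional derivatives of order at most \<open>k\<close>
  exist and are continuous on \<open>S\<close>, and those of order less than \<open>k\<close> are totally differentiable.
\<close>

primrec Ck_on :: "nat \<Rightarrow> ('a::real_normed_vector \<Rightarrow> 'b::real_normed_vector) \<Rightarrow> 'a set \<Rightarrow> bool" where
  "Ck_on 0 f S \<longleftrightarrow> continuous_on S f"
| "Ck_on (Suc k) f S \<longleftrightarrow>
     (\<forall>x\<in>S. f differentiable (at x)) \<and>
     (\<forall>v. Ck_on k (\<lambda>x. frechet_derivative f (at x) v) S)"

definition smooth_on :: "('a::real_normed_vector \<Rightarrow> 'b::real_normed_vector) \<Rightarrow> 'a set \<Rightarrow> bool" where
  "smooth_on f S \<longleftrightarrow> (\<forall>k. Ck_on k f S)"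

definition open_interval :: "real set \<Rightarrow> bool" where
  "open_interval J \<longleftrightarrow> open J \<and> is_interval J \<and> J \<noteq> {}"


section \<open>Generating functions\<close>

type_synonym 'n genfun = "real^'n \<Rightarrow> real^'n \<Rightarrow> real \<Rightarrow> real"

definition U1 :: "((real^'n) \<times> (real^'n)) set \<Rightarrow> (real^'n) set" where
  "U1 U = {x. \<exists>y. (x, y) \<in> U}"

definition U2 :: "((real^'n) \<times> (real^'n)) set \<Rightarrow> (real^'n) set" where
  "U2 U = {y. \<exists>x. (x, y) \<in> U}"

definition Ustar :: "((real^'n) \<times> (real^'n)) set \<Rightarrow> real^'n \<Rightarrow> (real^'n) set" where
  "Ustar U x = {y. (x, y) \<in> U}"

definition Gz :: "'n::finite genfun \<Rightarrow> 'n genfun" where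
  "Gz G x y z = deriv (\<lambda>z. G x y z) z"

definition Gx :: "'n::finite genfun \<Rightarrow> real^'n \<Rightarrow> real^'n \<Rightarrow> real \<Rightarrow> real^'n" where
  "Gx G x y z = (\<chi> i. pd i (\<lambda>x. G x y z) x)"

definition Gy :: "'n::finite genfun \<Rightarrow> real^'n \<Rightarrow> real^'n \<Rightarrow> real \<Rightarrow> real^'n" where
  "Gy G x y z = (\<chi> j. pd j (\<lambda>y. G x y z) y)"

definition Gxx :: "'n::finite genfun \<Rightarrow> 'n \<Rightarrow> 'n \<Rightarrow> 'n genfun" where
  "Gxx G i j x y z = pd i (\<lambda>x. pd j (\<lambda>x. G x y z) x) x"

definition Emat :: "'n::finite genfun \<Rightarrow> real^'n \<Rightarrow> real^'n \<Rightarrow> real \<Rightarrow> real^'n^'n" where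
  "Emat G x y z = (\<chi> i j.
      pd i (\<lambda>x. pd j (\<lambda>y. G x y z) y) x
      - inverse (Gz G x y z) * deriv (\<lambda>z. pd i (\<lambda>x. G x y z) x) z * Gy G x y z $ j)"

definition Qmap :: "'n::finite genfun \<Rightarrow> real^'n \<Rightarrow> real^'n \<Rightarrow> real \<Rightarrow> real^'n" where
  "Qmap G x y z = (- inverse (Gz G x y z)) *\<^sub>R Gy G x y z"

text \<open>In the following, \<open>J x y\<close> is the interval \<open>I(x,y)\<close>.\<close>

definition Gam ::
  "((real^'n) \<times> (real^'n)) set \<Rightarrow> (real^'n \<Rightarrow> real^'n \<Rightarrow> real set) \<Rightarrow> ((real^'n) \<times> (real^'n) \<times> real) set"
  where "Gam U J = {(x, y, z). (x, y) \<in> U \<and> z \<in> J x y}"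

definition condG1 ::
  "((real^'n::finite) \<times> (real^'n)) set \<Rightarrow> real set \<Rightarrow> (real^'n \<Rightarrow> real^'n \<Rightarrow> real set) \<Rightarrow> 'n genfun \<Rightarrow> bool"
  where "condG1 U I J G \<longleftrightarrow>
    (\<forall>(x, y)\<in>U. open_interval (J x y) \<and> J x y \<subseteq> I) \<and>
    (\<forall>x\<in>U1 U. inj_on (\<lambda>(y, z). (Gx G x y z, G x y z)) {(y, z). y \<in> Ustar U x \<and> z \<in> J x y})"

definition condG2 ::
  "((real^'n::finite) \<times> (real^'n)) set \<Rightarrow> (real^'n \<Rightarrow> real^'n \<Rightarrow> real set) \<Rightarrow> 'n genfun \<Rightarrow> bool"
  where "condG2 U J G \<longleftrightarrow> (\<forall>(x, y, z)\<in>Gam U J. det (Emat G x y z) \<noteq> 0)"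

definition condG1star ::
  "((real^'n::finite) \<times> (real^'n)) set \<Rightarrow> (real^'n \<Rightarrow> real^'n \<Rightarrow> real set) \<Rightarrow> 'n genfun \<Rightarrow> bool"
  where "condG1star U J G \<longleftrightarrow>
    (\<forall>y\<in>U2 U. \<forall>z. inj_on (\<lambda>x. Qmap G x y z) {x. (x, y, z) \<in> Gam U J})"

definition G_convex :: "'n::finite genfun \<Rightarrow> (real^'n) set \<Rightarrow> real^'n \<Rightarrow> real \<Rightarrow> bool" where
  "G_convex G \<Omega> y0 z0 \<longleftrightarrow> convex ((\<lambda>x. Qmap G x y0 z0) ` \<Omega>)"


section \<open>The matrix function \<open>A\<close> and its \<open>p\<close>-derivatives\<close>

text \<open>
  \<open>solves_YZ U I G x0 y0 z0 YZ\<close>: the map \<open>(u,p) \<mapsto> YZ (u,p) = (Y(x0,u,p), Z(x0,u,p))\<close> is, near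
  \<open>(G x0 y0 z0, Gx G x0 y0 z0)\<close>, the continuous solution of \<open>G(x0,Y,Z) = u\<close>, \<open>Gx(x0,Y,Z) = p\<close>
  through \<open>(y0,z0)\<close>.  Where \<open>det (Emat G x0 y0 z0) \<noteq> 0\<close> and \<open>Gz G x0 y0 z0 \<noteq> 0\<close> its germ exists and
  is unique by the inverse function theorem.  Working with the germ gives the \<open>p\<close>-derivative a
  meaning at every point of \<open>Gam U J\<close>, although nothing forces the slice of \<open>Gam U J\<close> over \<open>x0\<close> to be
  open; if that slice is open, the germ is that of the solution which is unique by \<open>condG1\<close>.
\<close>

definition solves_YZ ::
  "((real^'n::finite) \<times> (real^'n)) set \<Rightarrow> real set \<Rightarrow> 'n genfun \<Rightarrow> real^'n \<Rightarrow> real^'n \<Rightarrow> real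
    \<Rightarrow> (real \<times> (real^'n) \<Rightarrow> (real^'n) \<times> real) \<Rightarrow> bool" where
  "solves_YZ U I G x0 y0 z0 YZ \<longleftrightarrow>
    YZ (G x0 y0 z0, Gx G x0 y0 z0) = (y0, z0) \<and>
    (\<exists>N. open N \<and> (G x0 y0 z0, Gx G x0 y0 z0) \<in> N \<and> continuous_on N YZ \<and>
      (\<forall>(u, p)\<in>N. case YZ (u, p) of (y, z) \<Rightarrow>
         (x0, y) \<in> U \<and> z \<in> I \<and> G x0 y z = u \<and> Gx G x0 y z = p))"

definition YZsol ::
  "((real^'n::finite) \<times> (real^'n)) set \<Rightarrow> real set \<Rightarrow> 'n genfun \<Rightarrow> real^'n \<Rightarrow> real^'n \<Rightarrow> real
    \<Rightarrow> real \<times> (real^'n) \<Rightarrow> (real^'n) \<times> real" where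
  "YZsol U I G x0 y0 z0 = (SOME YZ. solves_YZ U I G x0 y0 z0 YZ)"

definition Amat ::
  "((real^'n::finite) \<times> (real^'n)) set \<Rightarrow> real set \<Rightarrow> 'n genfun \<Rightarrow> real^'n \<Rightarrow> real^'n \<Rightarrow> real
    \<Rightarrow> 'n \<Rightarrow> 'n \<Rightarrow> real \<Rightarrow> real^'n \<Rightarrow> real" where
  "Amat U I G x0 y0 z0 i j u p =
    (case YZsol U I G x0 y0 z0 (u, p) of (y, z) \<Rightarrow> Gxx G i j x0 y z)"

definition Gxxp ::
  "((real^'n::finite) \<times> (real^'n)) set \<Rightarrow> real set \<Rightarrow> 'n genfun \<Rightarrow> 'n \<Rightarrow> 'n \<Rightarrow> 'n \<Rightarrow> 'n genfun" where
  "Gxxp U I G i j k x y z = pd k (\<lambda>p. Amat U I G x y z i j (G x y z) p) (Gx G x y z)"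


section \<open>Domains with twice continuously differentiable boundary\<close>

definition C2_boundary :: "(real^'n::finite) set \<Rightarrow> bool" where
  "C2_boundary \<Omega> \<longleftrightarrow>
    (\<forall>x0\<in>frontier \<Omega>. \<exists>N (\<phi> :: real^'n \<Rightarrow> real). open N \<and> x0 \<in> N \<and> Ck_on 2 \<phi> N \<and>
      (\<forall>x\<in>N. frechet_derivative \<phi> (at x) \<noteq> (\<lambda>v. 0)) \<and>
      \<Omega> \<inter> N = {x\<in>N. \<phi> x < 0} \<and> frontier \<Omega> \<inter> N = {x\<in>N. \<phi> x = 0})"

definition tangent_to_boundary :: "(real^'n::finite) set \<Rightarrow> real^'n \<Rightarrow> real^'n \<Rightarrow> bool" where
  "tangent_to_boundary \<Omega> x \<tau> \<longleftrightarrow>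
    (\<exists>c :: real \<Rightarrow> real^'n. c 0 = x \<and> (\<forall>\<^sub>F t in at 0. c t \<in> frontier \<Omega>) \<and>
      (c has_vector_derivative \<tau>) (at 0))"

definition unit_outer_normal :: "(real^'n::finite) set \<Rightarrow> real^'n \<Rightarrow> real^'n \<Rightarrow> bool" where
  "unit_outer_normal \<Omega> x \<nu> \<longleftrightarrow>
    norm \<nu> = 1 \<and> (\<forall>\<tau>. tangent_to_boundary \<Omega> x \<tau> \<longrightarrow> \<nu> \<bullet> \<tau> = 0) \<and>
    (\<forall>\<^sub>F t in at_right 0. x + t *\<^sub>R \<nu> \<notin> closure \<Omega>)"

text \<open>
  The partial derivatives \<open>D\<^sub>i \<gamma>\<^sub>j\<close> of the normal field refer to a continuously differentiable
  extension of it from the boundary to a neighbourhood of the boundary point under consideration;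
  their contraction with tangent vectors does not depend on the extension.
\<close>

definition outer_normal_field_near :: "(real^'n::finite) set \<Rightarrow> real^'n \<Rightarrow> (real^'n \<Rightarrow> real^'n) \<Rightarrow> bool" where
  "outer_normal_field_near \<Omega> x \<gamma> \<longleftrightarrow>
    (\<exists>N. open N \<and> x \<in> N \<and> Ck_on 1 \<gamma> N \<and> (\<forall>w\<in>frontier \<Omega> \<inter> N. unit_outer_normal \<Omega> w (\<gamma> w)))"

end

theory Submission
  imports Defs
begin

text \<open>
  Put \<open>q = Q(\<cdot>, y0, z0)\<close>, a diffeomorphism near the closure of \<open>\<Omega>\<close>. At a boundary point with outer normal
  \<open>\<gamma>\<close>, the vector \<open>m\<close> with \<open>E m = \<gamma>\<close> is an outer normal of \<open>q(\<Omega>)\<close>, and \<open>(m, \<mu>)\<close> with \<open>\<mu> = q(x) \<bullet> m\<close> is the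
  derivative of \<open>(Y, Z)\<close> in the direction \<open>p = \<gamma>\<close>; comparing the defining function of \<open>\<Omega>\<close> with
  \<open>G\<^sub>y \<bullet> m + \<mu> G\<^sub>z\<close> identifies the quadratic form of the statement, up to a positive factor, with the second
  fundamental form of the boundary of \<open>q(\<Omega>)\<close>. If it is negative in some direction, a small chord centred at
  the boundary point lies in \<open>q(\<Omega>)\<close> except for its midpoint. If it is nonnegative, arcs bent slightly
  inwards cannot touch the boundary from inside, so the closure of \<open>q(\<Omega>)\<close> is locally convex, and
  being compact and connected it is convex.
\<close>

section \<open>Local and global convexity\<close>

text \<open>The curvature condition is only a weak inequality, so it does not by itself stop a
  segment from touching the boundary. Strictness has to come from the bend of the arcs, and the bend
  is removed by a limit at the end. The defining function of the image, \<phi> composed with a local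
  inverse of \<open>q\<close>, is handled only through its first derivative and its behaviour along
  parabolas \<open>y + s \<xi> + s^2 w\<close>, never through a Hessian of its own. The necessity of
  the condition uses the same parabolas with \<open>w = 0\<close>. The other obstacle is that
  curvature is local, while \<open>q\<close> has a differentiable inverse only near each boundary
  point. G1* on the closure excludes that a distant part of the domain is mapped to the same place,
  and it turns the boundary of the image into the image of the boundary. The passage from local to
  global is made for the closure, where compactness provides minimizing chains; the open image is
  then recovered as the interior of its closure.\<close>

lemma compact_chains:
  fixes X :: "'a::metric_space set"
  assumes "compact X"
  shows "compact {f :: nat \<Rightarrow> 'a. (\<forall>i\<le>m. f i \<in> X) \<and> (\<forall>i>m. f i = c)}"
proof -
  \<comment> \<open>Freezing the entries beyond \<open>m\<close> at \<open>c\<close> makes the set a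
    full product with compact factors, so Tychonoff applies in the product topology of
    sequences.\<close>
  have "compact (PiE UNIV (\<lambda>i. if i \<le> m then X else {c}))"
    using compactin_PiE[of "\<lambda>i. euclidean" UNIV "\<lambda>i. if i \<le> m then X else {c}"] assms
    by (auto simp: euclidean_product_topology)
  also have "PiE UNIV (\<lambda>i. if i \<le> m then X else {c}) = {f. (\<forall>i\<le>m. f i \<in> X) \<and> (\<forall>i>m. f i = c)}"
    by (force simp: PiE_UNIV_domain Pi_iff split: if_splits)
  finally show ?thesis .
qed

text \<open>Two points of a ball of radius \<open>e/2\<close> are less than \<open>e\<close> apart,
  so reachability from \<open>a\<close> by short steps is locally constant on \<open>X\<close>,
  hence constant by connectedness.\<close>

lemma connected_imp_chain:
  fixes X :: "'a::metric_space set"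
  assumes "connected X" "a \<in> X" "b \<in> X" "e > 0"
  shows "\<exists>m f. f 0 = a \<and> f m = b \<and> (\<forall>i\<le>m. f i \<in> X) \<and> (\<forall>i<m. dist (f i) (f (Suc i)) < e)"
proof -
  define R where "R = {(x, y). x \<in> X \<and> y \<in> X \<and> dist x y < e}"
  have R: "(x, y) \<in> R\<^sup>* \<Longrightarrow> y \<in> X" if "x \<in> X" for x y
    by (induction rule: rtrancl_induct) (use that in \<open>auto simp: R_def\<close>)
  have "(a, b) \<in> R\<^sup>*"
  proof (rule connected_induction_simple[OF assms(1), where P = "\<lambda>x. (a, x) \<in> R\<^sup>*" and a = a])
    show "\<exists>T. openin (top_of_set X) T \<and> x \<in> T \<and> (\<forall>x\<in>T. \<forall>y\<in>T. (a, x) \<in> R\<^sup>* \<longrightarrow> (a, y) \<in> R\<^sup>*)"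
      if "x \<in> X" for x
    proof (intro exI conjI ballI impI)
      show "openin (top_of_set X) (X \<inter> ball x (e/2))"
        by (simp add: openin_open_Int)
      fix u v assume *: "u \<in> X \<inter> ball x (e/2)" "v \<in> X \<inter> ball x (e/2)" "(a, u) \<in> R\<^sup>*"
      then have "dist u v < e"
        using dist_triangle_half_r[of x u e v] by simp
      with * have "(u, v) \<in> R"
        by (simp add: R_def)
      with * show "(a, v) \<in> R\<^sup>*"
        by auto
    qed (use that assms in auto)
  qed (use assms in auto)
  then obtain m where "(a, b) \<in> R ^^ m"
    using rtrancl_power by blast
  then obtain f where f: "f 0 = a" "f m = b" "\<And>i. i < m \<Longrightarrow> (f i, f (Suc i)) \<in> R"
    unfolding relpow_fun_conv by blast
  have "f i \<in> X" if "i \<le> m" for i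
    using f assms(2) that by (cases i) (auto simp: R_def)
  with f show ?thesis
    by (intro exI[of _ m] exI[of _ f]) (auto simp: R_def)
qed

text \<open>Apollonius' identity: the two sides differ by twice the squared distance from
  \<open>x\<close> to the midpoint, which also gives the strictness that the minimality argument
  needs.\<close>

lemma sum_sq_dist_midpoint_less:
  fixes a b x :: "'a::real_inner"
  assumes "x \<noteq> midpoint a b"
  shows "(dist a (midpoint a b))\<^sup>2 + (dist (midpoint a b) b)\<^sup>2 < (dist a x)\<^sup>2 + (dist x b)\<^sup>2"
proof -
  have "(dist a x)\<^sup>2 + (dist x b)\<^sup>2 - ((dist a (midpoint a b))\<^sup>2 + (dist (midpoint a b) b)\<^sup>2)
      = 2 * (dist x (midpoint a b))\<^sup>2"
    unfolding midpoint_def dist_norm power2_norm_eq_inner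
    by (simp add: inner_diff_left inner_diff_right inner_add_left inner_add_right
        inner_commute algebra_simps)
  moreover have "0 < (dist x (midpoint a b))\<^sup>2"
    using assms by simp
  ultimately show ?thesis
    by linarith
qed

text \<open>
  A chain of steps at most \<open>\<delta>\<close> in \<open>X\<close> that minimizes the sum of the squared step lengths is
  equally spaced on a straight line, as replacing a vertex by the midpoint of its neighbours
  decreases that sum.
\<close>

lemma uniformly_locally_convex_imp_segment:
  fixes X :: "'a::euclidean_space set"
  assumes "compact X" and "\<delta> > 0"
    and conv: "\<And>x. x \<in> X \<Longrightarrow> convex (X \<inter> cball x \<delta>)"
    and f0: "f0 0 = a" "f0 m = b" "\<And>i. i \<le> m \<Longrightarrow> f0 i \<in> X"
      "\<And>i. i < m \<Longrightarrow> dist (f0 i) (f0 (Suc i)) \<le> \<delta>"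
  shows "closed_segment a b \<subseteq> X"
proof (cases "m = 0")
  case True
  then show ?thesis using f0 by auto
next
  case False
  \<comment> \<open>The step bound is non-strict so that the admissible chains form a closed set;
    entries beyond \<open>m\<close> are fixed at \<open>b\<close> to make it compact.\<close>
  define C where "C = {f. (\<forall>i\<le>m. f i \<in> X) \<and> (\<forall>i>m. f i = b)} \<inter>
    {f. f 0 = a} \<inter> {f. f m = b} \<inter> (\<Inter>i\<in>{..<m}. {f. dist (f i) (f (Suc i)) \<le> \<delta>})"
  define En where "En = (\<lambda>f :: nat \<Rightarrow> 'a. \<Sum>i<m. (dist (f i) (f (Suc i)))\<^sup>2)"
  have cont: "continuous_on UNIV (\<lambda>f :: nat \<Rightarrow> 'a. f i)" for i
    by simp
  have "compact C"
    unfolding C_def Int_assoc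
    by (intro compact_Int_closed compact_chains closed_Int closed_INT ballI
        closed_Collect_eq closed_Collect_le continuous_intros cont assms)
  moreover have "(\<lambda>i. if i \<le> m then f0 i else b) \<in> C"
    using f0 by (auto simp: C_def)
  moreover have "continuous_on C En"
    unfolding En_def by (rule continuous_on_subset[of UNIV]) (intro continuous_intros cont, simp)
  ultimately obtain f where fC: "f \<in> C" and fmin: "\<And>g. g \<in> C \<Longrightarrow> En f \<le> En g"
    using continuous_attains_inf[of C En] by blast
  have f: "f 0 = a" "f m = b" "\<And>i. i \<le> m \<Longrightarrow> f i \<in> X" "\<And>i. i > m \<Longrightarrow> f i = b"
      "\<And>i. i < m \<Longrightarrow> dist (f i) (f (Suc i)) \<le> \<delta>"
    using fC by (auto simp: C_def)
  have mid: "f (Suc i) = midpoint (f i) (f (Suc (Suc i)))" if i: "Suc i < m" for i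
  proof (rule ccontr)
    define p where "p = midpoint (f i) (f (Suc (Suc i)))"
    define g where "g = f(Suc i := p)"
    assume ne: "f (Suc i) \<noteq> midpoint (f i) (f (Suc (Suc i)))"
    \<comment> \<open>Both neighbours lie within \<delta> of the middle vertex, so local convexity
      at that vertex puts their midpoint into \<open>X\<close>. Its distance to each of them is half
      of a distance at most \<open>2 * \<delta>\<close>, hence the modified chain is still
      admissible.\<close>
    have "f i \<in> X \<inter> cball (f (Suc i)) \<delta>" "f (Suc (Suc i)) \<in> X \<inter> cball (f (Suc i)) \<delta>"
      using f i by (auto simp: dist_commute)
    then have "p \<in> X \<inter> cball (f (Suc i)) \<delta>"
      using convexD[OF conv[of "f (Suc i)"], of "f i" "f (Suc (Suc i))" "1/2" "1/2"] f(3)[of "Suc i"] i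
      by (simp add: p_def midpoint_def algebra_simps)
    moreover have "dist (f i) (f (Suc (Suc i))) \<le> 2 * \<delta>"
      using f(5)[of i] f(5)[of "Suc i"] i dist_triangle[of "f i" "f (Suc (Suc i))" "f (Suc i)"] by linarith
    then have "dist (f i) p \<le> \<delta>" "dist p (f (Suc (Suc i))) \<le> \<delta>"
      by (simp_all add: p_def dist_midpoint)
    ultimately have "g \<in> C"
      using f i by (auto simp: C_def g_def)
    moreover have "En g < En f"
    proof -
      define r where "r = {..<m} - {i, Suc i}"
      have dec: "{..<m} = insert i (insert (Suc i) r)" "i \<notin> insert (Suc i) r" "Suc i \<notin> r" "finite r"
        using i by (auto simp: r_def)
      have "(\<Sum>j\<in>r. (dist (g j) (g (Suc j)))\<^sup>2) = (\<Sum>j\<in>r. (dist (f j) (f (Suc j)))\<^sup>2)"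
        by (rule sum.cong) (auto simp: g_def r_def)
      moreover have "g i = f i" "g (Suc i) = p" "g (Suc (Suc i)) = f (Suc (Suc i))"
        by (auto simp: g_def)
      ultimately show ?thesis
        using sum_sq_dist_midpoint_less[OF ne]
        unfolding En_def dec(1) using dec(2-4) by (simp add: p_def)
    qed
    ultimately show False
      using fmin[of g] by linarith
  qed
  define v where "v = f 1 - a"
  \<comment> \<open>The midpoint relation is a linear recurrence of order two, so the induction
    carries two consecutive vertices.\<close>
  have lin: "f i = a + real i *\<^sub>R v \<and> f (Suc i) = a + real (Suc i) *\<^sub>R v" if "Suc i \<le> m" for i
    using that
  proof (induction i)
    case 0
    then show ?case using f by (simp add: v_def)
  next
    case (Suc i)
    then have IH: "f i = a + real i *\<^sub>R v" "f (Suc i) = a + real (Suc i) *\<^sub>R v"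
      by auto
    have "f (Suc (Suc i)) = 2 *\<^sub>R f (Suc i) - f i"
      using mid[of i] Suc.prems
      by (simp add: midpoint_def scaleR_add_right[symmetric])
    also have "\<dots> = a + real (Suc (Suc i)) *\<^sub>R v"
      unfolding IH of_nat_Suc by (simp add: scaleR_2 scaleR_left_distrib)
    finally show ?case
      using IH(2) by simp
  qed
  have lin': "f i = a + real i *\<^sub>R v" if "i \<le> m" for i
  proof (cases i)
    case 0
    then show ?thesis using f by simp
  next
    case (Suc k)
    with that lin[of k] show ?thesis by blast
  qed
  have seg: "closed_segment (f i) (f (Suc i)) \<subseteq> X" if "i < m" for i
  proof -
    have "closed_segment (f i) (f (Suc i)) \<subseteq> X \<inter> cball (f i) \<delta>"
      using f(3)[of i] f(3)[of "Suc i"] f(5)[of i] that \<open>\<delta> > 0\<close>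
      by (intro closed_segment_subset conv) auto
    then show ?thesis by blast
  qed
  have bm: "b = a + real m *\<^sub>R v"
    using lin'[of m] f(2) by simp
  show ?thesis
  proof
    fix x assume "x \<in> closed_segment a b"
    then obtain u where u: "0 \<le> u" "u \<le> 1" "x = (1 - u) *\<^sub>R a + u *\<^sub>R b"
      by (auto simp: in_segment)
    \<comment> \<open>The index of the chain step that contains the parameter \<open>u\<close>. At
      \<open>u = 1\<close> the floor would give \<open>m\<close>, which starts no step, so the last
      step is taken instead.\<close>
    define i where "i = (if u = 1 then m - 1 else nat \<lfloor>u * real m\<rfloor>)"
    have i: "i < m" "real i \<le> u * real m" "u * real m \<le> real i + 1"
    proof -
      have "u * real m < real m" if "u \<noteq> 1"
        using u that False by simp
      then show "i < m" "real i \<le> u * real m" "u * real m \<le> real i + 1"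
        using u False unfolding i_def by (auto simp: nat_less_iff floor_less_iff)
    qed
    have "x = (1 - (u * real m - real i)) *\<^sub>R f i + (u * real m - real i) *\<^sub>R f (Suc i)"
      unfolding u(3) lin'[of i, OF less_imp_le[OF i(1)]] lin'[of "Suc i", OF Suc_leI[OF i(1)]]
      unfolding bm by (simp add: algebra_simps)
    then have "x \<in> closed_segment (f i) (f (Suc i))"
      using i unfolding in_segment by (intro exI[of _ "u * real m - real i"]) auto
    with seg[OF i(1)] show "x \<in> X"
      by blast
  qed
qed

text \<open>The Tietze-Nakajima theorem for compact sets. The radius of local convexity varies with
  the point; a Lebesgue number of the cover by these balls replaces it by a uniform one, and
  connectedness supplies the chain from which the minimization starts.\<close>

theorem compact_connected_locally_convex_imp_convex:
  fixes X :: "'a::euclidean_space set"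
  assumes "compact X" "connected X"
    and loc: "\<And>x. x \<in> X \<Longrightarrow> \<exists>r>0. convex (X \<inter> ball x r)"
  shows "convex X"
proof -
  obtain r where r: "\<And>x. x \<in> X \<Longrightarrow> r x > 0 \<and> convex (X \<inter> ball x (r x))"
    using loc by metis
  obtain e where e: "e > 0" "\<And>x. x \<in> X \<Longrightarrow> \<exists>B\<in>(\<lambda>x. ball x (r x)) ` X. ball x e \<subseteq> B"
    by (rule Heine_Borel_lemma[OF \<open>compact X\<close>, of "(\<lambda>x. ball x (r x)) ` X"]) (use r in auto)
  have conv: "convex (X \<inter> cball x (e/2))" if x: "x \<in> X" for x
  proof -
    obtain p where p: "p \<in> X" "ball x e \<subseteq> ball p (r p)"
      using e(2)[OF x] by blast
    have "cball x (e/2) \<subseteq> ball p (r p)"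
      using p(2) e(1) by (auto simp: subset_iff)
    then have "X \<inter> cball x (e/2) = (X \<inter> ball p (r p)) \<inter> cball x (e/2)"
      by blast
    then show ?thesis
      using r[OF p(1)] convex_Int convex_cball by metis
  qed
  have "closed_segment a b \<subseteq> X" if "a \<in> X" "b \<in> X" for a b
  proof -
    have "e/2 > 0"
      using e(1) by simp
    from connected_imp_chain[OF \<open>connected X\<close> that this]
    obtain m f where f: "f 0 = a" "f m = b" "\<And>i. i \<le> m \<Longrightarrow> f i \<in> X"
        "\<And>i. i < m \<Longrightarrow> dist (f i) (f (Suc i)) < e/2"
      by blast
    show ?thesis
      by (rule uniformly_locally_convex_imp_segment[OF \<open>compact X\<close> \<open>e/2 > 0\<close> conv f(1,2)])
        (use f in \<open>auto intro: less_imp_le\<close>)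
  qed
  then show ?thesis
    by (simp add: convex_contains_segment)
qed

section \<open>Convexity criterion at boundary points\<close>

text \<open>The last clause is what a second-order test leaves over for a merely differentiable
  \<psi>: it holds for smooth \<psi> with nonnegative second derivative along tangent vectors,
  because the \<open>s^2\<close> coefficient then contains the positive summand
  \<open>\<psi>' y w\<close>. It is demanded at all boundary points near \<open>b\<close>, since the
  point where an arc touches is not known beforehand. The vector \<open>n\<close> points strictly
  inwards throughout the ball and is a common direction for bending and translating.\<close>

definition convex_boundary_at :: "'a::real_normed_vector set \<Rightarrow> 'a \<Rightarrow> bool" where
  "convex_boundary_at S b \<longleftrightarrow>
    (\<exists>R \<psi> \<psi>' n. R > 0 \<and> \<psi> b = (0::real) \<and>
      (\<forall>y\<in>ball b R. (\<psi> has_derivative \<psi>' y) (at y) \<and> \<psi>' y n < 0 \<and>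
        (y \<in> S \<longleftrightarrow> \<psi> y < 0) \<and> (y \<in> closure S \<longleftrightarrow> \<psi> y \<le> 0)) \<and>
      (\<forall>y\<in>ball b R. \<forall>\<xi> w. \<psi> y = 0 \<longrightarrow> \<psi>' y \<xi> = 0 \<longrightarrow> \<psi>' y w > 0 \<longrightarrow>
        (\<forall>\<^sub>F s in at 0. \<psi> (y + s *\<^sub>R \<xi> + s\<^sup>2 *\<^sub>R w) > 0)))"

lemma decreasing_along_ray:
  fixes \<psi> :: "'a::real_normed_vector \<Rightarrow> real"
  assumes der: "\<And>t. 0 \<le> t \<Longrightarrow> t \<le> T \<Longrightarrow> (\<psi> has_derivative \<psi>' (y + t *\<^sub>R n)) (at (y + t *\<^sub>R n))"
    and neg: "\<And>t. 0 \<le> t \<Longrightarrow> t \<le> T \<Longrightarrow> \<psi>' (y + t *\<^sub>R n) n < 0"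
    and "T > 0"
  shows "\<psi> (y + T *\<^sub>R n) < \<psi> y"
proof -
  have "((\<lambda>t. \<psi> (y + t *\<^sub>R n)) has_real_derivative \<psi>' (y + t *\<^sub>R n) n) (at t)"
    if "0 \<le> t" "t \<le> T" for t
  proof -
    have "((\<lambda>t. \<psi> (y + t *\<^sub>R n)) has_derivative (\<lambda>h. \<psi>' (y + t *\<^sub>R n) (h *\<^sub>R n))) (at t)"
      by (rule has_derivative_compose[of "\<lambda>t. y + t *\<^sub>R n" "\<lambda>h. h *\<^sub>R n" t UNIV \<psi> "\<psi>' (y + t *\<^sub>R n)"])
        (use der[OF that] in \<open>auto intro!: derivative_eq_intros\<close>)
    moreover have "\<psi>' (y + t *\<^sub>R n) (h *\<^sub>R n) = h * \<psi>' (y + t *\<^sub>R n) n" for h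
      using has_derivative_linear[OF der[OF that]] by (simp add: linear_scale)
    ultimately show ?thesis
      by (simp add: has_field_derivative_def mult.commute[of _ "\<psi>' (y + t *\<^sub>R n) n"])
  qed
  then have "\<psi> (y + T *\<^sub>R n) < \<psi> (y + 0 *\<^sub>R n)"
    by (intro DERIV_neg_imp_decreasing[of 0 T "\<lambda>t. \<psi> (y + t *\<^sub>R n)"] \<open>T > 0\<close>) (use neg in blast)
  then show ?thesis
    by simp
qed

text \<open>
  Segments are approximated by parabolic arcs bent towards the inner direction \<open>n\<close>. Translating
  such an arc from far inside towards its final position, it cannot touch the boundary, because at
  a first contact it would be tangent to the boundary and curve strictly outwards.
\<close>

lemma convex_boundary_at_imp_locally_convex:
  fixes S :: "'a::euclidean_space set"
  assumes "convex_boundary_at S b"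
  shows "\<exists>r>0. convex (closure S \<inter> ball b r)"
proof -
  obtain R \<psi> \<psi>' n where R: "R > 0" and b: "\<psi> b = (0::real)"
    and der: "\<And>y. y \<in> ball b R \<Longrightarrow> (\<psi> has_derivative \<psi>' y) (at y)"
    and neg: "\<And>y. y \<in> ball b R \<Longrightarrow> \<psi>' y n < 0"
    and S: "\<And>y. y \<in> ball b R \<Longrightarrow> y \<in> S \<longleftrightarrow> \<psi> y < 0"
    and clS: "\<And>y. y \<in> ball b R \<Longrightarrow> y \<in> closure S \<longleftrightarrow> \<psi> y \<le> 0"
    and second: "\<And>y \<xi> w. y \<in> ball b R \<Longrightarrow> \<psi> y = 0 \<Longrightarrow> \<psi>' y \<xi> = 0 \<Longrightarrow> \<psi>' y w > 0 \<Longrightarrow>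
        (\<forall>\<^sub>F s in at 0. \<psi> (y + s *\<^sub>R \<xi> + s\<^sup>2 *\<^sub>R w) > 0)"
    using assms unfolding convex_boundary_at_def by blast
  have lin: "linear (\<psi>' y)" if "y \<in> ball b R" for y
    using der[OF that] by (rule has_derivative_linear)
  have contb: "isCont \<psi> y" if "y \<in> ball b R" for y
    using der[OF that] by (rule has_derivative_continuous)
  have cont: "continuous_on (ball b R) \<psi>"
    by (meson contb continuous_at_imp_continuous_on)
  have n0: "n \<noteq> 0"
    using neg[of b] lin[of b] R by (auto simp: linear_0)
  \<comment> \<open>A shift by at most \<open>T1 *\<^sub>R n\<close> has length at most
    \<open>R / 4\<close>, so from the ball of radius \<open>R / 2\<close> it stays within the ball
    of radius \<open>R\<close>.\<close>
  define T1 where "T1 = R / (4 * norm n)"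
  have T1: "T1 > 0" "T1 * norm n = R / 4"
    using n0 R by (auto simp: T1_def)
  have ray: "\<psi> (y + T *\<^sub>R n) < \<psi> y" if "y \<in> ball b (R/2)" "0 < T" "T \<le> T1" for y T
  proof (rule decreasing_along_ray[where \<psi>' = \<psi>'])
    fix t assume t: "0 \<le> t" "t \<le> T"
    then have "t * norm n \<le> R / 4"
      using that T1 by (metis mult_right_mono norm_ge_zero order_trans)
    then have "y + t *\<^sub>R n \<in> ball b R"
      using that t R dist_triangle[of b "y + t *\<^sub>R n" y] by (simp add: dist_norm)
    then show "(\<psi> has_derivative \<psi>' (y + t *\<^sub>R n)) (at (y + t *\<^sub>R n))" "\<psi>' (y + t *\<^sub>R n) n < 0"
      using der neg by auto
  qed (use that in auto)
  have bT1: "b + T1 *\<^sub>R n \<in> ball b R"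
    using T1 R by (simp add: dist_norm)
  have "\<psi> (b + T1 *\<^sub>R n) < 0"
    using ray[of b T1] R T1 b by simp
  then have "\<forall>\<^sub>F y in nhds (b + T1 *\<^sub>R n). \<psi> y < 0"
    using contb[OF bT1] by (intro order_tendstoD(2)[of \<psi> "\<psi> (b + T1 *\<^sub>R n)"])
      (auto simp: isCont_def tendsto_at_iff_tendsto_nhds)
  then obtain r0 where r0: "r0 > 0" "\<And>y. dist y (b + T1 *\<^sub>R n) < r0 \<Longrightarrow> \<psi> y < 0"
    unfolding eventually_nhds_metric by blast
  \<comment> \<open>The arcs below stay at distance less than \<open>2 * r\<close> from the shifted
    centre \<open>b + T *\<^sub>R n\<close>. The bound \<open>R / 4\<close> thus keeps them in the
    ball of radius \<open>R\<close>, and \<open>r0 / 2\<close> puts the arc with the largest shift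
    \<open>T1\<close> entirely inside.\<close>
  define r where "r = min (R/4) (r0/2)"
  have r: "r > 0" "r \<le> R/4" "r \<le> r0/2"
    using R r0 by (auto simp: r_def)

  \<comment> \<open>The bulge vanishes at both ends and has second-order coefficient
    \<open>- \<epsilon>\<close> along \<open>n\<close>, while \<open>T\<close> moves the whole arc
    rigidly. Tangency at a contact point therefore leaves an acceleration along \<open>- n\<close>,
    that is outwards.\<close>
  define \<sigma> where "\<sigma> = (\<lambda>a c \<epsilon> T s. (1 - s) *\<^sub>R a + s *\<^sub>R c + (T + \<epsilon> * (s * (1 - s))) *\<^sub>R n)"
  have arc: "\<psi> (\<sigma> a c \<epsilon> 0 s) < 0"
    if a: "a \<in> S \<inter> ball b r" and c: "c \<in> S \<inter> ball b r" and \<epsilon>: "\<epsilon> > 0" "\<epsilon> * norm n < r"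
      and s: "s \<in> {0..1}" for a c \<epsilon> s
  proof (rule ccontr)
    assume contra: "\<not> \<psi> (\<sigma> a c \<epsilon> 0 s) < 0"
    let ?\<sigma> = "\<sigma> a c \<epsilon>"
    have seg: "(1 - s) *\<^sub>R a + s *\<^sub>R c \<in> ball b r" if "s \<in> {0..1}" for s
      using convexD_alt[OF convex_ball, of a b r c s] a c that by auto
    have bend: "norm ((\<epsilon> * (s * (1 - s))) *\<^sub>R n) < r" if "s \<in> {0..1}" for s
    proof -
      have "\<bar>s * (1 - s)\<bar> \<le> 1"
        using that by (auto simp: abs_mult intro!: mult_le_one)
      then have "\<epsilon> * \<bar>s * (1 - s)\<bar> * norm n \<le> \<epsilon> * 1 * norm n"
        using \<epsilon> by (intro mult_right_mono mult_left_mono) auto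
      moreover have "norm ((\<epsilon> * (s * (1 - s))) *\<^sub>R n) = \<epsilon> * \<bar>s * (1 - s)\<bar> * norm n"
        using \<epsilon> by (simp add: abs_mult)
      ultimately show ?thesis
        using \<epsilon> by linarith
    qed
    have \<sigma>_dist: "dist (?\<sigma> T s) (b + T *\<^sub>R n) < 2 * r" if "s \<in> {0..1}" for s T
    proof -
      have "?\<sigma> T s - (b + T *\<^sub>R n) = ((1 - s) *\<^sub>R a + s *\<^sub>R c - b) + (\<epsilon> * (s * (1 - s))) *\<^sub>R n"
        by (simp add: \<sigma>_def algebra_simps)
      then have "dist (?\<sigma> T s) (b + T *\<^sub>R n)
          \<le> dist b ((1 - s) *\<^sub>R a + s *\<^sub>R c) + norm ((\<epsilon> * (s * (1 - s))) *\<^sub>R n)"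
        unfolding dist_norm norm_minus_commute[of b]
        by (metis norm_triangle_ineq)
      also have "\<dots> < r + r"
        using seg[OF that] bend[OF that] by (intro add_strict_mono) simp_all
      finally show ?thesis
        by simp
    qed
    have \<sigma>_ball: "?\<sigma> T s \<in> ball b R" if "s \<in> {0..1}" "0 \<le> T" "T \<le> T1" for s T
    proof -
      have "T * norm n \<le> R / 4"
        using that T1 by (metis mult_right_mono norm_ge_zero)
      then have "dist b (b + T *\<^sub>R n) \<le> R / 4"
        using that by (simp add: dist_norm)
      then show ?thesis
        using \<sigma>_dist[OF that(1), of T] r R dist_triangle[of b "?\<sigma> T s" "b + T *\<^sub>R n"]
        by (simp add: dist_commute)
    qed
    have \<sigma>_T1: "\<psi> (?\<sigma> T1 s) < 0" if "s \<in> {0..1}" for s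
      by (rule r0(2)) (use \<sigma>_dist[OF that, of T1] r in linarith)
    have \<sigma>_cont: "continuous_on A (\<lambda>p. ?\<sigma> (snd p) (fst p))" for A
      unfolding \<sigma>_def by (intro continuous_intros)
    let ?D = "{0..1} \<times> {0..T1}"
    \<comment> \<open>The points of the translated arcs that are not strictly inside. At
      \<open>T1\<close> there are none, so the largest \<open>T\<close> in this compact set is the
      moment of first contact when the arc descends from \<open>T1\<close>.\<close>
    define K where "K = {p \<in> ?D. \<psi> (?\<sigma> (snd p) (fst p)) \<in> {0..}}"
    have cD: "continuous_on ?D (\<lambda>p. \<psi> (?\<sigma> (snd p) (fst p)))"
      by (rule continuous_on_compose2[OF cont \<sigma>_cont]) (use \<sigma>_ball in auto)
    have "K = ?D \<inter> (\<lambda>p. \<psi> (?\<sigma> (snd p) (fst p))) -` {0..}"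
      by (auto simp: K_def)
    then have "closed K"
      using continuous_closed_preimage[OF cD closed_Times closed_atLeast] by simp
    moreover have "bounded K"
      by (rule bounded_subset[of ?D]) (auto simp: K_def intro: bounded_Times)
    ultimately have "compact K"
      by (simp add: compact_eq_bounded_closed)
    moreover have "(s, 0) \<in> K"
      using contra s T1 by (auto simp: K_def)
    ultimately obtain p where p: "p \<in> K" "\<And>q. q \<in> K \<Longrightarrow> snd q \<le> snd p"
      using continuous_attains_sup[of K snd] continuous_on_snd[OF continuous_on_id] by blast
    obtain s' T where pT: "p = (s', T)" by fastforce
    have s': "s' \<in> {0..1}" and T: "0 \<le> T" "T \<le> T1" and ge: "\<psi> (?\<sigma> T s') \<ge> 0"
      using p(1) pT by (auto simp: K_def)
    have le: "\<psi> (?\<sigma> T s) \<le> 0" if s: "s \<in> {0..1}" for s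
    proof (rule ccontr)
      assume pos: "\<not> \<psi> (?\<sigma> T s) \<le> 0"
      then have "T < T1"
        using \<sigma>_T1[OF s] T by (cases "T = T1") auto
      have "isCont (\<lambda>T. ?\<sigma> T s) T"
        unfolding \<sigma>_def by (intro continuous_intros)
      then have "isCont (\<lambda>T. \<psi> (?\<sigma> T s)) T"
        by (rule isCont_o2) (rule contb[OF \<sigma>_ball[OF s T]])
      then have "((\<lambda>T. \<psi> (?\<sigma> T s)) \<longlongrightarrow> \<psi> (?\<sigma> T s)) (at_right T)"
        by (auto simp: isCont_def intro: filterlim_mono at_le)
      then have "\<forall>\<^sub>F T' in at_right T. \<psi> (?\<sigma> T' s) > 0"
        using pos by (auto intro: order_tendstoD)
      moreover have "\<forall>\<^sub>F T' in at_right T. T' \<in> {T<..<T1}"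
        using \<open>T < T1\<close> by (rule eventually_at_right_real)
      ultimately have "\<forall>\<^sub>F T' in at_right T. \<psi> (?\<sigma> T' s) > 0 \<and> T' \<in> {T<..<T1}"
        by (rule eventually_conj)
      then obtain T' where "\<psi> (?\<sigma> T' s) > 0" "T' \<in> {T<..<T1}"
        using eventually_happens' trivial_limit_at_right_real by blast
      then have "(s, T') \<in> K" "T' > T"
        using s T by (auto simp: K_def)
      with p(2)[of "(s, T')"] pT show False by auto
    qed
    \<comment> \<open>The ends travel along \<open>n\<close>, where \<psi> decreases, so contact
      happens at an interior parameter.\<close>
    have ends: "\<psi> (e + T *\<^sub>R n) < 0" if "e \<in> S \<inter> ball b r" for e
    proof -
      have "e \<in> ball b (R/2)" "\<psi> e < 0"
        using that r R S[of e] by auto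
      then show ?thesis
        using ray[of e T] T by (cases "T = 0") auto
    qed
    have "s' \<noteq> 0" "s' \<noteq> 1"
      using ge ends[OF a] ends[OF c] by (auto simp: \<sigma>_def)
    then have s'01: "0 < s'" "s' < 1"
      using s' by auto
    define y where "y = ?\<sigma> T s'"
    have yb: "y \<in> ball b R" and y0: "\<psi> y = 0"
      using \<sigma>_ball[OF s' T] ge le[OF s'] by (auto simp: y_def)
    define \<xi> where "\<xi> = c - a + (\<epsilon> * (1 - 2 * s')) *\<^sub>R n"
    define w where "w = (- \<epsilon>) *\<^sub>R n"
    have expand: "?\<sigma> T (s' + h) = y + h *\<^sub>R \<xi> + h\<^sup>2 *\<^sub>R w" for h
      by (simp add: \<sigma>_def y_def \<xi>_def w_def algebra_simps power2_eq_square)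
    have near: "\<forall>\<^sub>F h in at 0. s' + h \<in> {0..1}"
      unfolding eventually_at
      by (rule exI[of _ "min s' (1 - s')"]) (use s'01 in \<open>auto simp: dist_real_def\<close>)
    have "((\<lambda>h. \<psi> (y + h *\<^sub>R \<xi> + h\<^sup>2 *\<^sub>R w)) has_derivative (\<lambda>h. \<psi>' y (h *\<^sub>R \<xi>))) (at 0)"
      by (rule has_derivative_compose[of "\<lambda>h. y + h *\<^sub>R \<xi> + h\<^sup>2 *\<^sub>R w"])
        (use der[OF yb] in \<open>auto intro!: derivative_eq_intros\<close>)
    then have "((\<lambda>h. \<psi> (y + h *\<^sub>R \<xi> + h\<^sup>2 *\<^sub>R w)) has_real_derivative \<psi>' y \<xi>) (at 0)"
      using lin[OF yb] by (simp add: has_field_derivative_def linear_scale mult.commute[of _ "\<psi>' y \<xi>"])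
    \<comment> \<open>At the moment of contact \<psi> is nonpositive on the whole arc and zero at
      \<open>s'\<close>, so the arc is tangent to the boundary there.\<close>
    then have "\<psi>' y \<xi> = 0"
    proof (rule DERIV_local_max)
      show "\<forall>h. \<bar>0 - h\<bar> < min s' (1 - s') \<longrightarrow>
          \<psi> (y + h *\<^sub>R \<xi> + h\<^sup>2 *\<^sub>R w) \<le> \<psi> (y + 0 *\<^sub>R \<xi> + 0\<^sup>2 *\<^sub>R w)"
      proof (intro allI impI)
        fix h assume "\<bar>0 - h\<bar> < min s' (1 - s')"
        then have "s' + h \<in> {0..1}"
          by auto
        from le[OF this] show "\<psi> (y + h *\<^sub>R \<xi> + h\<^sup>2 *\<^sub>R w) \<le> \<psi> (y + 0 *\<^sub>R \<xi> + 0\<^sup>2 *\<^sub>R w)"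
          using y0 unfolding expand by simp
      qed
    qed (use s'01 in auto)
    moreover have "\<psi>' y w > 0"
      using neg[OF yb] \<epsilon> lin[OF yb] by (simp add: w_def linear_neg linear_scale mult_pos_neg)
    ultimately have "\<forall>\<^sub>F h in at 0. \<psi> (y + h *\<^sub>R \<xi> + h\<^sup>2 *\<^sub>R w) > 0"
      using second[OF yb y0] by blast
    with near have "\<forall>\<^sub>F h in at (0::real). False"
    proof eventually_elim
      case (elim h)
      show False
        using le[OF elim(1)] elim(2) unfolding expand by simp
    qed
    then show False
      by simp
  qed

  have segment: "(1 - s) *\<^sub>R a + s *\<^sub>R c \<in> closure S"
    if a: "a \<in> S \<inter> ball b r" and c: "c \<in> S \<inter> ball b r" and s: "s \<in> {0..1}" for a c s
  proof -
    have ub: "(1 - s) *\<^sub>R a + s *\<^sub>R c \<in> ball b R"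
      using convexD_alt[OF convex_ball, of a b r c s] a c s r R by auto
    have "isCont (\<lambda>\<epsilon>. \<sigma> a c \<epsilon> 0 s) 0"
      unfolding \<sigma>_def by (intro continuous_intros)
    then have "isCont (\<lambda>\<epsilon>. \<psi> (\<sigma> a c \<epsilon> 0 s)) 0"
      by (rule isCont_o2) (use contb[OF ub] in \<open>simp add: \<sigma>_def\<close>)
    then have "((\<lambda>\<epsilon>. \<psi> (\<sigma> a c \<epsilon> 0 s)) \<longlongrightarrow> \<psi> (\<sigma> a c 0 0 s)) (at_right 0)"
      by (auto simp: isCont_def intro: filterlim_mono at_le)
    moreover have "\<forall>\<^sub>F \<epsilon> in at_right 0. \<epsilon> \<in> {0<..<r / norm n}"
      using r n0 by (intro eventually_at_right_real) simp
    then have "\<forall>\<^sub>F \<epsilon> in at_right 0. \<psi> (\<sigma> a c \<epsilon> 0 s) \<le> 0"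
      by eventually_elim (use arc[OF a c _ _ s] n0 in \<open>simp add: field_simps less_imp_le\<close>)
    ultimately have "\<psi> (\<sigma> a c 0 0 s) \<le> 0"
      by (intro tendsto_upperbound) auto
    with clS[OF ub] show ?thesis
      by (simp add: \<sigma>_def)
  qed

  have "convex (closure S \<inter> ball b r)"
    unfolding convex_alt
  proof (intro ballI allI impI)
    fix a c s assume a: "a \<in> closure S \<inter> ball b r" and c: "c \<in> closure S \<inter> ball b r"
      and s: "0 \<le> s \<and> s \<le> (1::real)"
    \<comment> \<open>A function of the pair of end points, so that both pass to the closure at
      once.\<close>
    define f where "f = (\<lambda>p. (1 - s) *\<^sub>R fst p + s *\<^sub>R (snd p :: 'a))"
    have "f ` closure ((S \<inter> ball b r) \<times> (S \<inter> ball b r)) \<subseteq> closure S"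
    proof (rule image_closure_subset)
      show "f ` ((S \<inter> ball b r) \<times> (S \<inter> ball b r)) \<subseteq> closure S"
        using segment s by (force simp: f_def)
    qed (auto simp: f_def intro!: continuous_intros)
    moreover have "closure S \<inter> ball b r \<subseteq> closure (S \<inter> ball b r)"
      using open_Int_closure_subset[of "ball b r" S] by (simp add: Int_commute)
    ultimately have "f (a, c) \<in> closure S"
      using a c unfolding closure_Times by blast
    moreover have "(1 - s) *\<^sub>R a + s *\<^sub>R c \<in> ball b r"
      using convexD_alt[OF convex_ball, of a b r c s] a c s by auto
    ultimately show "(1 - s) *\<^sub>R a + s *\<^sub>R c \<in> closure S \<inter> ball b r"
      by (simp add: f_def)
  qed
  with r show ?thesis
    by blast
qed

text \<open>Local convexity is available only for the closure. It transfers back because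
  \<open>S\<close> is the interior of its closure: behind a boundary point, in direction
  \<open>- n\<close>, the function \<psi> is positive, so points outside the closure lie arbitrarily
  near.\<close>

theorem convex_if_convex_boundary:
  fixes S :: "'a::euclidean_space set"
  assumes "open S" "connected S" "bounded S"
    and bd: "\<And>b. b \<in> frontier S \<Longrightarrow> convex_boundary_at S b"
  shows "convex S"
proof -
  have "convex (closure S)"
  proof (rule compact_connected_locally_convex_imp_convex)
    show "compact (closure S)" "connected (closure S)"
      using assms by (auto intro: connected_imp_connected_closure)
    fix x assume x: "x \<in> closure S"
    show "\<exists>r>0. convex (closure S \<inter> ball x r)"
    proof (cases "x \<in> S")
      case True
      then obtain r where "r > 0" "ball x r \<subseteq> S"
        using \<open>open S\<close> open_contains_ball by blast
      then show ?thesis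
        by (metis closure_subset convex_ball inf.absorb2 order_trans)
    next
      case False
      with x \<open>open S\<close> have "x \<in> frontier S"
        by (simp add: frontier_def interior_open)
      then show ?thesis
        using bd convex_boundary_at_imp_locally_convex by blast
    qed
  qed
  moreover have "interior (closure S) = S"
  proof
    show "S \<subseteq> interior (closure S)"
      using \<open>open S\<close> by (simp add: closure_subset interior_maximal)
    show "interior (closure S) \<subseteq> S"
    proof
      fix b assume b: "b \<in> interior (closure S)"
      show "b \<in> S"
      proof (rule ccontr)
        assume "b \<notin> S"
        with b interior_subset \<open>open S\<close> have "b \<in> frontier S"
          by (auto simp: frontier_def interior_open)
        from bd[OF this] obtain R \<psi> \<psi>' n where R: "R > 0" "\<psi> b = (0::real)"
          and der: "\<And>y. y \<in> ball b R \<Longrightarrow> (\<psi> has_derivative \<psi>' y) (at y)"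
          and neg: "\<And>y. y \<in> ball b R \<Longrightarrow> \<psi>' y n < 0"
          and clS: "\<And>y. y \<in> ball b R \<Longrightarrow> y \<in> closure S \<longleftrightarrow> \<psi> y \<le> 0"
          unfolding convex_boundary_at_def by blast
        obtain \<rho> where \<rho>: "\<rho> > 0" "ball b \<rho> \<subseteq> closure S" "\<rho> \<le> R"
        proof -
          obtain \<rho>' where "\<rho>' > 0" "ball b \<rho>' \<subseteq> closure S"
            using b by (auto simp: mem_interior)
          then show ?thesis
            using R by (intro that[of "min \<rho>' R"]) auto
        qed
        have "n \<noteq> 0"
          using neg[of b] R has_derivative_linear[OF der[of b]] by (auto simp: linear_0)
        define T where "T = \<rho> / (2 * norm n)"
        have T: "T > 0" "T * norm n = \<rho> / 2"
          using \<open>n \<noteq> 0\<close> \<rho> by (auto simp: T_def)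
        define y where "y = b - T *\<^sub>R n"
        have "\<psi> (y + T *\<^sub>R n) < \<psi> y"
        proof (rule decreasing_along_ray[where \<psi>' = \<psi>'])
          fix t assume t: "0 \<le> t" "t \<le> T"
          have "b - (y + t *\<^sub>R n) = (T - t) *\<^sub>R n"
            by (simp add: y_def algebra_simps)
          moreover have "(T - t) * norm n \<le> \<rho> / 2"
            using mult_right_mono[of "T - t" T "norm n"] t T by simp
          ultimately have "y + t *\<^sub>R n \<in> ball b R"
            using t \<rho> by (simp add: dist_norm)
          then show "(\<psi> has_derivative \<psi>' (y + t *\<^sub>R n)) (at (y + t *\<^sub>R n))"
              "\<psi>' (y + t *\<^sub>R n) n < 0"
            using der neg by auto
        qed (use T in auto)
        then have "\<psi> y > 0"
          using R by (simp add: y_def)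
        moreover have "y \<in> ball b \<rho>"
          using T \<rho> by (simp add: y_def dist_norm)
        ultimately show False
          using clS[of y] \<rho> by force
      qed
    qed
  qed
  ultimately show ?thesis
    by (metis convex_interior)
qed

section \<open>Second derivatives and the inverse function theorem\<close>

abbreviation dd :: "'a::real_normed_vector \<Rightarrow> ('a \<Rightarrow> 'b::real_normed_vector) \<Rightarrow> 'a \<Rightarrow> 'b" where
  "dd v f x \<equiv> frechet_derivative f (at x) v"

lemma pd_eq_dd: "pd i f = dd (axis i 1) f"
  by (simp add: pd_def fun_eq_iff)

lemma dd_eqI: "(f has_derivative f') (at x) \<Longrightarrow> dd v f x = f' v"
  by (simp add: frechet_derivative_at[symmetric])

lemma dd_cong_open:
  "open S \<Longrightarrow> x \<in> S \<Longrightarrow> (\<And>y. y \<in> S \<Longrightarrow> f y = g y) \<Longrightarrow> f differentiable (at x) \<Longrightarrow> dd v f x = dd v g x"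
  by (rule arg_cong[where f = "\<lambda>f'. f' v"], rule frechet_derivative_transform_within_open) auto

lemma dd_compose:
  assumes "(e has_derivative e') (at x)" "f differentiable (at (e x))"
  shows "dd v (\<lambda>x. f (e x)) x = dd (e' v) f (e x)"
    and "(\<lambda>x. f (e x)) differentiable (at x)"
proof -
  have "((\<lambda>x. f (e x)) has_derivative (\<lambda>v. dd (e' v) f (e x))) (at x)"
    by (rule has_derivative_compose[OF assms(1)]) (use assms(2) frechet_derivative_works in blast)
  then show "dd v (\<lambda>x. f (e x)) x = dd (e' v) f (e x)" "(\<lambda>x. f (e x)) differentiable (at x)"
    by (auto simp: dd_eqI intro: differentiableI)
qed

lemma dd_line:
  fixes f :: "'a::real_normed_vector \<Rightarrow> real"
  assumes "f differentiable (at (p + r *\<^sub>R v))"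
  shows "((\<lambda>r. f (p + r *\<^sub>R v)) has_real_derivative dd v f (p + r *\<^sub>R v)) (at r)"
proof -
  have "((\<lambda>r. f (p + r *\<^sub>R v)) has_derivative (\<lambda>h. dd (h *\<^sub>R v) f (p + r *\<^sub>R v))) (at r)"
    by (rule has_derivative_compose[of "\<lambda>r. p + r *\<^sub>R v"])
      (use assms frechet_derivative_works in \<open>auto intro!: derivative_eq_intros\<close>)
  then show ?thesis
    using linear_frechet_derivative[OF assms]
    by (simp add: has_field_derivative_def linear_scale mult.commute[of _ "dd v f (p + r *\<^sub>R v)"])
qed

lemma Ck_on_SucD:
  assumes "Ck_on (Suc k) f S"
  shows "x \<in> S \<Longrightarrow> f differentiable (at x)" "Ck_on k (dd v f) S"
  using assms by auto

lemma Ck_on_2D: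
  assumes "Ck_on 2 f S"
  shows "x \<in> S \<Longrightarrow> f differentiable (at x)" "x \<in> S \<Longrightarrow> dd v f differentiable (at x)"
    "continuous_on S (dd v (dd w f))"
  using assms by (auto simp: numeral_2_eq_2)

lemma Ck_on_cong:
  assumes "open S" "\<And>x. x \<in> S \<Longrightarrow> f x = g x" "Ck_on k f S"
  shows "Ck_on k g S"
  using assms(2,3)
proof (induction k arbitrary: f g)
  case 0
  then show ?case
    by (metis Ck_on.simps(1) continuous_on_cong)
next
  case (Suc k)
  have d: "f differentiable (at x)" if "x \<in> S" for x
    using Suc.prems that by auto
  have "g differentiable (at x)" if x: "x \<in> S" for x
  proof -
    obtain D where "(f has_derivative D) (at x)"
      using d[OF x] by (auto simp: differentiable_def)
    from has_derivative_transform_within_open[OF this \<open>open S\<close> x Suc.prems(1)]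
    show ?thesis
      by (rule differentiableI)
  qed
  moreover have "Ck_on k (dd v g) S" for v
  proof (rule Suc.IH[of "dd v f"])
    show "dd v f x = dd v g x" if "x \<in> S" for x
      using \<open>open S\<close> that Suc.prems(1) d[OF that] by (rule dd_cong_open)
  qed (use Suc.prems in auto)
  ultimately show ?case
    by simp
qed

lemma open_slice:
  assumes "open S"
  shows "open {x. (x, c) \<in> S}"
proof -
  have "open ((\<lambda>x. (x, c)) -` S)"
    by (rule open_vimage[OF assms]) (intro continuous_intros)
  then show ?thesis
    by (simp add: vimage_def)
qed

text \<open>The induction varies \<open>f\<close>, because the derivative of a slice along
  \<open>v\<close> is the slice of the derivative along \<open>(v, 0)\<close>.\<close>

lemma Ck_on_slice:
  fixes f :: "'a::real_normed_vector \<times> 'c::real_normed_vector \<Rightarrow> 'b::real_normed_vector"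
  assumes "open S" "Ck_on k f S"
  shows "Ck_on k (\<lambda>x. f (x, c)) {x. (x, c) \<in> S}"
  using assms(2)
proof (induction k arbitrary: f)
  case 0
  show ?case
    unfolding Ck_on.simps
    by (rule continuous_on_compose2[of S f]) (use 0 in \<open>auto intro!: continuous_intros\<close>)
next
  case (Suc k)
  have *: "((\<lambda>x. (x, c)) has_derivative (\<lambda>v. (v, 0))) (at x)" for x :: 'a
    by (auto intro!: derivative_eq_intros)
  have "(\<lambda>x. f (x, c)) differentiable (at x)" if "(x, c) \<in> S" for x
    by (rule dd_compose(2)[OF *]) (use Suc.prems that in auto)
  moreover have "Ck_on k (dd v (\<lambda>x. f (x, c))) {x. (x, c) \<in> S}" for v
  proof (rule Ck_on_cong[OF open_slice[OF assms(1)]])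
    show "Ck_on k (\<lambda>x. dd (v, 0) f (x, c)) {x. (x, c) \<in> S}"
      by (rule Suc.IH) (use Suc.prems in auto)
    show "dd (v, 0) f (x, c) = dd v (\<lambda>x. f (x, c)) x" if "x \<in> {x. (x, c) \<in> S}" for x
      using dd_compose(1)[OF *, of f x v] Suc.prems that by auto
  qed
  ultimately show ?case
    by simp
qed

section \<open>Symmetry of second derivatives and Taylor expansion along curves\<close>

text \<open>The mean value theorem is applied twice: along \<open>v\<close> to the difference of two
  translates by \<open>h *\<^sub>R w\<close>, then along \<open>w\<close> to the
  \<open>v\<close>-derivative. The left-hand side is symmetric in \<open>v\<close> and
  \<open>w\<close> while the right-hand side is not, which is what \<open>dd_commute\<close>
  exploits.\<close>

lemma second_difference:
  fixes f :: "'a::real_normed_vector \<Rightarrow> real"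
  assumes f: "Ck_on 2 f S" and S: "ball p \<delta> \<subseteq> S" and h: "h > 0" "h * (norm v + norm w) < \<delta>"
  shows "\<exists>a\<in>ball p \<delta>. f (p + h *\<^sub>R v + h *\<^sub>R w) - f (p + h *\<^sub>R v) - f (p + h *\<^sub>R w) + f p
    = h\<^sup>2 * dd w (dd v f) a"
proof -
  have inb: "p + r *\<^sub>R v + s *\<^sub>R w \<in> ball p \<delta>" if "0 \<le> r" "r \<le> h" "0 \<le> s" "s \<le> h" for r s
  proof -
    have "norm (r *\<^sub>R v + s *\<^sub>R w) \<le> r * norm v + s * norm w"
      using norm_triangle_ineq[of "r *\<^sub>R v" "s *\<^sub>R w"] that by simp
    also have "\<dots> \<le> h * norm v + h * norm w"
      using that by (intro add_mono mult_right_mono) auto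
    finally show ?thesis
      using h by (simp add: dist_norm distrib_left norm_minus_commute add.assoc flip: norm_minus_cancel[of "r *\<^sub>R v + s *\<^sub>R w"])
  qed
  have diff: "f differentiable (at y)" "dd v f differentiable (at y)" if "y \<in> ball p \<delta>" for y
    using Ck_on_2D[OF f] that S by blast+
  have "\<exists>r. 0 < r \<and> r < h \<and> (f (p + h *\<^sub>R w + h *\<^sub>R v) - f (p + h *\<^sub>R v)) - (f (p + h *\<^sub>R w + 0 *\<^sub>R v) - f (p + 0 *\<^sub>R v))
      = (h - 0) * (dd v f (p + h *\<^sub>R w + r *\<^sub>R v) - dd v f (p + r *\<^sub>R v))"
  proof (rule MVT2[OF h(1)])
    fix r assume r: "0 \<le> r" "r \<le> h"
    show "((\<lambda>r. f (p + h *\<^sub>R w + r *\<^sub>R v) - f (p + r *\<^sub>R v)) has_real_derivative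
        dd v f (p + h *\<^sub>R w + r *\<^sub>R v) - dd v f (p + r *\<^sub>R v)) (at r)"
      using inb[of r h] inb[of r 0] r h
      by (intro DERIV_diff dd_line diff) (simp_all add: algebra_simps)
  qed
  then obtain r where r: "0 < r" "r < h"
    and 1: "f (p + h *\<^sub>R w + h *\<^sub>R v) - f (p + h *\<^sub>R v) - f (p + h *\<^sub>R w) + f p
      = h * (dd v f (p + h *\<^sub>R w + r *\<^sub>R v) - dd v f (p + r *\<^sub>R v))"
    by auto
  have "\<exists>s. 0 < s \<and> s < h \<and> dd v f (p + r *\<^sub>R v + h *\<^sub>R w) - dd v f (p + r *\<^sub>R v + 0 *\<^sub>R w)
      = (h - 0) * dd w (dd v f) (p + r *\<^sub>R v + s *\<^sub>R w)"
    by (rule MVT2[OF h(1)]) (intro dd_line diff inb, use r in auto)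
  then obtain s where s: "0 < s" "s < h"
    and 2: "dd v f (p + r *\<^sub>R v + h *\<^sub>R w) - dd v f (p + r *\<^sub>R v)
      = h * dd w (dd v f) (p + r *\<^sub>R v + s *\<^sub>R w)"
    by auto
  have e: "p + h *\<^sub>R w + r *\<^sub>R v = p + r *\<^sub>R v + h *\<^sub>R w" for r
    by (simp add: algebra_simps)
  show ?thesis
    using 1 2 inb[of r s] r s unfolding e
    by (intro bexI[of _ "p + r *\<^sub>R v + s *\<^sub>R w"]) (auto simp: power2_eq_square)
qed

lemma dd_commute:
  fixes f :: "'a::real_normed_vector \<Rightarrow> real"
  assumes f: "Ck_on 2 f S" and S: "open S" "p \<in> S"
  shows "dd v (dd w f) p = dd w (dd v f) p"
proof (rule ccontr)
  let ?A = "dd w (dd v f)" and ?B = "dd v (dd w f)"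
  assume "?B p \<noteq> ?A p"
  define e where "e = dist (?A p) (?B p) / 2"
  have "e > 0"
    using \<open>?B p \<noteq> ?A p\<close> by (simp add: e_def)
  have near: "\<exists>\<delta>>0. \<forall>y. dist y p < \<delta> \<longrightarrow> dist (dd a (dd b f) y) (dd a (dd b f) p) < e" for a b
    using Ck_on_2D(3)[OF f, where v = a and w = b] S \<open>e > 0\<close>
    by (simp add: continuous_on_eq_continuous_at continuous_at_eps_delta)
  obtain \<delta>1 where \<delta>1: "\<delta>1 > 0" "\<And>y. dist y p < \<delta>1 \<Longrightarrow> dist (?A y) (?A p) < e"
    using near by blast
  obtain \<delta>2 where \<delta>2: "\<delta>2 > 0" "\<And>y. dist y p < \<delta>2 \<Longrightarrow> dist (?B y) (?B p) < e"
    using near by blast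
  obtain \<delta>3 where \<delta>3: "\<delta>3 > 0" "ball p \<delta>3 \<subseteq> S"
    using S open_contains_ball by blast
  define \<delta> where "\<delta> = min \<delta>1 (min \<delta>2 \<delta>3)"
  have \<delta>: "\<delta> > 0" "\<delta> \<le> \<delta>1" "\<delta> \<le> \<delta>2" "ball p \<delta> \<subseteq> S"
    using \<delta>1 \<delta>2 \<delta>3 by (auto simp: \<delta>_def)
  \<comment> \<open>The summand 1 keeps the denominator positive even if \<open>v\<close> and
    \<open>w\<close> vanish, and the factor 2 leaves the parallelogram well inside the ball of
    radius \<delta>.\<close>
  define h where "h = \<delta> / (2 * (norm v + norm w + 1))"
  have pos: "norm v + norm w + 1 > 0"
    by (simp add: add_nonneg_pos)
  then have h: "h > 0"
    using \<delta> by (simp add: h_def)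
  have "h * (norm v + norm w) < h * (norm v + norm w + 1)"
    using h by simp
  also have "\<dots> = \<delta> / 2"
    using pos by (simp add: h_def field_simps)
  finally have hs: "h * (norm v + norm w) < \<delta>" "h * (norm w + norm v) < \<delta>"
    using \<delta> by (simp_all add: add.commute)
  obtain a where a: "a \<in> ball p \<delta>" "f (p + h *\<^sub>R v + h *\<^sub>R w) - f (p + h *\<^sub>R v) - f (p + h *\<^sub>R w) + f p
      = h\<^sup>2 * ?A a"
    using second_difference[OF f \<delta>(4) h hs(1)] by blast
  obtain b where b: "b \<in> ball p \<delta>" "f (p + h *\<^sub>R w + h *\<^sub>R v) - f (p + h *\<^sub>R w) - f (p + h *\<^sub>R v) + f p
      = h\<^sup>2 * ?B b"
    using second_difference[OF f \<delta>(4) h hs(2)] by blast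
  have "p + h *\<^sub>R w + h *\<^sub>R v = p + h *\<^sub>R v + h *\<^sub>R w"
    by (simp add: algebra_simps)
  with a(2) b(2) have "h\<^sup>2 * ?A a = h\<^sup>2 * ?B b"
    by (simp only:)
  then have "?A a = ?B b"
    using h by simp
  moreover have "dist (?A a) (?A p) < e" "dist (?B b) (?B p) < e"
    using \<delta>1(2)[of a] \<delta>2(2)[of b] a b \<delta> by (auto simp: dist_commute)
  ultimately have "dist (?A a) (?A p) < dist (?A p) (?B p) / 2" "dist (?A a) (?B p) < dist (?A p) (?B p) / 2"
    by (simp_all add: e_def)
  then have "dist (?A p) (?B p) < dist (?A p) (?B p)"
    by (rule dist_triangle_half_r)
  then show False
    by simp
qed

lemma dd_axis_expand:
  fixes f :: "real^'n::finite \<Rightarrow> real"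
  assumes "f differentiable (at x)"
  shows "dd u f x = (\<Sum>j\<in>UNIV. u $ j * pd j f x)"
proof -
  have "dd u f x = dd (\<Sum>j\<in>UNIV. u $ j *\<^sub>R axis j 1) f x"
    using basis_expansion[of u] by (simp add: scalar_mult_eq_scaleR)
  also have "\<dots> = (\<Sum>j\<in>UNIV. u $ j * pd j f x)"
    using linear_frechet_derivative[OF assms] by (simp add: linear_sum linear_scale pd_def)
  finally show ?thesis .
qed

text \<open>Expanded in coordinates instead of iterated along \<open>u\<close>, because in the
  Taylor remainder along a curve both the base point and the direction vary and the limit is taken
  coefficientwise.\<close>

definition hess :: "(real^'n::finite \<Rightarrow> real) \<Rightarrow> real^'n \<Rightarrow> real^'n \<Rightarrow> real" where
  "hess f x u = (\<Sum>i\<in>UNIV. \<Sum>j\<in>UNIV. u $ i * u $ j * pd i (pd j f) x)"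

lemma dd_dd_eq_hess:
  fixes f :: "real^'n::finite \<Rightarrow> real"
  assumes f: "Ck_on 2 f S" and S: "open S" "x \<in> S"
  shows "dd u (dd u f) x = hess f x u"
proof -
  have d: "pd j f differentiable (at x)" for j
    using Ck_on_2D(2)[OF f S(2)] by (simp add: pd_eq_dd)
  have "dd u (dd u f) x = dd u (\<lambda>y. \<Sum>j\<in>UNIV. u $ j * pd j f y) x"
    by (rule dd_cong_open[OF S])
      (intro dd_axis_expand Ck_on_2D(1)[OF f] Ck_on_2D(2)[OF f] S | assumption)+
  also have "((\<lambda>y. \<Sum>j\<in>UNIV. u $ j * pd j f y) has_derivative
      (\<lambda>v. \<Sum>j\<in>UNIV. u $ j * dd v (pd j f) x)) (at x)"
    using d by (intro has_derivative_sum has_derivative_mult_right) (simp add: frechet_derivative_works)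
  then have "dd u (\<lambda>y. \<Sum>j\<in>UNIV. u $ j * pd j f y) x = (\<Sum>j\<in>UNIV. u $ j * dd u (pd j f) x)"
    by (rule dd_eqI)
  also have "\<dots> = (\<Sum>j\<in>UNIV. u $ j * (\<Sum>i\<in>UNIV. u $ i * pd i (pd j f) x))"
    by (simp add: dd_axis_expand[OF d])
  also have "\<dots> = (\<Sum>j\<in>UNIV. \<Sum>i\<in>UNIV. u $ i * u $ j * pd i (pd j f) x)"
    by (simp add: sum_distrib_left mult_ac)
  finally show ?thesis
    by (simp add: hess_def sum.swap[of "\<lambda>i j. u $ i * u $ j * pd i (pd j f) x"])
qed

lemma taylor_2:
  fixes f :: "real^'n::finite \<Rightarrow> real"
  assumes f: "Ck_on 2 f S" and S: "ball x \<delta> \<subseteq> S" "open S" and u: "norm u < \<delta>"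
  shows "\<exists>t. 0 \<le> t \<and> t \<le> 1 \<and> f (x + u) = f x + dd u f x + hess f (x + t *\<^sub>R u) u / 2"
proof -
  have inS: "x + t *\<^sub>R u \<in> S" if "0 \<le> t" "t \<le> 1" for t
  proof -
    have "t * norm u \<le> 1 * norm u"
      using that by (intro mult_right_mono) auto
    then have "x + t *\<^sub>R u \<in> ball x \<delta>"
      using that u by (simp add: dist_norm)
    with S show ?thesis by blast
  qed
  define D where "D = (\<lambda>m. if m = (0::nat) then (\<lambda>t. f (x + t *\<^sub>R u)) else if m = 1 then (\<lambda>t. dd u f (x + t *\<^sub>R u))
    else (\<lambda>t. dd u (dd u f) (x + t *\<^sub>R u)))"
  have "\<exists>t. 0 < t \<and> t < 1 \<and> D 0 1 = (\<Sum>m<2. D m 0 / fact m * 1 ^ m) + D 2 t / fact 2 * 1 ^ 2"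
  proof (rule Maclaurin)
    show "\<forall>m t. m < 2 \<and> 0 \<le> t \<and> t \<le> 1 \<longrightarrow> (D m has_real_derivative D (Suc m) t) (at t)"
    proof (intro allI impI)
      fix m :: nat and t :: real assume *: "m < 2 \<and> 0 \<le> t \<and> t \<le> 1"
      then have "x + t *\<^sub>R u \<in> S"
        using inS by blast
      then have "f differentiable (at (x + t *\<^sub>R u))" "dd u f differentiable (at (x + t *\<^sub>R u))"
        using Ck_on_2D[OF f] by blast+
      then show "(D m has_real_derivative D (Suc m) t) (at t)"
        using * by (cases m) (auto simp: D_def intro!: dd_line)
    qed
  qed auto
  then obtain t where t: "0 < t" "t < 1" "D 0 1 = D 0 0 + D 1 0 + D 2 t / 2"
    by (auto simp: numeral_2_eq_2)
  then show ?thesis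
    using dd_dd_eq_hess[OF f S(2) inS[of t]]
    by (intro exI[of _ t]) (auto simp: D_def)
qed

lemma has_vector_derivative_quotient:
  fixes c :: "real \<Rightarrow> real^'n::finite"
  assumes "(c has_vector_derivative \<tau>) (at 0)"
  shows "((\<lambda>s. (c s $ i - c 0 $ i) / s) \<longlongrightarrow> \<tau> $ i) (at 0)"
proof -
  have "((\<lambda>s. c s $ i) has_vector_derivative \<tau> $ i) (at 0)"
    by (rule bounded_linear.has_vector_derivative[OF bounded_linear_vec_nth assms])
  then show ?thesis
    by (simp add: has_real_derivative_iff_has_vector_derivative[symmetric] DERIV_def)
qed

text \<open>The curve is only differentiable at 0, so the first-order term
  \<open>dd (c s - x) f x\<close> need not have a second-order expansion and is left exact. For two
  functions with proportional gradients at \<open>x\<close> these terms cancel in a linear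
  combination, which is how the lemma is used.\<close>

lemma taylor_along_curve:
  fixes f :: "real^'n::finite \<Rightarrow> real"
  assumes f: "Ck_on 2 f S" and S: "open S" "x \<in> S"
    and c: "(c has_vector_derivative \<tau>) (at 0)" "c 0 = x"
  shows "((\<lambda>s. (f (c s) - f x - dd (c s - x) f x) / s\<^sup>2) \<longlongrightarrow> hess f x \<tau> / 2) (at 0)"
proof -
  obtain \<delta> where \<delta>: "\<delta> > 0" "ball x \<delta> \<subseteq> S"
    using S open_contains_ball by blast
  \<comment> \<open>The intermediate point is chosen as a function of the increment, so that along
    the curve it becomes a function of \<open>s\<close> tending to \<open>x\<close>.\<close>
  define T where "T = (\<lambda>u. SOME t. 0 \<le> t \<and> t \<le> 1 \<and> f (x + u) = f x + dd u f x + hess f (x + t *\<^sub>R u) u / 2)"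
  have T: "0 \<le> T u \<and> T u \<le> 1 \<and> f (x + u) = f x + dd u f x + hess f (x + T u *\<^sub>R u) u / 2"
    if "norm u < \<delta>" for u
    unfolding T_def using taylor_2[OF f \<delta>(2) S(1) that] by (rule someI_ex)
  have "continuous (at 0) c"
    using c(1) by (rule has_vector_derivative_continuous)
  then have c0: "((\<lambda>s. c s - x) \<longlongrightarrow> 0) (at 0)"
    using c(2) LIM_zero by (auto simp: isCont_def)
  have near: "\<forall>\<^sub>F s in at 0. norm (c s - x) < \<delta>"
    using tendstoD[OF c0 \<delta>(1)] by (simp add: dist_norm)
  define y where "y = (\<lambda>s. x + T (c s - x) *\<^sub>R (c s - x))"
  have "((\<lambda>s. y s - x) \<longlongrightarrow> 0) (at 0)"
  proof (rule Lim_null_comparison)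
    show "\<forall>\<^sub>F s in at 0. norm (y s - x) \<le> norm (c s - x)"
      using near
    proof eventually_elim
      case (elim s)
      have "\<bar>T (c s - x)\<bar> * norm (c s - x) \<le> 1 * norm (c s - x)"
        using T[OF elim] by (intro mult_right_mono) auto
      then show ?case
        by (simp add: y_def)
    qed
    show "((\<lambda>s. norm (c s - x)) \<longlongrightarrow> 0) (at 0)"
      using c0 by (rule tendsto_norm_zero)
  qed
  then have y: "(y \<longlongrightarrow> x) (at 0)"
    using LIM_zero_iff by blast
  have h: "((\<lambda>s. pd i (pd j f) (y s)) \<longlongrightarrow> pd i (pd j f) x) (at 0)" for i j
  proof -
    have "isCont (pd i (pd j f)) x"
      using Ck_on_2D(3)[OF f] S by (simp add: pd_eq_dd continuous_on_eq_continuous_at)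
    then show ?thesis
      using y by (rule isCont_tendsto_compose)
  qed
  have q: "((\<lambda>s. (c s $ i - x $ i) / s) \<longlongrightarrow> \<tau> $ i) (at 0)" for i
    using has_vector_derivative_quotient[OF c(1), of i] c(2) by simp
  have "((\<lambda>s. (\<Sum>i\<in>UNIV. \<Sum>j\<in>UNIV. ((c s $ i - x $ i) / s) * ((c s $ j - x $ j) / s) * pd i (pd j f) (y s)) / 2)
      \<longlongrightarrow> hess f x \<tau> / 2) (at 0)"
    unfolding hess_def by (intro tendsto_divide tendsto_sum tendsto_mult q h tendsto_const) simp
  then show ?thesis
  proof (rule Lim_transform_eventually)
    show "\<forall>\<^sub>F s in at 0. (\<Sum>i\<in>UNIV. \<Sum>j\<in>UNIV. ((c s $ i - x $ i) / s) * ((c s $ j - x $ j) / s) * pd i (pd j f) (y s)) / 2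
        = (f (c s) - f x - dd (c s - x) f x) / s\<^sup>2"
      using near
    proof eventually_elim
      case (elim s)
      have "f (c s) - f x - dd (c s - x) f x = hess f (y s) (c s - x) / 2"
        using T[OF elim] by (simp add: y_def)
      then show ?case
        by (simp add: hess_def sum_divide_distrib power2_eq_square field_simps)
    qed
  qed
qed

section \<open>Inverse function theorem\<close>

text \<open>In finite dimension, injectivity of the derivative at one point already makes it
  invertible. The last conclusion, convergence of the inverse derivative at the image point, later
  preserves the sign of a transported derivative in a full neighbourhood of a boundary
  point.\<close>

lemma inverse_function_injective:
  fixes f :: "'a::euclidean_space \<Rightarrow> 'a"
  assumes U: "open U" "x0 \<in> U"
    and der: "\<And>x. x \<in> U \<Longrightarrow> (f has_derivative f' x) (at x)"
    and cont: "\<And>v. continuous_on U (\<lambda>x. f' x v)"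
    and inj: "\<And>v. f' x0 v = 0 \<Longrightarrow> v = 0"
  obtains U' V g g' where "open U'" "U' \<subseteq> U" "x0 \<in> U'" "open V" "f x0 \<in> V" "homeomorphism U' V f g"
    "\<And>y. y \<in> V \<Longrightarrow> (g has_derivative g' y) (at y)"
    "\<And>y v. y \<in> V \<Longrightarrow> f' (g y) (g' y v) = v"
    "\<And>v. ((\<lambda>y. g' y v) \<longlongrightarrow> g' (f x0) v) (at (f x0))"
proof -
  \<comment> \<open>The derivative is needed as a map continuous in operator norm; in finite
    dimension this follows from continuity on each basis vector.\<close>
  define F where "F = (\<lambda>x. Blinfun (f' x))"
  have F: "blinfun_apply (F x) = f' x" if "x \<in> U" for x
    using has_derivative_bounded_linear[OF der[OF that]] by (simp add: F_def bounded_linear_Blinfun_apply)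
  have contF: "continuous_on U F"
  proof (rule continuous_on_blinfun_componentwise)
    fix i :: 'a
    show "continuous_on U (\<lambda>x. F x i)"
      using cont[of i] by (rule continuous_on_eq) (simp add: F)
  qed
  have lin0: "linear (f' x0)"
    using der[OF U(2)] by (rule has_derivative_linear)
  have inj0: "inj (f' x0)"
    using inj lin0 by (simp add: linear_injective_0)
  obtain k where k: "linear k" "k \<circ> f' x0 = id"
    using linear_injective_left_inverse[OF lin0 inj0] by blast
  have "Blinfun k o\<^sub>L F x0 = id_blinfun"
    by (rule blinfun_eqI)
      (use k in \<open>simp add: F[OF U(2)] bounded_linear_Blinfun_apply linear_conv_bounded_linear fun_eq_iff\<close>)
  from inverse_function_theorem[OF U(1) _ contF U(2) this, of f]
  obtain U' V g g' where UV: "open U'" "U' \<subseteq> U" "x0 \<in> U'" "open V" "f x0 \<in> V" "homeomorphism U' V f g"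
    and g': "\<And>y. y \<in> V \<Longrightarrow> (g has_derivative g' y) (at y)"
    and inv: "\<And>y. y \<in> V \<Longrightarrow> g' y = inv (blinfun_apply (F (g y)))"
    and bij: "\<And>y. y \<in> V \<Longrightarrow> bij (blinfun_apply (F (g y)))"
    using der F by metis
  have gU: "g y \<in> U" if "y \<in> V" for y
    using UV that by (auto simp: homeomorphism_def)
  have fg: "F (g y) (g' y v) = v" if "y \<in> V" for y v
    unfolding inv[OF that] using bij[OF that] by (meson bij_is_surj surj_f_inv_f)
  have gf0: "g (f x0) = x0"
    using UV by (auto simp: homeomorphism_def)
  obtain \<beta> where \<beta>: "\<beta> > 0" "\<And>v. \<beta> * norm v \<le> norm (f' x0 v)"
    using linear_inj_bounded_below_pos[OF lin0 inj0] by blast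
  have lim: "((\<lambda>y. g' y v) \<longlongrightarrow> g' (f x0) v) (at (f x0))" for v
  proof -
    let ?b = "f x0"
    have "isCont g ?b"
      using g'[OF UV(5)] by (rule has_derivative_continuous)
    moreover have "isCont F (g ?b)"
      using contF U by (simp add: gf0 continuous_on_eq_continuous_at)
    ultimately have "isCont (\<lambda>y. F (g y)) ?b"
      by (rule isCont_o2)
    then have "((\<lambda>y. F (g y)) \<longlongrightarrow> F x0) (at ?b)"
      by (simp add: isCont_def gf0)
    then have F0: "((\<lambda>y. norm (F (g y) - F x0)) \<longlongrightarrow> 0) (at ?b)"
      using LIM_zero tendsto_norm_zero by blast
    have evV: "\<forall>\<^sub>F y in at ?b. y \<in> V"
      using UV(4,5) by (rule eventually_at_in_open')
    have "\<forall>\<^sub>F y in at ?b. norm (F (g y) - F x0) < \<beta> / 2"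
      using order_tendstoD(2)[OF F0, of "\<beta> / 2"] \<beta> by simp
    \<comment> \<open>The lower bound \<beta> for \<open>f' x0\<close> survives with constant
      \<open>\<beta> / 2\<close> for derivatives within \<open>\<beta> / 2\<close> of it. This
      bounds \<open>g' y v\<close> uniformly, and applying \<open>F x0\<close> to the difference of
      the inverses leaves an error proportional to \<open>norm (F (g y) - F x0)\<close>.\<close>
    with evV have "\<forall>\<^sub>F y in at ?b. norm (g' y v - g' ?b v) \<le> norm (F (g y) - F x0) * (2 * norm v / \<beta> / \<beta>)"
    proof eventually_elim
      case (elim y)
      let ?N = "norm (F (g y) - F x0)"
      have eq: "F x0 (g' y v) = v - (F (g y) - F x0) (g' y v)"
        using fg[OF elim(1)] by (simp add: blinfun.diff_left)
      have le: "norm ((F (g y) - F x0) (g' y v)) \<le> ?N * norm (g' y v)"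
        by (rule norm_blinfun)
      have "\<beta> * norm (g' y v) \<le> norm (F x0 (g' y v))"
        using \<beta> F[OF U(2)] by simp
      also have "\<dots> \<le> norm v + ?N * norm (g' y v)"
        unfolding eq using le norm_triangle_ineq4[of v "(F (g y) - F x0) (g' y v)"] by linarith
      also have "\<dots> \<le> norm v + \<beta> / 2 * norm (g' y v)"
        using elim(2) by (intro add_left_mono mult_right_mono) auto
      finally have bound: "norm (g' y v) \<le> 2 * norm v / \<beta>"
        using \<beta> by (simp add: field_simps)
      have "F x0 (g' ?b v) = v"
        using fg[OF UV(5)] gf0 by simp
      then have "F x0 (g' y v - g' ?b v) = - (F (g y) - F x0) (g' y v)"
        using eq by (simp add: blinfun.diff_right)
      then have "\<beta> * norm (g' y v - g' ?b v) \<le> norm ((F (g y) - F x0) (g' y v))"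
        using \<beta>(2)[of "g' y v - g' ?b v"] F[OF U(2)] by simp
      also have "\<dots> \<le> ?N * (2 * norm v / \<beta>)"
        using le bound by (meson mult_left_mono norm_ge_zero order_trans)
      finally show ?case
        using \<beta> by (simp add: field_simps)
    qed
    moreover have "((\<lambda>y. norm (F (g y) - F x0) * (2 * norm v / \<beta> / \<beta>)) \<longlongrightarrow> 0) (at ?b)"
      using F0 by (rule tendsto_mult_left_zero)
    ultimately have "((\<lambda>y. g' y v - g' ?b v) \<longlongrightarrow> 0) (at ?b)"
      by (rule Lim_null_comparison)
    then show ?thesis
      using LIM_zero_iff by blast
  qed
  show ?thesis
    by (rule that[OF UV g']) (use fg F gU lim in auto)
qed

section \<open>Boundary geometry\<close>

lemma has_derivative_vec_lambda:
  fixes f :: "'n::finite \<Rightarrow> 'a::real_normed_vector \<Rightarrow> real"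
  assumes "\<And>i. (f i has_derivative f' i) (at a within S)"
  shows "((\<lambda>x. \<chi> i. f i x) has_derivative (\<lambda>v. \<chi> i. f' i v)) (at a within S)"
  by (subst has_derivative_componentwise_within) (use assms in \<open>auto simp: Basis_vec_def inner_axis\<close>)

lemma has_derivative_sgn:
  fixes y :: "'a::real_inner"
  assumes "y \<noteq> 0"
  shows "(sgn has_derivative (\<lambda>v. v /\<^sub>R norm y - ((y \<bullet> v) / norm y ^ 3) *\<^sub>R y)) (at y)"
proof -
  have "((\<lambda>y. inverse (norm y) *\<^sub>R y) has_derivative
      (\<lambda>v. inverse (norm y) *\<^sub>R v + (- (inverse (norm y) * (v \<bullet> sgn y) * inverse (norm y))) *\<^sub>R y)) (at y)"
    using assms by (auto intro!: derivative_eq_intros has_derivative_norm)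
  moreover have "(\<lambda>v. inverse (norm y) *\<^sub>R v + (- (inverse (norm y) * (v \<bullet> sgn y) * inverse (norm y))) *\<^sub>R y)
      = (\<lambda>v. v /\<^sub>R norm y - ((y \<bullet> v) / norm y ^ 3) *\<^sub>R y)"
    using assms by (auto simp: fun_eq_iff sgn_div_norm field_simps power3_eq_cube inner_commute)
  ultimately show ?thesis
    by (simp add: sgn_div_norm[abs_def])
qed

definition grad :: "(real^'n::finite \<Rightarrow> real) \<Rightarrow> real^'n \<Rightarrow> real^'n" where
  "grad f x = (\<chi> i. pd i f x)"

lemma dd_eq_grad: "f differentiable (at x) \<Longrightarrow> dd v f x = grad f x \<bullet> v"
  by (simp add: dd_axis_expand grad_def inner_vec_def mult.commute)

definition defining_function :: "(real^'n::finite) set \<Rightarrow> (real^'n) set \<Rightarrow> (real^'n \<Rightarrow> real) \<Rightarrow> bool" where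
  "defining_function \<Omega> N \<phi> \<longleftrightarrow> open N \<and> Ck_on 2 \<phi> N \<and> (\<forall>x\<in>N. grad \<phi> x \<noteq> 0) \<and>
    \<Omega> \<inter> N = {x\<in>N. \<phi> x < 0} \<and> frontier \<Omega> \<inter> N = {x\<in>N. \<phi> x = 0}"

lemma C2_boundary_defining_function:
  fixes \<Omega> :: "(real^'n::finite) set"
  assumes "C2_boundary \<Omega>" "x \<in> frontier \<Omega>"
  obtains N \<phi> where "defining_function \<Omega> N \<phi>" "x \<in> N"
proof -
  obtain N and \<phi> :: "real^'n \<Rightarrow> real" where *: "open N" "x \<in> N" "Ck_on 2 \<phi> N"
      "\<And>x. x\<in>N \<Longrightarrow> frechet_derivative \<phi> (at x) \<noteq> (\<lambda>v. 0)"
      "\<Omega> \<inter> N = {x\<in>N. \<phi> x < 0}" "frontier \<Omega> \<inter> N = {x\<in>N. \<phi> x = 0}"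
    using assms unfolding C2_boundary_def by meson
  have "grad \<phi> y \<noteq> 0" if "y \<in> N" for y
    using *(4)[OF that] dd_eq_grad[OF Ck_on_2D(1)[OF *(3) that]] by (auto simp: fun_eq_iff)
  with * show ?thesis
    by (intro that[of N \<phi>]) (auto simp: defining_function_def)
qed

section \<open>Tangents, normals and curvature in terms of a defining function\<close>

context
  fixes \<Omega> N :: "(real^'n::finite) set" and \<phi> :: "real^'n \<Rightarrow> real"
  assumes def_fun: "defining_function \<Omega> N \<phi>"
begin

lemma
  shows open_N: "open N"
    and C2: "Ck_on 2 \<phi> N"
    and grad_nonzero: "x \<in> N \<Longrightarrow> grad \<phi> x \<noteq> 0"
    and in_domain_iff: "x \<in> N \<Longrightarrow> x \<in> \<Omega> \<longleftrightarrow> \<phi> x < 0"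
    and in_frontier_iff: "x \<in> N \<Longrightarrow> x \<in> frontier \<Omega> \<longleftrightarrow> \<phi> x = 0"
    and in_closure_iff: "x \<in> N \<Longrightarrow> x \<in> closure \<Omega> \<longleftrightarrow> \<phi> x \<le> 0"
proof -
  show N: "open N" "Ck_on 2 \<phi> N" "x \<in> N \<Longrightarrow> grad \<phi> x \<noteq> 0"
    and i: "x \<in> N \<Longrightarrow> x \<in> \<Omega> \<longleftrightarrow> \<phi> x < 0" and f: "x \<in> N \<Longrightarrow> x \<in> frontier \<Omega> \<longleftrightarrow> \<phi> x = 0"
    using def_fun unfolding defining_function_def by blast+
  show "x \<in> closure \<Omega> \<longleftrightarrow> \<phi> x \<le> 0" if "x \<in> N"
    unfolding closure_Un_frontier using i[OF that] f[OF that] by auto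
qed

lemma \<phi>_differentiable: "x \<in> N \<Longrightarrow> \<phi> differentiable (at x)"
  using Ck_on_2D(1)[OF C2] .

lemma dd_\<phi>: "x \<in> N \<Longrightarrow> dd v \<phi> x = grad \<phi> x \<bullet> v"
  by (simp add: dd_eq_grad \<phi>_differentiable)

lemma \<phi>_has_derivative:
  assumes "x \<in> N"
  shows "(\<phi> has_derivative (\<lambda>v. grad \<phi> x \<bullet> v)) (at x)"
proof -
  have "frechet_derivative \<phi> (at x) = (\<lambda>v. grad \<phi> x \<bullet> v)"
    using dd_\<phi>[OF assms] by (rule ext)
  then show ?thesis
    using \<phi>_differentiable[OF assms] by (metis frechet_derivative_works)
qed

text \<open>The required boundary curve is the preimage of the line
  \<open>t *\<^sub>R \<tau>\<close> under a chart that flattens the boundary. The chart \<Psi>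
  corrects \<open>y - x\<close> along the normal so that
  \<open>\<nu> \<bullet> \<Psi> y = \<phi> y\<close>; its derivative at \<open>x\<close> is the
  identity, so the curve starts with velocity \<tau>.\<close>

lemma tangent_if_orthogonal:
  assumes x: "x \<in> frontier \<Omega>" "x \<in> N" and \<tau>: "grad \<phi> x \<bullet> \<tau> = 0"
  shows "tangent_to_boundary \<Omega> x \<tau>"
proof -
  define \<nu> where "\<nu> = grad \<phi> x"
  have \<nu>: "\<nu> \<noteq> 0"
    using grad_nonzero x by (simp add: \<nu>_def)
  define \<Psi> where "\<Psi> = (\<lambda>y. y - x + ((\<phi> y - \<nu> \<bullet> (y - x)) / (\<nu> \<bullet> \<nu>)) *\<^sub>R \<nu>)"
  define \<Psi>' where "\<Psi>' = (\<lambda>y v. v + ((dd v \<phi> y - \<nu> \<bullet> v) / (\<nu> \<bullet> \<nu>)) *\<^sub>R \<nu>)"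
  have der: "(\<Psi> has_derivative \<Psi>' y) (at y)" if "y \<in> N" for y
  proof -
    have "(\<phi> has_derivative (\<lambda>v. dd v \<phi> y)) (at y)"
      using \<phi>_differentiable[OF that] by (simp add: frechet_derivative_works)
    then show ?thesis
      unfolding \<Psi>_def \<Psi>'_def using \<nu> by (auto intro!: derivative_eq_intros)
  qed
  have "continuous_on N (dd v \<phi>)" for v
    using Ck_on_2D(2)[OF C2]
    by (meson continuous_at_imp_continuous_on differentiable_imp_continuous_within)
  then have cont: "continuous_on N (\<lambda>y. \<Psi>' y v)" for v
    unfolding \<Psi>'_def using \<nu> by (intro continuous_intros) auto
  have \<Psi>'x: "\<Psi>' x v = v" for v
    using dd_\<phi>[OF x(2)] by (simp add: \<Psi>'_def \<nu>_def)
  obtain U' V g g' where g: "open U'" "U' \<subseteq> N" "x \<in> U'" "open V" "\<Psi> x \<in> V"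
      "homeomorphism U' V \<Psi> g"
      "\<And>y. y \<in> V \<Longrightarrow> (g has_derivative g' y) (at y)" "\<And>y v. y \<in> V \<Longrightarrow> \<Psi>' (g y) (g' y v) = v"
    by (rule inverse_function_injective[OF open_N x(2) der cont]) (auto simp: \<Psi>'x)
  have \<phi>x: "\<phi> x = 0"
    using x in_frontier_iff by blast
  have \<Psi>x: "\<Psi> x = 0"
    by (simp add: \<Psi>_def \<phi>x)
  have gx: "g 0 = x"
    using g(3,6) \<Psi>x by (metis homeomorphism_apply1)
  define c where "c = (\<lambda>t. g (t *\<^sub>R \<tau>))"
  have "\<forall>\<^sub>F t in at 0. t *\<^sub>R \<tau> \<in> V"
  proof -
    have "((\<lambda>t. t *\<^sub>R \<tau>) \<longlongrightarrow> 0 *\<^sub>R \<tau>) (at 0)"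
      by (intro tendsto_intros)
    then show ?thesis
      using g(4,5) \<Psi>x by (intro topological_tendstoD) auto
  qed
  then have "\<forall>\<^sub>F t in at 0. c t \<in> frontier \<Omega>"
  proof eventually_elim
    case (elim t)
    have gN: "g (t *\<^sub>R \<tau>) \<in> N" and eq: "\<Psi> (g (t *\<^sub>R \<tau>)) = t *\<^sub>R \<tau>"
      using g(2,6) elim by (auto simp: homeomorphism_def)
    have "\<phi> y = \<nu> \<bullet> \<Psi> y" for y
      using \<nu> by (simp add: \<Psi>_def inner_add_right)
    then have "\<phi> (c t) = 0"
      using eq \<tau> by (simp add: c_def \<nu>_def)
    with gN show ?case
      using in_frontier_iff by (simp add: c_def)
  qed
  moreover have "(c has_vector_derivative \<tau>) (at 0)"
  proof -
    have "g' 0 \<tau> = \<tau>"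
      using g(8)[of 0 \<tau>] g(5) \<Psi>x gx \<Psi>'x by simp
    moreover have g0: "(g has_derivative g' 0) (at (0 *\<^sub>R \<tau>))"
      using g(7)[of 0] g(5) \<Psi>x by simp
    then have "(c has_derivative (\<lambda>h. g' 0 (h *\<^sub>R \<tau>))) (at 0)"
      unfolding c_def by (rule has_derivative_compose[rotated]) (auto intro!: derivative_eq_intros)
    ultimately show ?thesis
      using has_derivative_linear[OF g0] by (simp add: has_vector_derivative_def linear_scale)
  qed
  moreover have "c 0 = x"
    by (simp add: c_def gx)
  ultimately show ?thesis
    unfolding tangent_to_boundary_def by blast
qed

lemma eventually_curve_in_N:
  assumes "(c has_vector_derivative \<tau>) (at 0)" "c 0 = x" "x \<in> N"
  shows "\<forall>\<^sub>F t in at 0. c t \<in> N"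
  using has_vector_derivative_continuous[OF assms(1)] assms(2,3) open_N
  by (auto simp: isCont_def intro: topological_tendstoD)

lemma orthogonal_if_tangent:
  assumes x: "x \<in> frontier \<Omega>" "x \<in> N" and \<tau>: "tangent_to_boundary \<Omega> x \<tau>"
  shows "grad \<phi> x \<bullet> \<tau> = 0"
proof -
  obtain c where c: "c 0 = x" "\<forall>\<^sub>F t in at 0. c t \<in> frontier \<Omega>" "(c has_vector_derivative \<tau>) (at 0)"
    using \<tau> unfolding tangent_to_boundary_def by blast
  have "((\<lambda>t. \<phi> (c t)) has_derivative (\<lambda>h. grad \<phi> x \<bullet> (h *\<^sub>R \<tau>))) (at 0)"
    using c \<phi>_has_derivative[OF x(2)] unfolding has_vector_derivative_def
    by (intro has_derivative_compose[of c "\<lambda>h. h *\<^sub>R \<tau>" 0 UNIV \<phi>]) auto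
  moreover have "\<forall>\<^sub>F t in at 0. \<phi> (c t) = 0"
    using c(2) eventually_curve_in_N[OF c(3,1) x(2)]
    by eventually_elim (use in_frontier_iff in blast)
  moreover have "\<phi> (c 0) = 0"
    using c x in_frontier_iff by simp
  ultimately have "((\<lambda>t. 0) has_derivative (\<lambda>h. grad \<phi> x \<bullet> (h *\<^sub>R \<tau>))) (at (0::real))"
    by (rule has_derivative_transform_eventually) auto
  then have "(\<lambda>h. grad \<phi> x \<bullet> (h *\<^sub>R \<tau>)) = (\<lambda>h. 0)"
    using has_derivative_unique has_derivative_const by blast
  then show ?thesis
    by (metis scaleR_one)
qed

lemma positive_in_direction:
  assumes x: "x \<in> N" "\<phi> x = 0" and \<nu>: "grad \<phi> x \<bullet> \<nu> > 0"
  shows "\<forall>\<^sub>F t in at_right 0. x + t *\<^sub>R \<nu> \<in> N \<and> \<phi> (x + t *\<^sub>R \<nu>) > 0 \<and> x - t *\<^sub>R \<nu> \<in> N \<and> \<phi> (x - t *\<^sub>R \<nu>) < 0"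
proof -
  have "((\<lambda>r. \<phi> (x + r *\<^sub>R \<nu>)) has_real_derivative grad \<phi> x \<bullet> \<nu>) (at 0)"
    using dd_line[of \<phi> x 0 \<nu>] x \<phi>_differentiable dd_\<phi> by simp
  from DERIV_pos_inc_right[OF this \<nu>] DERIV_pos_inc_left[OF this \<nu>]
  obtain d e where d: "d > 0" "\<And>h. 0 < h \<Longrightarrow> h < d \<Longrightarrow> \<phi> (x + h *\<^sub>R \<nu>) > 0"
    and e: "e > 0" "\<And>h. 0 < h \<Longrightarrow> h < e \<Longrightarrow> \<phi> (x - h *\<^sub>R \<nu>) < 0"
    using x by auto
  have 1: "\<forall>\<^sub>F t in at_right 0. t \<in> {0<..<min d e}"
    using d e by (intro eventually_at_right_real) auto
  have "((\<lambda>t. x + t *\<^sub>R \<nu>) \<longlongrightarrow> x + 0 *\<^sub>R \<nu>) (at_right 0)" "((\<lambda>t. x - t *\<^sub>R \<nu>) \<longlongrightarrow> x - 0 *\<^sub>R \<nu>) (at_right 0)"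
    by (intro tendsto_intros)+
  then have "\<forall>\<^sub>F t in at_right 0. x + t *\<^sub>R \<nu> \<in> N" "\<forall>\<^sub>F t in at_right 0. x - t *\<^sub>R \<nu> \<in> N"
    using open_N x by (auto intro!: topological_tendstoD)
  with 1 show ?thesis
    by eventually_elim (use d e in auto)
qed

text \<open>The component of \<nu> orthogonal to the gradient is itself a tangent vector, hence
  orthogonal to \<nu>, hence zero; that the points \<open>x + t *\<^sub>R \<nu>\<close> leave the
  closure fixes the sign.\<close>

lemma unit_outer_normal_eq:
  assumes x: "x \<in> frontier \<Omega>" "x \<in> N"
  shows "unit_outer_normal \<Omega> x \<nu> \<longleftrightarrow> \<nu> = sgn (grad \<phi> x)"
proof
  let ?G = "grad \<phi> x"
  have G: "?G \<noteq> 0" and \<phi>x: "\<phi> x = 0"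
    using x grad_nonzero in_frontier_iff by auto
  show "unit_outer_normal \<Omega> x \<nu>" if \<nu>: "\<nu> = sgn ?G"
    unfolding unit_outer_normal_def
  proof (intro conjI allI impI)
    show "norm \<nu> = 1"
      using G by (simp add: \<nu> norm_sgn)
    show "\<nu> \<bullet> \<tau> = 0" if "tangent_to_boundary \<Omega> x \<tau>" for \<tau>
      using orthogonal_if_tangent[OF x that] by (simp add: \<nu> sgn_div_norm)
    have "?G \<bullet> \<nu> > 0"
      using G by (simp add: \<nu> sgn_div_norm)
    from positive_in_direction[OF x(2) \<phi>x this]
    show "\<forall>\<^sub>F t in at_right 0. x + t *\<^sub>R \<nu> \<notin> closure \<Omega>"
      by eventually_elim (use in_closure_iff in force)
  qed
  assume \<nu>: "unit_outer_normal \<Omega> x \<nu>"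
  define k where "k = (\<nu> \<bullet> ?G) / (?G \<bullet> ?G)"
  define \<tau> where "\<tau> = \<nu> - k *\<^sub>R ?G"
  have "?G \<bullet> \<tau> = 0"
    using G by (simp add: \<tau>_def k_def inner_diff_right inner_commute)
  then have "\<nu> \<bullet> \<tau> = 0"
    using \<nu> tangent_if_orthogonal[OF x] by (simp add: unit_outer_normal_def)
  with \<open>?G \<bullet> \<tau> = 0\<close> have "\<tau> \<bullet> \<tau> = 0"
    by (simp add: \<tau>_def inner_diff_left)
  then have \<nu>k: "\<nu> = k *\<^sub>R ?G"
    by (simp add: \<tau>_def)
  have "norm \<nu> = 1"
    using \<nu> by (simp add: unit_outer_normal_def)
  have "k > 0"
  proof (rule ccontr)
    assume "\<not> k > 0"
    with \<open>norm \<nu> = 1\<close> \<nu>k have "k < 0"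
      by (cases "k = 0") auto
    then have "?G \<bullet> (- \<nu>) > 0"
      using G by (simp add: \<nu>k mult_neg_pos)
    from positive_in_direction[OF x(2) \<phi>x this]
    have "\<forall>\<^sub>F t in at_right 0. x + t *\<^sub>R \<nu> \<in> closure \<Omega>"
      by eventually_elim (use in_closure_iff in force)
    moreover have "\<forall>\<^sub>F t in at_right 0. x + t *\<^sub>R \<nu> \<notin> closure \<Omega>"
      using \<nu> by (simp add: unit_outer_normal_def)
    ultimately have "\<forall>\<^sub>F t in at_right (0::real). False"
      by eventually_elim auto
    then show False
      by simp
  qed
  then show "\<nu> = sgn ?G"
    using \<nu>k G by (metis sgn_scaleR sgn_pos scaleR_one \<open>norm \<nu> = 1\<close> sgn_div_norm inverse_1)
qed

lemma has_derivative_grad: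
  assumes "x \<in> N"
  shows "(grad \<phi> has_derivative (\<lambda>v. \<chi> i. dd v (pd i \<phi>) x)) (at x)"
proof -
  have "((\<lambda>x. \<chi> i. pd i \<phi> x) has_derivative (\<lambda>v. \<chi> i. dd v (pd i \<phi>) x)) (at x)"
  proof (rule has_derivative_vec_lambda)
    fix i
    show "(pd i \<phi> has_derivative (\<lambda>v. dd v (pd i \<phi>) x)) (at x)"
      using Ck_on_2D(2)[OF C2 assms] by (simp add: pd_eq_dd frechet_derivative_works)
  qed
  then show ?thesis
    by (simp add: grad_def[abs_def])
qed

lemma continuous_on_grad: "continuous_on N (grad \<phi>)"
  using has_derivative_grad by (meson continuous_at_imp_continuous_on has_derivative_continuous)

text \<open>The curvature condition quantifies over normal fields; anything can be drawn from it at
  a boundary point only if one exists there.\<close>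

lemma outer_normal_field_exists:
  assumes "x \<in> N"
  shows "outer_normal_field_near \<Omega> x (\<lambda>w. sgn (grad \<phi> w))"
proof -
  let ?D = "\<lambda>v x. \<chi> i. dd v (pd i \<phi>) x"
  have der: "((\<lambda>w. sgn (grad \<phi> w)) has_derivative (\<lambda>v. ?D v x /\<^sub>R norm (grad \<phi> x)
      - ((grad \<phi> x \<bullet> ?D v x) / norm (grad \<phi> x) ^ 3) *\<^sub>R grad \<phi> x)) (at x)" if "x \<in> N" for x
    using has_derivative_compose[OF has_derivative_grad[OF that] has_derivative_sgn[OF grad_nonzero[OF that]]] .
  have cont: "continuous_on N (dd v (pd i \<phi>))" for v i
    using Ck_on_2D(3)[OF C2] by (simp add: pd_eq_dd)
  have "continuous_on N (\<lambda>x. ?D v x /\<^sub>R norm (grad \<phi> x)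
      - ((grad \<phi> x \<bullet> ?D v x) / norm (grad \<phi> x) ^ 3) *\<^sub>R grad \<phi> x)" for v
    by (intro continuous_intros cont continuous_on_grad) (use grad_nonzero in auto)
  then have "continuous_on N (dd v (\<lambda>w. sgn (grad \<phi> w)))" for v
    by (rule continuous_on_eq) (simp add: dd_eqI[OF der])
  moreover have "(\<lambda>w. sgn (grad \<phi> w)) differentiable (at x)" if "x \<in> N" for x
    using der[OF that] by (rule differentiableI)
  ultimately have "Ck_on 1 (\<lambda>w. sgn (grad \<phi> w)) N"
    by (simp add: numeral_eq_Suc del: One_nat_def add: One_nat_def)
  then show ?thesis
    unfolding outer_normal_field_near_def using open_N assms unit_outer_normal_eq by blast
qed

lemma outer_normal_field_at:
  assumes x: "x \<in> frontier \<Omega>" "x \<in> N" and \<gamma>: "outer_normal_field_near \<Omega> x \<gamma>"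
  shows "\<gamma> x = sgn (grad \<phi> x)"
  using \<gamma> unit_outer_normal_eq[OF x] x unfolding outer_normal_field_near_def by blast

text \<open>Off the boundary \<gamma> is arbitrary, so it can be compared with the gradient only
  along boundary curves, where \<open>grad \<phi>\<close> is \<open>norm (grad \<phi>)\<close> times
  \<gamma>. Tested against \<tau>, which is orthogonal to both at \<open>x\<close>, the derivative
  of the norm drops out; dividing by \<open>t\<close> and passing to the limit replaces a product
  rule.\<close>

lemma normal_field_hess:
  assumes x: "x \<in> frontier \<Omega>" "x \<in> N" and \<gamma>: "outer_normal_field_near \<Omega> x \<gamma>"
    and \<tau>: "tangent_to_boundary \<Omega> x \<tau>"
  shows "norm (grad \<phi> x) * (\<Sum>i\<in>UNIV. \<Sum>j\<in>UNIV. pd i (\<lambda>w. \<gamma> w $ j) x * \<tau> $ i * \<tau> $ j) = hess \<phi> x \<tau>"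
proof -
  obtain M where M: "open M" "x \<in> M" "Ck_on 1 \<gamma> M" "\<And>w. w \<in> frontier \<Omega> \<inter> M \<Longrightarrow> unit_outer_normal \<Omega> w (\<gamma> w)"
    using \<gamma> unfolding outer_normal_field_near_def by blast
  obtain c where c: "c 0 = x" "\<forall>\<^sub>F t in at 0. c t \<in> frontier \<Omega>" "(c has_vector_derivative \<tau>) (at 0)"
    using \<tau> unfolding tangent_to_boundary_def by blast
  have orth: "grad \<phi> x \<bullet> \<tau> = 0"
    using orthogonal_if_tangent[OF x \<tau>] .
  have cx: "(c \<longlongrightarrow> x) (at 0)"
    using has_vector_derivative_continuous[OF c(3)] c(1) by (simp add: isCont_def)
  have ev: "\<forall>\<^sub>F t in at 0. \<tau> \<bullet> grad \<phi> (c t) = norm (grad \<phi> (c t)) * (\<tau> \<bullet> \<gamma> (c t))"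
    using c(2) eventually_curve_in_N[OF c(3,1) x(2)] topological_tendstoD[OF cx M(1,2)]
  proof eventually_elim
    case (elim t)
    then have "\<gamma> (c t) = sgn (grad \<phi> (c t))"
      using M(4)[of "c t"] unit_outer_normal_eq by blast
    then show ?case
      using grad_nonzero elim by (simp add: sgn_div_norm)
  qed
  have dc: "(c has_derivative (\<lambda>h. h *\<^sub>R \<tau>)) (at 0)"
    using c(3) by (simp add: has_vector_derivative_def)
  have der: "((\<lambda>t. \<tau> \<bullet> F (c t) / t) \<longlongrightarrow> \<tau> \<bullet> F' \<tau>) (at 0)"
    if F: "(F has_derivative F') (at x)" and F0: "\<tau> \<bullet> F x = 0" for F F'
  proof -
    have "((\<lambda>t. F (c t)) has_derivative (\<lambda>h. F' (h *\<^sub>R \<tau>))) (at 0)"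
      by (rule has_derivative_compose[OF dc]) (simp add: c(1) F)
    then have "((\<lambda>t. \<tau> \<bullet> F (c t)) has_derivative (\<lambda>h. \<tau> \<bullet> F' (h *\<^sub>R \<tau>))) (at 0)"
      by (rule has_derivative_inner_right)
    then have "((\<lambda>t. \<tau> \<bullet> F (c t)) has_real_derivative \<tau> \<bullet> F' \<tau>) (at 0)"
      using has_derivative_linear[OF F]
      by (simp add: has_field_derivative_def linear_scale mult.commute[of _ "\<tau> \<bullet> F' \<tau>"])
    then show ?thesis
      using F0 by (simp add: DERIV_def c(1))
  qed
  have d\<gamma>: "\<gamma> differentiable (at x)"
    using M by simp
  have 1: "((\<lambda>t. \<tau> \<bullet> \<gamma> (c t) / t) \<longlongrightarrow> \<tau> \<bullet> dd \<tau> \<gamma> x) (at 0)"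
    using d\<gamma> outer_normal_field_at[OF x \<gamma>] orth
    by (intro der) (auto simp: frechet_derivative_works sgn_div_norm inner_commute)
  have "((\<lambda>t. grad \<phi> (c t)) \<longlongrightarrow> grad \<phi> x) (at 0)"
    using isCont_tendsto_compose[OF has_derivative_continuous[OF has_derivative_grad[OF x(2)]] cx] .
  then have "((\<lambda>t. norm (grad \<phi> (c t)) * (\<tau> \<bullet> \<gamma> (c t) / t)) \<longlongrightarrow> norm (grad \<phi> x) * (\<tau> \<bullet> dd \<tau> \<gamma> x)) (at 0)"
    by (intro tendsto_mult tendsto_norm 1)
  moreover have "\<forall>\<^sub>F t in at 0. norm (grad \<phi> (c t)) * (\<tau> \<bullet> \<gamma> (c t) / t) = \<tau> \<bullet> grad \<phi> (c t) / t"
    using ev by eventually_elim simp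
  ultimately have "((\<lambda>t. \<tau> \<bullet> grad \<phi> (c t) / t) \<longlongrightarrow> norm (grad \<phi> x) * (\<tau> \<bullet> dd \<tau> \<gamma> x)) (at 0)"
    by (rule Lim_transform_eventually)
  moreover have "((\<lambda>t. \<tau> \<bullet> grad \<phi> (c t) / t) \<longlongrightarrow> \<tau> \<bullet> (\<chi> i. dd \<tau> (pd i \<phi>) x)) (at 0)"
    by (rule der[OF has_derivative_grad[OF x(2)]]) (use orth in \<open>simp add: inner_commute\<close>)
  ultimately have "norm (grad \<phi> x) * (\<tau> \<bullet> dd \<tau> \<gamma> x) = \<tau> \<bullet> (\<chi> i. dd \<tau> (pd i \<phi>) x)"
    by (rule tendsto_unique[rotated]) simp
  moreover have "\<tau> \<bullet> (\<chi> i. dd \<tau> (pd i \<phi>) x) = hess \<phi> x \<tau>"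
  proof -
    have "dd \<tau> (pd j \<phi>) x = (\<Sum>i\<in>UNIV. \<tau> $ i * pd i (pd j \<phi>) x)" for j
      using Ck_on_2D(2)[OF C2 x(2)] by (intro dd_axis_expand) (simp add: pd_eq_dd)
    then have "\<tau> \<bullet> (\<chi> i. dd \<tau> (pd i \<phi>) x) = (\<Sum>j\<in>UNIV. \<Sum>i\<in>UNIV. \<tau> $ i * \<tau> $ j * pd i (pd j \<phi>) x)"
      by (simp add: inner_vec_def sum_distrib_left mult_ac)
    also have "\<dots> = hess \<phi> x \<tau>"
      unfolding hess_def by (rule sum.swap)
    finally show ?thesis .
  qed
  moreover have "\<tau> \<bullet> dd \<tau> \<gamma> x = (\<Sum>i\<in>UNIV. \<Sum>j\<in>UNIV. pd i (\<lambda>w. \<gamma> w $ j) x * \<tau> $ i * \<tau> $ j)"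
  proof -
    have comp: "((\<lambda>w. \<gamma> w $ j) has_derivative (\<lambda>v. dd v \<gamma> x $ j)) (at x)" for j
      using d\<gamma> unfolding frechet_derivative_works by (rule bounded_linear.has_derivative[OF bounded_linear_vec_nth])
    define a where "a = (\<lambda>i j. pd i (\<lambda>w. \<gamma> w $ j) x)"
    have "dd \<tau> \<gamma> x $ j = (\<Sum>i\<in>UNIV. \<tau> $ i * a i j)" for j
      using dd_axis_expand[OF differentiableI[OF comp], where u = \<tau>] dd_eqI[OF comp, where v = \<tau>]
      by (simp add: a_def)
    then have "\<tau> \<bullet> dd \<tau> \<gamma> x = (\<Sum>j\<in>UNIV. \<Sum>i\<in>UNIV. a i j * \<tau> $ i * \<tau> $ j)"
      by (simp add: inner_vec_def sum_distrib_left mult_ac)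
    also have "\<dots> = (\<Sum>i\<in>UNIV. \<Sum>j\<in>UNIV. a i j * \<tau> $ i * \<tau> $ j)"
      by (rule sum.swap)
    finally show ?thesis
      by (simp only: a_def)
  qed
  ultimately show ?thesis
    by simp
qed

end

section \<open>Generating functions\<close>

lemma smooth_onD:
  assumes "smooth_on f S"
  shows "x \<in> S \<Longrightarrow> f differentiable (at x)" "smooth_on (dd v f) S" "Ck_on k f S" "continuous_on S f"
proof -
  have k: "Ck_on k f S" for k
    using assms by (simp add: smooth_on_def)
  show "x \<in> S \<Longrightarrow> f differentiable (at x)"
    by (rule Ck_on_SucD(1)[OF k])
  show "Ck_on k f S"
    by (rule k)
  show "smooth_on (dd v f) S"
    unfolding smooth_on_def using k[of "Suc _"] by auto
  show "continuous_on S f"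
    using k[of 0] by simp
qed

locale generating_function =
  fixes U :: "((real^'n::finite) \<times> (real^'n)) set" and I :: "real set" and G :: "'n genfun"
  assumes open_U: "open U" and open_I: "open I"
    and smooth_G: "smooth_on (\<lambda>(x, y, z). G x y z) {(x, y, z). (x, y) \<in> U \<and> z \<in> I}"
    and Gz_neg: "\<forall>(x, y)\<in>U. \<forall>z\<in>I. Gz G x y z < 0"
begin

definition D :: "((real^'n) \<times> (real^'n) \<times> real) set" where
  "D = {(x, y, z). (x, y) \<in> U \<and> z \<in> I}"

text \<open>Uncurrying turns every partial derivative into \<open>dd\<close> of one function on the
  open set \<open>D\<close>, so that smoothness and the symmetry \<open>commute\<close> cover all
  mixed derivatives in \<open>x\<close>, \<open>y\<close> and \<open>z\<close>.\<close>

definition g :: "(real^'n) \<times> (real^'n) \<times> real \<Rightarrow> real" where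
  "g = (\<lambda>(x, y, z). G x y z)"

abbreviation ex :: "real^'n \<Rightarrow> (real^'n) \<times> (real^'n) \<times> real" where "ex v \<equiv> (v, 0, 0)"
abbreviation ey :: "real^'n \<Rightarrow> (real^'n) \<times> (real^'n) \<times> real" where "ey v \<equiv> (0, v, 0)"
abbreviation ez :: "(real^'n) \<times> (real^'n) \<times> real" where "ez \<equiv> (0, 0, 1)"
abbreviation ax :: "'n \<Rightarrow> real^'n" where "ax i \<equiv> axis i 1"

lemma in_D: "(x, y, z) \<in> D \<longleftrightarrow> (x, y) \<in> U \<and> z \<in> I"
  by (simp add: D_def)

lemma open_D: "open D"
proof -
  have "open ((\<lambda>p :: (real^'n) \<times> (real^'n) \<times> real. (fst p, fst (snd p))) -` U)"
    "open ((\<lambda>p :: (real^'n) \<times> (real^'n) \<times> real. snd (snd p)) -` I)"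
    by (intro open_vimage open_U open_I continuous_intros)+
  from open_Int[OF this] show ?thesis
    by (rule back_subst[of "open"]) (auto simp: D_def)
qed

lemma smooth_g: "smooth_on g D"
  using smooth_G by (simp add: g_def D_def)

lemma g_apply: "g (x, y, z) = G x y z"
  by (simp add: g_def)

lemma commute:
  fixes f :: "_ \<Rightarrow> real"
  assumes "smooth_on f D" "p \<in> D"
  shows "dd v (dd w f) p = dd w (dd v f) p"
  using dd_commute[OF smooth_onD(3)[OF assms(1)] open_D assms(2)] .

lemma dd_cong_D:
  assumes "\<And>p. p \<in> D \<Longrightarrow> f p = h p" "p \<in> D" "smooth_on f D"
  shows "dd v f p = dd v h p"
  using open_D assms(2) assms(1) smooth_onD(1)[OF assms(3,2)] by (rule dd_cong_open)

lemma
  assumes f: "f differentiable (at (x, y, z))"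
  shows dd_x_slice: "dd v (\<lambda>x. f (x, y, z)) x = dd (ex v) f (x, y, z)"
    and dd_y_slice: "dd v (\<lambda>y. f (x, y, z)) y = dd (ey v) f (x, y, z)"
    and dd_yz_slice: "((\<lambda>q. f (x, q)) has_derivative (\<lambda>v. dd (0, v) f (x, y, z))) (at (y, z))"
proof -
  have "((\<lambda>x. (x, y, z)) has_derivative (\<lambda>v. ex v)) (at x)"
    "((\<lambda>y. (x, y, z)) has_derivative (\<lambda>v. ey v)) (at y)"
    by (intro has_derivative_Pair has_derivative_ident has_derivative_const)+
  note * = this
  show "dd v (\<lambda>x. f (x, y, z)) x = dd (ex v) f (x, y, z)"
    by (rule dd_compose(1)[OF *(1) f])
  show "dd v (\<lambda>y. f (x, y, z)) y = dd (ey v) f (x, y, z)"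
    by (rule dd_compose(1)[OF *(2) f])
  have "((\<lambda>q. (x, q)) has_derivative (\<lambda>v. (0, v))) (at (y, z))"
    by (intro has_derivative_Pair has_derivative_ident has_derivative_const)
  moreover have "(f has_derivative (\<lambda>v. dd v f (x, y, z))) (at (x, y, z))"
    using f unfolding frechet_derivative_works .
  ultimately show "((\<lambda>q. f (x, q)) has_derivative (\<lambda>v. dd (0, v) f (x, y, z))) (at (y, z))"
    by (rule has_derivative_compose)
qed

lemma deriv_z_slice:
  fixes f :: "_ \<Rightarrow> real"
  assumes f: "f differentiable (at (x, y, z))"
  shows "deriv (\<lambda>z. f (x, y, z)) z = dd ez f (x, y, z)"
proof -
  have "((\<lambda>r. f ((x, y, 0) + r *\<^sub>R ez)) has_real_derivative dd ez f ((x, y, 0) + z *\<^sub>R ez)) (at z)"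
    by (rule dd_line) (use f in simp)
  from DERIV_imp_deriv[OF this] show ?thesis
    by simp
qed

lemma open_x_slice: "open {x. (x, q) \<in> D}"
  by (rule open_slice[OF open_D])

lemma open_yz_slice: "open {q. (x, q) \<in> D}"
proof -
  have "open ((\<lambda>q. (x, q)) -` D)"
    by (rule open_vimage[OF open_D]) (intro continuous_intros)
  then show ?thesis
    by (simp add: vimage_def)
qed

lemmas smooth_dd = smooth_onD(2) smooth_onD(2)[OF smooth_g] smooth_g
lemmas diff_g = smooth_onD(1)[OF smooth_g]
lemmas diff_dd_g = smooth_onD(1)[OF smooth_onD(2)[OF smooth_g]]

lemma pd_x_G: "(x, y, z) \<in> D \<Longrightarrow> pd i (\<lambda>x. G x y z) x = dd (ex (ax i)) g (x, y, z)"
  using dd_x_slice[OF diff_g, of x y z "ax i"] by (simp add: pd_def g_apply)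

lemma pd_y_G: "(x, y, z) \<in> D \<Longrightarrow> pd j (\<lambda>y. G x y z) y = dd (ey (ax j)) g (x, y, z)"
  using dd_y_slice[OF diff_g, of x y z "ax j"] by (simp add: pd_def g_apply)

lemma Gx_eq: "(x, y, z) \<in> D \<Longrightarrow> Gx G x y z = (\<chi> i. dd (ex (ax i)) g (x, y, z))"
  by (simp add: Gx_def pd_x_G)

lemma Gy_eq: "(x, y, z) \<in> D \<Longrightarrow> Gy G x y z = (\<chi> j. dd (ey (ax j)) g (x, y, z))"
  by (simp add: Gy_def pd_y_G)

lemma Gz_eq: "(x, y, z) \<in> D \<Longrightarrow> Gz G x y z = dd ez g (x, y, z)"
  using deriv_z_slice[OF diff_g, of x y z] by (simp add: Gz_def g_apply)

lemma pd_dd_x_slice: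
  fixes f :: "_ \<Rightarrow> real"
  assumes "smooth_on f D" "(x, y, z) \<in> D" "\<And>x. (x, y, z) \<in> D \<Longrightarrow> h x = f (x, y, z)"
  shows "pd i h x = dd (ex (ax i)) f (x, y, z)"
proof -
  have f: "f differentiable (at (x, y, z))"
    using smooth_onD(1)[OF assms(1,2)] .
  have "((\<lambda>x. (x, y, z)) has_derivative (\<lambda>v. ex v)) (at x)"
    by (intro has_derivative_Pair has_derivative_ident has_derivative_const)+
  then have d: "(\<lambda>x. f (x, y, z)) differentiable (at x)"
    using f by (rule dd_compose(2))
  have "dd (ax i) (\<lambda>x. f (x, y, z)) x = dd (ax i) h x"
    by (rule dd_cong_open[OF open_x_slice[of "(y, z)"] _ _ d]) (use assms in auto)
  then show ?thesis
    using dd_x_slice[OF f] by (simp add: pd_eq_dd)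
qed

lemma Gxx_eq:
  assumes "(x, y, z) \<in> D"
  shows "Gxx G i j x y z = dd (ex (ax i)) (dd (ex (ax j)) g) (x, y, z)"
  unfolding Gxx_def
  by (rule pd_dd_x_slice[OF smooth_dd(2) assms pd_x_G])

lemma Emat_eq:
  assumes "(x, y, z) \<in> D"
  shows "Emat G x y z $ i $ j = dd (ex (ax i)) (dd (ey (ax j)) g) (x, y, z)
    - inverse (dd ez g (x, y, z)) * dd ez (dd (ex (ax i)) g) (x, y, z) * dd (ey (ax j)) g (x, y, z)"
proof -
  have 1: "pd i (\<lambda>x. pd j (\<lambda>y. G x y z) y) x = dd (ex (ax i)) (dd (ey (ax j)) g) (x, y, z)"
    by (rule pd_dd_x_slice[OF smooth_dd(2) assms pd_y_G])
  have "deriv (\<lambda>z. pd i (\<lambda>x. G x y z) x) z = deriv (\<lambda>z. dd (ex (ax i)) g (x, y, z)) z"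
  proof (rule deriv_cong_ev)
    have "\<forall>\<^sub>F z in nhds z. z \<in> I"
      using open_I assms in_D by (intro eventually_nhds_in_open) auto
    then show "\<forall>\<^sub>F z in nhds z. pd i (\<lambda>x. G x y z) x = dd (ex (ax i)) g (x, y, z)"
    proof eventually_elim
      case (elim z)
      then have "(x, y, z) \<in> D"
        using assms in_D by auto
      then show ?case
        by (rule pd_x_G)
    qed
  qed simp
  also have "\<dots> = dd ez (dd (ex (ax i)) g) (x, y, z)"
    using diff_dd_g[OF assms] by (rule deriv_z_slice)
  finally show ?thesis
    using assms by (simp add: Emat_def 1 Gz_eq Gy_eq)
qed

lemma dd_yz_expand:
  fixes f :: "_ \<Rightarrow> real"
  assumes f: "f differentiable (at p)"
  shows "dd (0, m, \<mu>) f p = (\<Sum>j\<in>UNIV. m $ j * dd (ey (ax j)) f p) + \<mu> * dd ez f p"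
proof -
  interpret linear "frechet_derivative f (at p)"
    using linear_frechet_derivative[OF f] .
  have "(\<Sum>j\<in>UNIV. m $ j *\<^sub>R ey (ax j)) + \<mu> *\<^sub>R ez = (0, m, \<mu>)"
    using basis_expansion[of m]
    by (simp add: prod_eq_iff fst_sum snd_sum scalar_mult_eq_scaleR)
  then have "dd (0, m, \<mu>) f p = dd ((\<Sum>j\<in>UNIV. m $ j *\<^sub>R ey (ax j)) + \<mu> *\<^sub>R ez) f p"
    by simp
  also have "\<dots> = (\<Sum>j\<in>UNIV. m $ j * dd (ey (ax j)) f p) + \<mu> * dd ez f p"
    by (simp only: add sum scale real_scaleR_def)
  finally show ?thesis .
qed

lemma Gz_nonzero:
  assumes "p \<in> D"
  shows "dd ez g p < 0"
proof -
  obtain x y z where p: "p = (x, y, z)"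
    by (metis prod_cases3)
  then have "Gz G x y z < 0"
    using Gz_neg assms by (auto simp: in_D)
  then show ?thesis
    using Gz_eq assms by (simp add: p)
qed

text \<open>The correction term in \<open>Emat\<close> is the effect of moving \<open>z\<close> so
  as to keep \<open>G\<close> constant: the hypothesis solves to
  \<open>\<mu> = - (G_y \<bullet> m) / G_z\<close>, which is the coefficient of \<open>G_xz\<close>
  in that term.\<close>

lemma Emat_mult:
  assumes p: "(x, y, z) \<in> D" and \<mu>: "dd (0, m, \<mu>) g (x, y, z) = 0"
  shows "(Emat G x y z *v m) $ i = dd (ex (ax i)) (dd (0, m, \<mu>) g) (x, y, z)"
proof -
  let ?p = "(x, y, z)"
  define A where "A = (\<lambda>j. dd (ex (ax i)) (dd (ey (ax j)) g) ?p)"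
  define B where "B = dd ez (dd (ex (ax i)) g) ?p"
  have "dd (ex (ax i)) (dd (0, m, \<mu>) g) ?p
      = dd (ex (ax i)) (\<lambda>p. (\<Sum>j\<in>UNIV. m $ j * dd (ey (ax j)) g p) + \<mu> * dd ez g p) ?p"
    by (rule dd_cong_D[OF _ p smooth_dd(2)]) (rule dd_yz_expand[OF diff_g])
  also have "\<dots> = (\<Sum>j\<in>UNIV. m $ j * dd (ex (ax i)) (dd (ey (ax j)) g) ?p) + \<mu> * dd (ex (ax i)) (dd ez g) ?p"
  proof (rule dd_eqI)
    show "((\<lambda>p. (\<Sum>j\<in>UNIV. m $ j * dd (ey (ax j)) g p) + \<mu> * dd ez g p) has_derivative
      (\<lambda>v. (\<Sum>j\<in>UNIV. m $ j * dd v (dd (ey (ax j)) g) ?p) + \<mu> * dd v (dd ez g) ?p)) (at ?p)"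
      using diff_dd_g[OF p]
      by (intro has_derivative_add has_derivative_sum has_derivative_mult_right)
        (simp_all add: frechet_derivative_works)
  qed
  also have "dd (ex (ax i)) (dd ez g) ?p = B"
    unfolding B_def by (rule commute[OF smooth_g p])
  finally have *: "dd (ex (ax i)) (dd (0, m, \<mu>) g) ?p = (\<Sum>j\<in>UNIV. m $ j * A j) + \<mu> * B"
    by (simp only: A_def)
  define S where "S = (\<Sum>j\<in>UNIV. m $ j * dd (ey (ax j)) g ?p)"
  have "S + \<mu> * dd ez g ?p = 0"
    using \<mu> dd_yz_expand[OF diff_g[OF p], of m \<mu>] by (simp add: S_def)
  then have "S = - \<mu> * dd ez g ?p"
    by simp
  then have \<mu>S: "\<mu> = - inverse (dd ez g ?p) * S"
    using Gz_nonzero[OF p] by simp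
  have "(Emat G x y z *v m) $ i = (\<Sum>j\<in>UNIV. (A j - inverse (dd ez g ?p) * B * dd (ey (ax j)) g ?p) * m $ j)"
    by (simp add: matrix_vector_mult_def Emat_eq[OF p] A_def B_def)
  also have "\<dots> = (\<Sum>j\<in>UNIV. m $ j * A j) - inverse (dd ez g ?p) * B * S"
    by (simp add: S_def left_diff_distrib right_diff_distrib sum_subtractf sum_distrib_left mult_ac)
  also have "\<dots> = (\<Sum>j\<in>UNIV. m $ j * A j) + \<mu> * B"
    unfolding \<mu>S by simp
  finally show ?thesis
    unfolding * .
qed

section \<open>Inverting the map from \<open>(y, z)\<close> to \<open>(u, p)\<close>\<close>

definition F :: "real^'n \<Rightarrow> (real^'n) \<times> real \<Rightarrow> real \<times> (real^'n)" where
  "F x q = (g (x, q), \<chi> i. dd (ex (ax i)) g (x, q))"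

definition F' :: "real^'n \<Rightarrow> (real^'n) \<times> real \<Rightarrow> (real^'n) \<times> real \<Rightarrow> real \<times> (real^'n)" where
  "F' x q v = (dd (0, v) g (x, q), \<chi> i. dd (0, v) (dd (ex (ax i)) g) (x, q))"

lemma F_eq: "(x, y, z) \<in> D \<Longrightarrow> F x (y, z) = (G x y z, Gx G x y z)"
  by (simp add: F_def g_apply Gx_eq)

lemma F_has_derivative:
  assumes "(x, q) \<in> D"
  shows "(F x has_derivative F' x q) (at q)"
proof -
  obtain y z where q: "q = (y, z)" by fastforce
  with assms have p: "(x, y, z) \<in> D" by simp
  show ?thesis
    unfolding F_def[abs_def] F'_def[abs_def] q
    by (intro has_derivative_Pair has_derivative_vec_lambda dd_yz_slice diff_g[OF p] diff_dd_g[OF p])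
qed

lemma linear_F': "(x, q) \<in> D \<Longrightarrow> linear (F' x q)"
  using F_has_derivative has_derivative_linear by blast

lemma F'_eq:
  assumes p: "(x, y, z) \<in> D" and ann: "dd (0, m, \<mu>) g (x, y, z) = 0"
  shows "F' x (y, z) (m, \<mu>) = (0, Emat G x y z *v m)"
proof -
  have "dd (0, m, \<mu>) (dd (ex (ax i)) g) (x, y, z) = (Emat G x y z *v m) $ i" for i
    unfolding Emat_mult[OF p ann] by (rule commute[OF smooth_g p])
  then show ?thesis
    using ann by (simp add: F'_def vec_eq_iff)
qed

text \<open>A kernel vector leaves \<open>G\<close> unchanged to first order, so
  \<open>F'_eq\<close> reduces the claim to \<open>E m = 0\<close>; then \<open>m = 0\<close>, and
  \<mu> vanishes because \<open>G_z\<close> is nonzero.\<close>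

lemma inj_F':
  assumes p: "(x, y, z) \<in> D" and E: "det (Emat G x y z) \<noteq> 0" and 0: "F' x (y, z) v = 0"
  shows "v = 0"
proof -
  obtain m \<mu> where v: "v = (m, \<mu>)" by fastforce
  have *: "dd (0, m, \<mu>) g (x, y, z) = 0"
    using 0 by (simp add: F'_def v zero_prod_def)
  then have Em: "Emat G x y z *v m = 0"
    using F'_eq[OF p *] 0 by (simp add: v zero_prod_def)
  obtain B where "B ** Emat G x y z = mat 1"
    using E invertible_det_nz[of "Emat G x y z"] by (auto simp: invertible_def)
  then have "B *v (Emat G x y z *v m) = m"
    by (simp add: matrix_vector_mul_assoc)
  then have m: "m = 0"
    by (simp add: Em)
  then have "\<mu> * dd ez g (x, y, z) = 0"
    using * dd_yz_expand[OF diff_g[OF p], of m \<mu>] by simp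
  then have "\<mu> = 0"
    using Gz_nonzero[OF p] by simp
  with m show ?thesis
    by (simp add: v zero_prod_def)
qed

lemma solves_YZ_exists:
  assumes p: "(x, y, z) \<in> D" and E: "det (Emat G x y z) \<noteq> 0"
  shows "\<exists>YZ. solves_YZ U I G x y z YZ"
proof -
  define W where "W = {q. (x, q) \<in> D}"
  \<comment> \<open>The inverse function theorem concerns maps of a space into itself, so the
    components are swapped to give values of the same type as \<open>(y, z)\<close>.\<close>
  define f where "f = (\<lambda>q. (snd (F x q), fst (F x q)))"
  define f' where "f' = (\<lambda>q v. (snd (F' x q v), fst (F' x q v)))"
  have der: "(f has_derivative f' q) (at q)" if "q \<in> W" for q
    unfolding f_def f'_def using F_has_derivative[of x q] that
    by (auto simp: W_def intro!: has_derivative_Pair has_derivative_fst has_derivative_snd)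
  have c: "continuous_on W (\<lambda>q. dd v (dd w g) (x, q))" "continuous_on W (\<lambda>q. dd v g (x, q))" for v w
    by (rule continuous_on_compose2[OF smooth_onD(4)[OF smooth_dd(1)[OF smooth_dd(2)]]]
          continuous_on_compose2[OF smooth_onD(4)[OF smooth_dd(2)]];
        auto simp: W_def intro!: continuous_intros)+
  have cont: "continuous_on W (\<lambda>q. f' q v)" for v
    unfolding f'_def F'_def by (auto intro!: continuous_intros c)
  have yW: "(y, z) \<in> W" "open W"
    using p open_yz_slice by (auto simp: W_def)
  have inj: "v = 0" if "f' (y, z) v = 0" for v
    using inj_F'[OF p E] that by (auto simp: f'_def prod_eq_iff)
  obtain W' V h where h: "open W'" "W' \<subseteq> W" "(y, z) \<in> W'" "open V" "f (y, z) \<in> V" "homeomorphism W' V f h"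
    by (rule inverse_function_injective[OF yW(2,1) der cont inj]) auto
  define YZ where "YZ = (\<lambda>(u, p). h (p, u))"
  define N where "N = (\<lambda>(u, p). (p, u)) -` V"
  have fyz: "f (y, z) = (Gx G x y z, G x y z)"
    using F_eq[OF p] by (simp add: f_def)
  have sol: "case YZ (u, p) of (y, z) \<Rightarrow> (x, y) \<in> U \<and> z \<in> I \<and> G x y z = u \<and> Gx G x y z = p"
    if "(u, p) \<in> N" for u p
  proof -
    have "h (p, u) \<in> W" "f (h (p, u)) = (p, u)"
      using that h(2,6) by (auto simp: N_def homeomorphism_def)
    then show ?thesis
      using F_eq[of x "fst (h (p, u))" "snd (h (p, u))"]
      by (auto simp: YZ_def W_def f_def in_D split: prod.splits)
  qed
  have "open N"
    unfolding N_def case_prod_beta by (intro open_vimage[OF h(4)] continuous_intros)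
  moreover have "continuous_on N YZ"
    unfolding YZ_def case_prod_beta
  proof (rule continuous_on_compose2[of V h N "\<lambda>p. (snd p, fst p)"])
    show "continuous_on V h"
      using h(6) by (simp add: homeomorphism_def)
    show "continuous_on N (\<lambda>p. (snd p, fst p))"
      by (intro continuous_intros)
  qed (auto simp: N_def)
  moreover have "(G x y z, Gx G x y z) \<in> N"
    using h(5) by (simp add: N_def fyz)
  moreover have "YZ (G x y z, Gx G x y z) = (y, z)"
    using h(3,6) by (simp add: YZ_def fyz[symmetric] homeomorphism_def)
  moreover have "\<forall>(u, p)\<in>N. case YZ (u, p) of (y, z) \<Rightarrow> (x, y) \<in> U \<and> z \<in> I \<and> G x y z = u \<and> Gx G x y z = p"
  proof
    fix q assume "q \<in> N"
    moreover obtain u p where "q = (u, p)" by fastforce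
    ultimately show "case q of (u, p) \<Rightarrow>
        case YZ (u, p) of (y, z) \<Rightarrow> (x, y) \<in> U \<and> z \<in> I \<and> G x y z = u \<and> Gx G x y z = p"
      using sol[of u p] by (simp only: prod.case)
  qed
  ultimately have "solves_YZ U I G x y z YZ"
    unfolding solves_YZ_def by (intro conjI exI[of _ N])
  then show ?thesis
    by (rule exI[of _ YZ])
qed

text \<open>
  The direction \<open>(0, m, \<mu>)\<close> annihilates \<open>G\<close> at the base point, and \<open>E m = \<gamma>\<close>, so it is the derivative
  of \<open>(Y, Z)\<close> in the direction \<open>p = \<gamma>\<close>. Hence contracting \<open>G\<^sub>i\<^sub>j\<^sub>,\<^sub>p\<^sub>k\<close> with \<open>\<gamma>\<close> differentiates
  \<open>G\<^sub>i\<^sub>j\<close> in this fixed direction, which commutes with the \<open>x\<close>-derivatives.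
\<close>

lemma Gxxp_contraction:
  assumes p: "(x0, y0, z0) \<in> D" and E: "det (Emat G x0 y0 z0) \<noteq> 0"
  obtains m \<mu> where "dd (0, m, \<mu>) g (x0, y0, z0) = 0"
    "\<And>i. pd i (\<lambda>x. dd (0, m, \<mu>) g (x, y0, z0)) x0 = \<gamma> $ i"
    "\<And>i j. (\<Sum>k\<in>UNIV. Gxxp U I G i j k x0 y0 z0 * \<gamma> $ k)
      = pd i (pd j (\<lambda>x. dd (0, m, \<mu>) g (x, y0, z0))) x0"
proof -
  let ?p = "(x0, y0, z0)"
  obtain B where B: "Emat G x0 y0 z0 ** B = mat 1"
    using E invertible_det_nz unfolding invertible_def by blast
  define m where "m = B *v \<gamma>"
  define \<mu> where "\<mu> = - (\<Sum>j\<in>UNIV. m $ j * dd (ey (ax j)) g ?p) / dd ez g ?p"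
  have Em: "Emat G x0 y0 z0 *v m = \<gamma>"
    by (simp add: m_def matrix_vector_mul_assoc B)
  have ann: "dd (0, m, \<mu>) g ?p = 0"
    using dd_yz_expand[OF diff_g[OF p], of m \<mu>] Gz_nonzero[OF p] by (simp add: \<mu>_def)

  \<comment> \<open>\<open>YZsol\<close> is an arbitrary choice, known only to solve the equations
    continuously near the base point. Its derivative there is obtained from the equations, as a left
    inverse \<open>k\<close> of the injective linear map \<open>F' x0 (y0, z0)\<close>.\<close>
  define YZ where "YZ = YZsol U I G x0 y0 z0"
  have "solves_YZ U I G x0 y0 z0 YZ"
    unfolding YZ_def YZsol_def using solves_YZ_exists[OF p E] by (rule someI_ex)
  then have YZ0: "YZ (G x0 y0 z0, Gx G x0 y0 z0) = (y0, z0)"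
    and "\<exists>N. open N \<and> (G x0 y0 z0, Gx G x0 y0 z0) \<in> N \<and> continuous_on N YZ \<and>
      (\<forall>(u, p)\<in>N. case YZ (u, p) of (y, z) \<Rightarrow> (x0, y) \<in> U \<and> z \<in> I \<and> G x0 y z = u \<and> Gx G x0 y z = p)"
    unfolding solves_YZ_def by (rule conjunct1, rule conjunct2)
  then obtain N where N: "open N" "(G x0 y0 z0, Gx G x0 y0 z0) \<in> N" "continuous_on N YZ"
    and sol': "\<forall>(u, p)\<in>N. case YZ (u, p) of (y, z) \<Rightarrow> (x0, y) \<in> U \<and> z \<in> I \<and> G x0 y z = u \<and> Gx G x0 y z = p"
    by (elim exE conjE)
  have sol: "case YZ (u, p) of (y, z) \<Rightarrow> (x0, y) \<in> U \<and> z \<in> I \<and> G x0 y z = u \<and> Gx G x0 y z = p"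
    if "(u, p) \<in> N" for u p
    using bspec[OF sol' that] by (simp only: prod.case)
  define u0 where "u0 = G x0 y0 z0"
  define p0 where "p0 = Gx G x0 y0 z0"
  have YZ: "(x0, YZ (u, p)) \<in> D" "F x0 (YZ (u, p)) = (u, p)" if "(u, p) \<in> N" for u p
  proof -
    obtain y z where yz: "YZ (u, p) = (y, z)" by fastforce
    with sol[OF that] show "(x0, YZ (u, p)) \<in> D" "F x0 (YZ (u, p)) = (u, p)"
      by (auto simp: in_D F_eq)
  qed
  have "inj (F' x0 (y0, z0))"
    using linear_F'[OF p] inj_F'[OF p E] linear_injective_0 by blast
  then obtain k where k: "linear k" "k \<circ> F' x0 (y0, z0) = id"
    using linear_injective_left_inverse[OF linear_F'[OF p]] by blast
  have dYZ: "(YZ has_derivative k) (at (u0, p0))"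
  proof (rule has_derivative_inverse_basic)
    show "(F x0 has_derivative F' x0 (y0, z0)) (at (YZ (u0, p0)))"
      using F_has_derivative[OF p] YZ0 by (simp add: u0_def p0_def)
    show "continuous (at (u0, p0)) YZ"
      using N continuous_on_eq_continuous_at by (auto simp: u0_def p0_def)
    show "F x0 (YZ q) = q" if "q \<in> N" for q
      using YZ(2)[of "fst q" "snd q"] that by simp
  qed (use k N in \<open>auto simp: linear_conv_bounded_linear u0_def p0_def\<close>)
  have k\<gamma>: "k (0, \<gamma>) = (m, \<mu>)"
    using fun_cong[OF k(2), of "(m, \<mu>)"] F'_eq[OF p ann] Em by simp

  let ?P = "\<lambda>x. dd (0, m, \<mu>) g (x, y0, z0)"
  have P1: "pd i ?P x = dd (ex (ax i)) (dd (0, m, \<mu>) g) (x, y0, z0)" if "(x, y0, z0) \<in> D" for i x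
    by (rule pd_dd_x_slice[OF smooth_dd(2) that]) (rule refl)
  have P2: "pd i (pd j ?P) x0 = dd (ex (ax i)) (dd (ex (ax j)) (dd (0, m, \<mu>) g)) ?p" for i j
    by (rule pd_dd_x_slice[OF smooth_dd(1)[OF smooth_dd(2)] p]) (rule P1)
  have "(\<Sum>k\<in>UNIV. Gxxp U I G i j k x0 y0 z0 * \<gamma> $ k) = pd i (pd j ?P) x0" for i j
  proof -
    define \<Phi> where "\<Phi> = dd (ex (ax i)) (dd (ex (ax j)) g)"
    have \<Phi>: "smooth_on \<Phi> D"
      unfolding \<Phi>_def by (rule smooth_dd(1)[OF smooth_dd(2)])
    have "((\<lambda>p. (u0, p)) has_derivative (\<lambda>v. (0, v))) (at p0)"
      by (intro has_derivative_Pair has_derivative_ident has_derivative_const)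
    then have "((\<lambda>p. YZ (u0, p)) has_derivative (\<lambda>v. k (0, v))) (at p0)"
      using dYZ by (rule has_derivative_compose)
    moreover have "((\<lambda>q. \<Phi> (x0, q)) has_derivative (\<lambda>v. dd (0, v) \<Phi> ?p)) (at (YZ (u0, p0)))"
      using dd_yz_slice[OF smooth_onD(1)[OF \<Phi> p]] YZ0 by (simp add: u0_def p0_def)
    ultimately have d: "((\<lambda>p. \<Phi> (x0, YZ (u0, p))) has_derivative (\<lambda>v. dd (0, k (0, v)) \<Phi> ?p)) (at p0)"
      by (rule has_derivative_compose)
    have op: "open {p. (u0, p) \<in> N}" "p0 \<in> {p. (u0, p) \<in> N}"
    proof -
      have "open ((\<lambda>p. (u0, p)) -` N)"
        by (rule open_vimage[OF N(1)]) (intro continuous_intros)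
      then show "open {p. (u0, p) \<in> N}"
        by (simp add: vimage_def)
    qed (use N in \<open>simp add: u0_def p0_def\<close>)
    have "\<Phi> (x0, YZ (u0, p)) = Amat U I G x0 y0 z0 i j u0 p" if "p \<in> {p. (u0, p) \<in> N}" for p
    proof -
      obtain y z where yz: "YZ (u0, p) = (y, z)" by fastforce
      with YZ(1)[of u0 p] that have "(x0, y, z) \<in> D" by simp
      with yz show ?thesis
        by (simp add: Amat_def YZ_def[symmetric] \<Phi>_def Gxx_eq)
    qed
    from has_derivative_transform_within_open[OF d op this]
    have "Gxxp U I G i j k' x0 y0 z0 = dd (0, k (0, ax k')) \<Phi> ?p" for k'
      unfolding Gxxp_def pd_eq_dd u0_def[symmetric] p0_def[symmetric] by (rule dd_eqI)
    moreover have "dd (0, k (0, \<gamma>)) \<Phi> ?p = (\<Sum>k'\<in>UNIV. dd (0, k (0, ax k')) \<Phi> ?p * \<gamma> $ k')"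
    proof -
      have L: "linear (\<lambda>v. dd (0, k (0, v)) \<Phi> ?p)"
        using d by (rule has_derivative_linear)
      have "dd (0, k (0, \<Sum>k'\<in>UNIV. \<gamma> $ k' *\<^sub>R ax k')) \<Phi> ?p = (\<Sum>k'\<in>UNIV. \<gamma> $ k' *\<^sub>R dd (0, k (0, ax k')) \<Phi> ?p)"
        using linear_sum[OF L, of "\<lambda>k'. \<gamma> $ k' *\<^sub>R ax k'" UNIV] by (simp add: linear_scale[OF L])
      then show ?thesis
        using basis_expansion[of \<gamma>] by (simp add: scalar_mult_eq_scaleR mult.commute)
    qed
    ultimately have "(\<Sum>k\<in>UNIV. Gxxp U I G i j k x0 y0 z0 * \<gamma> $ k) = dd (0, m, \<mu>) \<Phi> ?p"
      by (simp add: k\<gamma>)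
    also have "\<dots> = dd (ex (ax i)) (dd (0, m, \<mu>) (dd (ex (ax j)) g)) ?p"
      unfolding \<Phi>_def by (rule commute[OF smooth_dd(2) p])
    also have "\<dots> = dd (ex (ax i)) (dd (ex (ax j)) (dd (0, m, \<mu>) g)) ?p"
      by (rule dd_cong_D[OF commute[OF smooth_g] p smooth_dd(1)[OF smooth_dd(2)]])
    finally show ?thesis
      by (simp add: P2)
  qed
  moreover have "pd i ?P x0 = \<gamma> $ i" for i
    using P1[OF p, of i] Emat_mult[OF p ann, of i] Em by simp
  ultimately show ?thesis
    using that[OF ann] by blast
qed

section \<open>The map \<open>Q\<close> and its derivative\<close>

lemma Qmap_eq: "(x, y, z) \<in> D \<Longrightarrow>
    Qmap G x y z = (- inverse (dd ez g (x, y, z))) *\<^sub>R (\<chi> j. dd (ey (ax j)) g (x, y, z))"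
  by (simp add: Qmap_def Gz_eq Gy_eq)

text \<open>For fixed \<open>(m, \<mu>)\<close> and varying \<open>x\<close>, this derivative of
  \<open>G\<close> is a positive multiple of an affine function of \<open>Q\<close>. Its zero set is
  thus the preimage of a hyperplane, which links the generating function to the geometry of the
  image.\<close>

lemma dd_yz_Qmap:
  assumes p: "(x, y, z) \<in> D"
  shows "dd (0, m, \<mu>) g (x, y, z) = - dd ez g (x, y, z) * (Qmap G x y z \<bullet> m - \<mu>)"
proof -
  define a where "a = dd ez g (x, y, z)"
  define b where "b = (\<lambda>j. dd (ey (ax j)) g (x, y, z))"
  have a: "a \<noteq> 0"
    using Gz_nonzero[OF p] by (simp add: a_def)
  have "Qmap G x y z \<bullet> m = - inverse a * (\<Sum>j\<in>UNIV. m $ j * b j)"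
    unfolding Qmap_eq[OF p] inner_scaleR_left by (simp add: inner_vec_def a_def b_def mult.commute)
  then have "(\<Sum>j\<in>UNIV. m $ j * b j) = - a * (Qmap G x y z \<bullet> m)"
    using a by simp
  moreover have "dd (0, m, \<mu>) g (x, y, z) = (\<Sum>j\<in>UNIV. m $ j * b j) + \<mu> * a"
    unfolding a_def b_def by (rule dd_yz_expand[OF diff_g[OF p]])
  ultimately show ?thesis
    unfolding a_def[symmetric] by (simp add: right_diff_distrib mult.commute)
qed

lemma slice_has_derivative:
  assumes "smooth_on f D" "(x, y, z) \<in> D"
  shows "((\<lambda>x. f (x, y, z)) has_derivative (\<lambda>v. dd (ex v) f (x, y, z))) (at x)"
proof -
  have "((\<lambda>x. (x, y, z)) has_derivative (\<lambda>v. ex v)) (at x)"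
    by (intro has_derivative_Pair has_derivative_ident has_derivative_const)+
  moreover have "(f has_derivative (\<lambda>v. dd v f (x, y, z))) (at (x, y, z))"
    using smooth_onD(1)[OF assms] unfolding frechet_derivative_works .
  ultimately show ?thesis
    by (rule has_derivative_compose)
qed

lemma slice_continuous:
  assumes "smooth_on f D"
  shows "continuous_on {x. (x, y, z) \<in> D} (\<lambda>x. f (x, y, z))"
  by (rule continuous_on_compose2[OF smooth_onD(4)[OF assms]]) (auto intro!: continuous_intros)

lemma Ck_on_slice_dd: "Ck_on k (\<lambda>x. dd v g (x, y, z)) {x. (x, y, z) \<in> D}"
  by (rule Ck_on_slice[OF open_D smooth_onD(3)[OF smooth_dd(2)]])

text \<open>The quotient rule for the \<open>x\<close>-derivative of \<open>Qmap\<close>, written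
  out in derivatives of \<open>g\<close> so that the continuity required by the inverse function
  theorem can be read off.\<close>

definition Q' :: "real^'n \<Rightarrow> real \<Rightarrow> real^'n \<Rightarrow> real^'n \<Rightarrow> real^'n" where
  "Q' y z x v = (- inverse (dd ez g (x, y, z))) *\<^sub>R (\<chi> j. dd (ex v) (dd (ey (ax j)) g) (x, y, z))
    + (inverse (dd ez g (x, y, z)) * dd (ex v) (dd ez g) (x, y, z) * inverse (dd ez g (x, y, z)))
      *\<^sub>R (\<chi> j. dd (ey (ax j)) g (x, y, z))"

lemma Q'_has_derivative:
  assumes p: "(x, y, z) \<in> D"
  shows "((\<lambda>x. Qmap G x y z) has_derivative Q' y z x) (at x)"
proof -
  define a where "a = (\<lambda>x. dd ez g (x, y, z))"
  define a' where "a' = (\<lambda>v. dd (ex v) (dd ez g) (x, y, z))"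
  define b where "b = (\<lambda>x. \<chi> j. dd (ey (ax j)) g (x, y, z))"
  define b' where "b' = (\<lambda>v. \<chi> j. dd (ex v) (dd (ey (ax j)) g) (x, y, z))"
  have a0: "a x \<noteq> 0"
    using Gz_nonzero[OF p] by (simp add: a_def)
  have a: "(a has_derivative a') (at x)"
    unfolding a_def a'_def by (rule slice_has_derivative[OF smooth_dd(2) p])
  have b: "(b has_derivative b') (at x)"
    unfolding b_def b'_def by (rule has_derivative_vec_lambda) (rule slice_has_derivative[OF smooth_dd(2) p])
  have "((\<lambda>x. - inverse (a x)) has_derivative (\<lambda>v. - (- (inverse (a x) * a' v * inverse (a x))))) (at x)"
    by (intro has_derivative_minus Deriv.has_derivative_inverse a0 a)
  from has_derivative_scaleR[OF this b]
  have "((\<lambda>x. (- inverse (a x)) *\<^sub>R b x) has_derivative Q' y z x) (at x)"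
    unfolding Q'_def[abs_def] a_def[symmetric] a'_def[symmetric] b_def[symmetric] b'_def[symmetric]
    by (simp add: a_def b_def a'_def b'_def)
  then show ?thesis
  proof (rule has_derivative_transform_within_open[OF _ open_x_slice[of "(y, z)"]])
    show "(- inverse (a x)) *\<^sub>R b x = Qmap G x y z" if "x \<in> {x. (x, y, z) \<in> D}" for x
      using that Qmap_eq[of x y z] by (simp add: a_def b_def)
  qed (use p in simp)
qed

lemma Q'_continuous: "continuous_on {x. (x, y, z) \<in> D} (\<lambda>x. Q' y z x v)"
proof -
  let ?S = "{x. (x, y, z) \<in> D}"
  have "dd ez g (x, y, z) \<noteq> 0" if "x \<in> ?S" for x
    using Gz_nonzero[of "(x, y, z)"] that by simp
  then have 1: "continuous_on ?S (\<lambda>x. inverse (dd ez g (x, y, z)))"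
    by (intro continuous_on_inverse slice_continuous smooth_dd(2)) blast
  have 2: "continuous_on ?S (\<lambda>x. \<chi> j. dd (ey (ax j)) g (x, y, z))"
    by (intro continuous_on_vec_lambda slice_continuous smooth_dd(2))
  have 3: "continuous_on ?S (\<lambda>x. dd (ex v) (dd w g) (x, y, z))" for w
    by (rule slice_continuous[OF smooth_dd(1)[OF smooth_dd(2)]])
  have 4: "continuous_on ?S (\<lambda>x. \<chi> j. dd (ex v) (dd (ey (ax j)) g) (x, y, z))"
    by (rule continuous_on_vec_lambda) (rule 3)
  show ?thesis
    unfolding Q'_def
    by (intro continuous_on_add continuous_on_scaleR continuous_on_mult continuous_on_minus 1 2 3 4)
qed

text \<open>The affine factor of \<open>dd_yz_Qmap\<close> vanishes at \<open>x0\<close>, so the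
  derivative of the factor \<open>G_z\<close> contributes nothing.\<close>

lemma dd_P_Q':
  assumes p: "(x0, y0, z0) \<in> D" and ann: "dd (0, m, \<mu>) g (x0, y0, z0) = 0"
  shows "dd v (\<lambda>x. dd (0, m, \<mu>) g (x, y0, z0)) x0 = - dd ez g (x0, y0, z0) * (Q' y0 z0 x0 v \<bullet> m)"
proof -
  have \<mu>: "Qmap G x0 y0 z0 \<bullet> m - \<mu> = 0"
    using ann Gz_nonzero[OF p] unfolding dd_yz_Qmap[OF p, of m \<mu>] by simp
  define a where "a = (\<lambda>x. dd ez g (x, y0, z0))"
  define a' where "a' = (\<lambda>v. dd (ex v) (dd ez g) (x0, y0, z0))"
  have a: "(a has_derivative a') (at x0)"
    unfolding a_def a'_def by (rule slice_has_derivative[OF smooth_dd(2) p])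
  have "((\<lambda>x. Qmap G x y0 z0 \<bullet> m - \<mu>) has_derivative (\<lambda>v. Q' y0 z0 x0 v \<bullet> m - 0)) (at x0)"
    by (intro has_derivative_diff has_derivative_inner_left has_derivative_const Q'_has_derivative[OF p])
  from has_derivative_mult[OF has_derivative_minus[OF a] this]
  have "((\<lambda>x. - a x * (Qmap G x y0 z0 \<bullet> m - \<mu>)) has_derivative (\<lambda>v. - a x0 * (Q' y0 z0 x0 v \<bullet> m))) (at x0)"
    unfolding \<mu> by simp
  then have "((\<lambda>x. dd (0, m, \<mu>) g (x, y0, z0)) has_derivative (\<lambda>v. - a x0 * (Q' y0 z0 x0 v \<bullet> m))) (at x0)"
  proof (rule has_derivative_transform_within_open[OF _ open_x_slice[of "(y0, z0)"]])
    show "- a x * (Qmap G x y0 z0 \<bullet> m - \<mu>) = dd (0, m, \<mu>) g (x, y0, z0)" if "x \<in> {x. (x, y0, z0) \<in> D}" for x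
      using that dd_yz_Qmap[of x y0 z0 m \<mu>] by (simp add: a_def)
  qed (use p in simp)
  then show ?thesis
    unfolding a_def by (rule dd_eqI)
qed

section \<open>Second-order comparison at the boundary\<close>

text \<open>For tangent \<tau> this is twice the limit of \<open>\<phi> (c s) / s^2\<close> along a
  curve with velocity \<tau> whose image under \<open>Q\<close> is a straight line, as
  \<open>contact\<close> shows with \<open>w = 0\<close>. The vector \<tau> is not normalized,
  because the local inverse of \<open>Q\<close> produces velocities of any length.\<close>

definition curv :: "real^'n \<Rightarrow> real \<Rightarrow> (real^'n \<Rightarrow> real) \<Rightarrow> real^'n \<Rightarrow> real^'n \<Rightarrow> real" where
  "curv y0 z0 \<phi> x \<tau> = hess \<phi> x \<tau> - norm (grad \<phi> x) * (\<Sum>i\<in>UNIV. \<Sum>j\<in>UNIV.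
      (\<Sum>k\<in>UNIV. Gxxp U I G i j k x y0 z0 * sgn (grad \<phi> x) $ k) * \<tau> $ i * \<tau> $ j)"

lemma curv_scaleR: "curv y0 z0 \<phi> x (r *\<^sub>R \<tau>) = r\<^sup>2 * curv y0 z0 \<phi> x \<tau>"
proof -
  have "hess \<phi> x (r *\<^sub>R \<tau>) = r\<^sup>2 * hess \<phi> x \<tau>"
    by (simp add: hess_def sum_distrib_left power2_eq_square mult_ac)
  moreover have "(\<Sum>i\<in>UNIV. \<Sum>j\<in>UNIV. A i j * (r *\<^sub>R \<tau>) $ i * (r *\<^sub>R \<tau>) $ j)
      = r\<^sup>2 * (\<Sum>i\<in>UNIV. \<Sum>j\<in>UNIV. A i j * \<tau> $ i * \<tau> $ j)" for A :: "'n \<Rightarrow> 'n \<Rightarrow> real"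
    by (simp add: sum_distrib_left power2_eq_square mult_ac)
  ultimately show ?thesis
    by (simp add: curv_def right_diff_distrib)
qed

text \<open>
  Let \<open>P(x) = G\<^sub>y \<bullet> m + \<mu> G\<^sub>z = - G\<^sub>z(x) (q(x) - q(x0)) \<bullet> m\<close> with \<open>q = Q(\<cdot>, y0, z0)\<close>. A multiple \<open>\<lambda> P\<close> has the
  same gradient at \<open>x0\<close> as \<open>\<phi>\<close>, and \<open>P\<close> is explicitly known along curves that \<open>q\<close> maps to parabolas. So
  the second-order behaviour of \<open>\<phi>\<close> along them can be read off the Hessian of \<open>\<phi> - \<lambda> P\<close>, without
  second derivatives of \<open>q\<close>.
\<close>

lemma contact:
  assumes p: "(x0, y0, z0) \<in> D" and E: "det (Emat G x0 y0 z0) \<noteq> 0"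
    and \<phi>: "defining_function \<Omega> N \<phi>" and x0: "x0 \<in> frontier \<Omega>" "x0 \<in> N"
  shows "\<exists>m. (\<forall>v. grad \<phi> x0 \<bullet> v = norm (grad \<phi> x0) * (- Gz G x0 y0 z0) * (Q' y0 z0 x0 v \<bullet> m)) \<and>
    (\<forall>c \<tau> \<xi> w. c 0 = x0 \<longrightarrow> (c has_vector_derivative \<tau>) (at 0) \<longrightarrow> \<xi> \<bullet> m = 0 \<longrightarrow>
        (\<forall>\<^sub>F s in at 0. (c s, y0, z0) \<in> D \<and> Qmap G (c s) y0 z0 = Qmap G x0 y0 z0 + s *\<^sub>R \<xi> + s\<^sup>2 *\<^sub>R w)
      \<longrightarrow> ((\<lambda>s. \<phi> (c s) / s\<^sup>2) \<longlongrightarrow>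
        curv y0 z0 \<phi> x0 \<tau> / 2 + norm (grad \<phi> x0) * (- Gz G x0 y0 z0) * (w \<bullet> m)) (at 0))"
proof -
  define \<gamma> where "\<gamma> = sgn (grad \<phi> x0)"
  define l where "l = norm (grad \<phi> x0)"
  have grad: "grad \<phi> x0 = l *\<^sub>R \<gamma>"
    using grad_nonzero[OF \<phi> x0(2)] by (simp add: \<gamma>_def l_def sgn_div_norm)
  obtain m \<mu> where ann: "dd (0, m, \<mu>) g (x0, y0, z0) = 0"
    and P1: "\<And>i. pd i (\<lambda>x. dd (0, m, \<mu>) g (x, y0, z0)) x0 = \<gamma> $ i"
    and P2: "\<And>i j. (\<Sum>k\<in>UNIV. Gxxp U I G i j k x0 y0 z0 * \<gamma> $ k)
      = pd i (pd j (\<lambda>x. dd (0, m, \<mu>) g (x, y0, z0))) x0"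
    by (rule Gxxp_contraction[OF p E, of \<gamma>]) (rule that; blast)
  define P where "P = (\<lambda>x. dd (0, m, \<mu>) g (x, y0, z0))"
  define V where "V = {x. (x, y0, z0) \<in> D}"
  have V: "open V" "x0 \<in> V" "Ck_on 2 P V"
    using p open_x_slice[of "(y0, z0)"] Ck_on_slice_dd by (auto simp: V_def P_def)
  have P0: "P x0 = 0"
    by (simp add: P_def ann)
  have \<mu>: "Qmap G x0 y0 z0 \<bullet> m = \<mu>"
    using ann Gz_nonzero[OF p] dd_yz_Qmap[OF p, of m \<mu>] by simp
  have dP: "dd v P x0 = \<gamma> \<bullet> v" for v
    using dd_axis_expand[OF Ck_on_2D(1)[OF V(3,2)], of v] P1
    by (simp add: P_def inner_vec_def mult.commute)
  have a: "grad \<phi> x0 \<bullet> v = l * (- Gz G x0 y0 z0) * (Q' y0 z0 x0 v \<bullet> m)" for v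
  proof -
    have "\<gamma> \<bullet> v = - dd ez g (x0, y0, z0) * (Q' y0 z0 x0 v \<bullet> m)"
      using dP[of v] dd_P_Q'[OF p ann, of v] by (simp only: P_def)
    then show ?thesis
      by (simp add: grad Gz_eq[OF p])
  qed
  have "((\<lambda>s. \<phi> (c s) / s\<^sup>2) \<longlongrightarrow> curv y0 z0 \<phi> x0 \<tau> / 2 + l * (- Gz G x0 y0 z0) * (w \<bullet> m)) (at 0)"
    if c: "c 0 = x0" "(c has_vector_derivative \<tau>) (at 0)" and \<xi>: "\<xi> \<bullet> m = 0"
      and q: "\<forall>\<^sub>F s in at 0. (c s, y0, z0) \<in> D \<and> Qmap G (c s) y0 z0 = Qmap G x0 y0 z0 + s *\<^sub>R \<xi> + s\<^sup>2 *\<^sub>R w"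
    for c \<tau> \<xi> w
  proof -
    define A where "A = (\<lambda>s. (\<phi> (c s) - \<phi> x0 - dd (c s - x0) \<phi> x0) / s\<^sup>2)"
    define B where "B = (\<lambda>s. (P (c s) - P x0 - dd (c s - x0) P x0) / s\<^sup>2)"
    have A: "(A \<longlongrightarrow> hess \<phi> x0 \<tau> / 2) (at 0)"
      unfolding A_def by (rule taylor_along_curve[OF C2[OF \<phi>] open_N[OF \<phi>] x0(2) c(2,1)])
    have B: "(B \<longlongrightarrow> hess P x0 \<tau> / 2) (at 0)"
      unfolding B_def by (rule taylor_along_curve[OF V(3,1,2) c(2,1)])
    have "isCont (\<lambda>x. dd ez g (x, y0, z0)) x0"
      by (rule has_derivative_continuous[OF slice_has_derivative[OF smooth_dd(2) p]])
    moreover have "(c \<longlongrightarrow> x0) (at 0)"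
      using has_vector_derivative_continuous[OF c(2)] c(1) by (simp add: isCont_def)
    ultimately have C: "((\<lambda>s. dd ez g (c s, y0, z0)) \<longlongrightarrow> dd ez g (x0, y0, z0)) (at 0)"
      by (rule isCont_tendsto_compose)
    have "\<forall>\<^sub>F s in at (0::real). s \<noteq> 0"
      by (simp add: eventually_at_filter)
    with q have "\<forall>\<^sub>F s in at 0. A s - l * B s + l * (- dd ez g (c s, y0, z0)) * (w \<bullet> m) = \<phi> (c s) / s\<^sup>2"
    proof eventually_elim
      case (elim s)
      then have Dc: "(c s, y0, z0) \<in> D" and "Qmap G (c s) y0 z0 = Qmap G x0 y0 z0 + s *\<^sub>R \<xi> + s\<^sup>2 *\<^sub>R w"
        by auto
      \<comment> \<open>The linear term in \<open>s\<close> disappears since \<xi> is orthogonal to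
        \<open>m\<close>, and the constant term since the hyperplane passes through the image of
        \<open>x0\<close>.\<close>
      then have "Qmap G (c s) y0 z0 \<bullet> m - \<mu> = s\<^sup>2 * (w \<bullet> m)"
        using \<mu> \<xi> by (simp add: inner_add_left)
      then have Pc: "P (c s) = - dd ez g (c s, y0, z0) * (s\<^sup>2 * (w \<bullet> m))"
        unfolding P_def using dd_yz_Qmap[OF Dc, of m \<mu>] by simp
      have "\<phi> x0 = 0"
        using in_frontier_iff[OF \<phi>] x0 by blast
      \<comment> \<open>The gradients of \<phi> and \<open>l P\<close> agree, so the exact
        first-order terms cancel; individually they are known only up to \<open>o(s)\<close>, too
        coarse for a division by \<open>s^2\<close>.\<close>
      moreover have "dd (c s - x0) \<phi> x0 = l * dd (c s - x0) P x0"
        using dd_\<phi>[OF \<phi> x0(2)] dP by (simp add: grad)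
      ultimately have "A s - l * B s = (\<phi> (c s) - l * P (c s)) / s\<^sup>2"
        using P0 by (simp add: A_def B_def diff_divide_distrib right_diff_distrib)
      also have "\<dots> = \<phi> (c s) / s\<^sup>2 - l * (- dd ez g (c s, y0, z0)) * (w \<bullet> m)"
        unfolding Pc using elim(2) by (simp add: diff_divide_distrib add_divide_distrib)
      finally show ?case
        by linarith
    qed
    moreover have "((\<lambda>s. A s - l * B s + l * (- dd ez g (c s, y0, z0)) * (w \<bullet> m)) \<longlongrightarrow>
        hess \<phi> x0 \<tau> / 2 - l * (hess P x0 \<tau> / 2) + l * (- dd ez g (x0, y0, z0)) * (w \<bullet> m)) (at 0)"
      by (intro tendsto_add tendsto_diff tendsto_mult tendsto_minus A B C tendsto_const)
    ultimately have lim: "((\<lambda>s. \<phi> (c s) / s\<^sup>2) \<longlongrightarrow>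
        hess \<phi> x0 \<tau> / 2 - l * (hess P x0 \<tau> / 2) + l * (- dd ez g (x0, y0, z0)) * (w \<bullet> m)) (at 0)"
      by (rule Lim_transform_eventually[rotated])
    have "hess P x0 \<tau> = (\<Sum>i\<in>UNIV. \<Sum>j\<in>UNIV. (\<Sum>k\<in>UNIV. Gxxp U I G i j k x0 y0 z0 * \<gamma> $ k) * \<tau> $ i * \<tau> $ j)"
      unfolding hess_def P2 P_def by (simp add: mult_ac)
    then have e: "hess \<phi> x0 \<tau> / 2 - l * (hess P x0 \<tau> / 2) = curv y0 z0 \<phi> x0 \<tau> / 2"
      by (simp add: curv_def l_def \<gamma>_def diff_divide_distrib)
    show ?thesis
      using lim unfolding e Gz_eq[OF p] .
  qed
  with a show ?thesis
    unfolding l_def by (intro exI[of _ m] conjI allI impI)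
qed

text \<open>Taking \<open>v\<close> for \<gamma> in \<open>Gxxp_contraction\<close> yields a
  function with gradient \<open>v\<close> at \<open>x0\<close> whose derivative factors through
  \<open>Q'\<close>. Its derivative along \<open>v\<close> is both \<open>v \<bullet> v\<close> and
  zero, which avoids writing \<open>Q'\<close> as a multiple of the transpose of
  \<open>E\<close>.\<close>

lemma Q'_injective:
  assumes p: "(x0, y0, z0) \<in> D" and E: "det (Emat G x0 y0 z0) \<noteq> 0" and v: "Q' y0 z0 x0 v = 0"
  shows "v = 0"
proof -
  obtain m \<mu> where ann: "dd (0, m, \<mu>) g (x0, y0, z0) = 0"
    and P1: "\<And>i. pd i (\<lambda>x. dd (0, m, \<mu>) g (x, y0, z0)) x0 = v $ i"
    and "\<And>i j. (\<Sum>k\<in>UNIV. Gxxp U I G i j k x0 y0 z0 * v $ k)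
      = pd i (pd j (\<lambda>x. dd (0, m, \<mu>) g (x, y0, z0))) x0"
    by (rule Gxxp_contraction[OF p E, of v]) (rule that; blast)
  have "(\<lambda>x. dd (0, m, \<mu>) g (x, y0, z0)) differentiable (at x0)"
    by (rule differentiableI[OF slice_has_derivative[OF smooth_dd(2) p]])
  from dd_axis_expand[OF this, of v] have "v \<bullet> v = dd v (\<lambda>x. dd (0, m, \<mu>) g (x, y0, z0)) x0"
    using P1 by (simp add: inner_vec_def)
  also have "\<dots> = 0"
    using dd_P_Q'[OF p ann, of v] v by simp
  finally show ?thesis
    by simp
qed

end

section \<open>The image of the domain\<close>

text \<open>The assumptions reach up to the boundary: \<open>q\<close> has to be differentiable
  across the frontier and a local diffeomorphism there, and injectivity on the closure keeps the
  image of the frontier apart from the image of \<Omega>.\<close>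

locale generating_domain = generating_function U I G
  for U :: "((real^'n::finite) \<times> (real^'n)) set" and I :: "real set" and G :: "'n genfun" +
  fixes \<Omega> :: "(real^'n) set" and y0 :: "real^'n" and z0 :: real
  assumes open_\<Omega>: "open \<Omega>" and bounded_\<Omega>: "bounded \<Omega>"
    and closure_D: "x \<in> closure \<Omega> \<Longrightarrow> (x, y0, z0) \<in> D"
    and inj_q: "inj_on (\<lambda>x. Qmap G x y0 z0) (closure \<Omega>)"
    and det_E: "x \<in> frontier \<Omega> \<Longrightarrow> det (Emat G x y0 z0) \<noteq> 0"
begin

definition q :: "real^'n \<Rightarrow> real^'n" where "q x = Qmap G x y0 z0"
abbreviation q' :: "real^'n \<Rightarrow> real^'n \<Rightarrow> real^'n" where "q' \<equiv> Q' y0 z0"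
abbreviation V :: "(real^'n) set" where "V \<equiv> {x. (x, y0, z0) \<in> D}"

lemma open_V: "open V"
  using open_x_slice[of "(y0, z0)"] .

lemma frontier_subset_closure: "x \<in> frontier \<Omega> \<Longrightarrow> x \<in> closure \<Omega>"
  by (simp add: frontier_def)

lemma not_in_domain: "x \<in> frontier \<Omega> \<Longrightarrow> x \<notin> \<Omega>"
  using open_\<Omega> by (simp add: frontier_def interior_open)

lemma frontier_V: "x \<in> frontier \<Omega> \<Longrightarrow> (x, y0, z0) \<in> D"
  using closure_D frontier_subset_closure by blast

lemma q_has_derivative: "x \<in> V \<Longrightarrow> (q has_derivative q' x) (at x)"
  unfolding q_def[abs_def] by (rule Q'_has_derivative) simp

lemma q_cont: "continuous_on (closure \<Omega>) q"
proof (rule continuous_at_imp_continuous_on, rule ballI)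
  fix x assume "x \<in> closure \<Omega>"
  then have "x \<in> V"
    using closure_D by blast
  then show "isCont q x"
    by (rule has_derivative_continuous[OF q_has_derivative])
qed

lemma inj_on_q: "inj_on q (closure \<Omega>)"
  using inj_q unfolding q_def[abs_def] .

lemma compact_closure_Omega: "compact (closure \<Omega>)"
  using bounded_\<Omega> compact_closure by blast

lemma closure_image_q: "closure (q ` \<Omega>) = q ` closure \<Omega>"
proof
  have "closed (q ` closure \<Omega>)"
    by (intro compact_imp_closed compact_continuous_image q_cont compact_closure_Omega)
  then show "closure (q ` \<Omega>) \<subseteq> q ` closure \<Omega>"
    by (intro closure_minimal image_mono closure_subset)
  show "q ` closure \<Omega> \<subseteq> closure (q ` \<Omega>)"
    by (rule image_closure_subset[OF q_cont]) (auto simp: closure_subset)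
qed

lemma open_image_q: "open (q ` \<Omega>)"
  by (rule invariance_of_domain[OF continuous_on_subset[OF q_cont closure_subset] open_\<Omega>
        inj_on_subset[OF inj_on_q closure_subset]])

lemma frontier_image_q:
  assumes "b \<in> frontier (q ` \<Omega>)"
  obtains x where "x \<in> frontier \<Omega>" "q x = b"
proof -
  have "b \<in> q ` closure \<Omega>" "b \<notin> q ` \<Omega>"
    using assms open_image_q by (auto simp: frontier_def closure_image_q interior_open)
  then show ?thesis
    using that open_\<Omega> by (auto simp: frontier_def interior_open)
qed

lemma q_eq_frontier:
  assumes x: "x \<in> frontier \<Omega>"
  shows "q x \<notin> q ` \<Omega>"
proof
  assume "q x \<in> q ` \<Omega>"
  then obtain w where w: "w \<in> \<Omega>" "q x = q w"
    by blast
  then have "w \<in> closure \<Omega>"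
    using closure_subset by blast
  with inj_on_q w(2) frontier_subset_closure[OF x] have "x = w"
    by (rule inj_onD)
  with w not_in_domain[OF x] show False
    by blast
qed

lemma local_inverse:
  assumes x0: "x0 \<in> frontier \<Omega>" "x0 \<in> N" and N: "open N"
  shows "\<exists>W W' h h'. open W \<and> W \<subseteq> V \<inter> N \<and> x0 \<in> W \<and> open W' \<and> q x0 \<in> W' \<and>
    (\<forall>y\<in>W'. h y \<in> W \<and> q (h y) = y) \<and> (\<forall>x\<in>W. h (q x) = x) \<and>
    (\<forall>y\<in>W'. (h has_derivative h' y) (at y)) \<and> (\<forall>y\<in>W'. \<forall>v. q' (h y) (h' y v) = v) \<and>
    (\<forall>v. ((\<lambda>y. h' y v) \<longlongrightarrow> h' (q x0) v) (at (q x0)))"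
proof -
  have VN: "open (V \<inter> N)" "x0 \<in> V \<inter> N"
    using open_V N x0 frontier_V by auto
  have der: "(q has_derivative q' x) (at x)" if "x \<in> V \<inter> N" for x
    using q_has_derivative that by blast
  have cont: "continuous_on (V \<inter> N) (\<lambda>x. q' x v)" for v
    by (rule continuous_on_subset[OF Q'_continuous]) blast
  have inj: "v = 0" if "q' x0 v = 0" for v
    using Q'_injective[OF frontier_V[OF x0(1)] det_E[OF x0(1)] that] .
  obtain W W' h h' where *: "open W" "W \<subseteq> V \<inter> N" "x0 \<in> W" "open W'" "q x0 \<in> W'" "homeomorphism W W' q h"
    "\<And>y. y \<in> W' \<Longrightarrow> (h has_derivative h' y) (at y)" "\<And>y v. y \<in> W' \<Longrightarrow> q' (h y) (h' y v) = v"
    "\<And>v. ((\<lambda>y. h' y v) \<longlongrightarrow> h' (q x0) v) (at (q x0))"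
    by (rule inverse_function_injective[OF VN der cont inj]) auto
  have 1: "\<forall>y\<in>W'. h y \<in> W \<and> q (h y) = y" "\<forall>x\<in>W. h (q x) = x"
    using *(6) by (auto simp: homeomorphism_def)
  have 2: "\<forall>y\<in>W'. (h has_derivative h' y) (at y)"
    by (intro ballI *(7))
  have 3: "\<forall>y\<in>W'. \<forall>v. q' (h y) (h' y v) = v"
    by (intro ballI allI *(8))
  have 4: "\<forall>v. ((\<lambda>y. h' y v) \<longlongrightarrow> h' (q x0) v) (at (q x0))"
    by (intro allI *(9))
  show ?thesis
    by (rule exI[of _ W], rule exI[of _ W'], rule exI[of _ h], rule exI[of _ h']) (intro conjI *(1-5) 1 2 3 4)
qed

lemma parabola_tendsto: "((\<lambda>s. b + s *\<^sub>R \<xi> + s\<^sup>2 *\<^sub>R w) \<longlongrightarrow> b) (at (0::real))" for b :: "'b::real_normed_vector"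
proof -
  have "((\<lambda>s. b + s *\<^sub>R \<xi> + s\<^sup>2 *\<^sub>R w) \<longlongrightarrow> b + 0 *\<^sub>R \<xi> + 0\<^sup>2 *\<^sub>R w) (at (0::real))"
    by (intro tendsto_intros)
  then show ?thesis by simp
qed

lemma parabola_lift:
  assumes h: "(h has_derivative h') (at b)"
  shows "((\<lambda>s. h (b + s *\<^sub>R \<xi> + s\<^sup>2 *\<^sub>R w)) has_vector_derivative h' \<xi>) (at (0::real))"
proof -
  have "((\<lambda>s. b + s *\<^sub>R \<xi> + s\<^sup>2 *\<^sub>R w) has_derivative (\<lambda>s. s *\<^sub>R \<xi>)) (at (0::real))"
    by (auto intro!: derivative_eq_intros)
  moreover have "(h has_derivative h') (at (b + 0 *\<^sub>R \<xi> + 0\<^sup>2 *\<^sub>R w))"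
    using h by simp
  ultimately have "((\<lambda>s. h (b + s *\<^sub>R \<xi> + s\<^sup>2 *\<^sub>R w)) has_derivative (\<lambda>s. h' (s *\<^sub>R \<xi>))) (at (0::real))"
    by (rule has_derivative_compose)
  then show ?thesis
    using has_derivative_linear[OF h] by (simp add: has_vector_derivative_def linear_scale)
qed

lemma curv_nonneg_if_convex:
  assumes conv: "convex (q ` \<Omega>)" and \<phi>: "defining_function \<Omega> N \<phi>"
    and x0: "x0 \<in> frontier \<Omega>" "x0 \<in> N" and \<tau>: "grad \<phi> x0 \<bullet> \<tau> = 0"
  shows "curv y0 z0 \<phi> x0 \<tau> \<ge> 0"
proof (rule ccontr)
  assume neg: "\<not> curv y0 z0 \<phi> x0 \<tau> \<ge> 0"
  note p = frontier_V[OF x0(1)] and E = det_E[OF x0(1)]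
  obtain W W' h h' where W: "open W" "W \<subseteq> V \<inter> N" "x0 \<in> W" "open W'" "q x0 \<in> W'"
    and h': "\<forall>y\<in>W'. h y \<in> W \<and> q (h y) = y" "\<forall>x\<in>W. h (q x) = x"
      "\<forall>y\<in>W'. (h has_derivative h' y) (at y)" "\<forall>y\<in>W'. \<forall>v. q' (h y) (h' y v) = v"
      "\<forall>v. ((\<lambda>y. h' y v) \<longlongrightarrow> h' (q x0) v) (at (q x0))"
    using local_inverse[OF x0 open_N[OF \<phi>]] by (elim exE conjE) (rule that)
  note h = h'(1)[THEN bspec] h'(2)[THEN bspec] h'(3)[THEN bspec] h'(4)[THEN bspec, THEN spec] h'(5)[THEN spec]
  obtain m where a: "\<forall>v. grad \<phi> x0 \<bullet> v = norm (grad \<phi> x0) * (- Gz G x0 y0 z0) * (q' x0 v \<bullet> m)"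
    and lim: "\<forall>c \<tau> \<xi> w. c 0 = x0 \<longrightarrow> (c has_vector_derivative \<tau>) (at 0) \<longrightarrow> \<xi> \<bullet> m = 0 \<longrightarrow>
        (\<forall>\<^sub>F s in at 0. (c s, y0, z0) \<in> D \<and> Qmap G (c s) y0 z0 = Qmap G x0 y0 z0 + s *\<^sub>R \<xi> + s\<^sup>2 *\<^sub>R w)
      \<longrightarrow> ((\<lambda>s. \<phi> (c s) / s\<^sup>2) \<longlongrightarrow>
        curv y0 z0 \<phi> x0 \<tau> / 2 + norm (grad \<phi> x0) * (- Gz G x0 y0 z0) * (w \<bullet> m)) (at 0)"
    using contact[OF p E \<phi> x0] by (elim exE conjE) (rule that)
  have "Gz G x0 y0 z0 \<noteq> 0"
    using Gz_nonzero[OF p] Gz_eq[OF p] by simp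
  moreover define \<xi> where "\<xi> = q' x0 \<tau>"
  ultimately have \<xi>m: "\<xi> \<bullet> m = 0"
    using a[rule_format, of \<tau>] \<tau> grad_nonzero[OF \<phi> x0(2)] by simp
  have hx0: "h (q x0) = x0"
    using h(2) W(3) .
  have "q' x0 (h' (q x0) \<xi> - \<tau>) = 0"
    using h(4)[OF W(5), of \<xi>] has_derivative_linear[OF q_has_derivative[of x0]] p
    by (simp add: hx0 linear_diff \<xi>_def)
  then have h'\<xi>: "h' (q x0) \<xi> = \<tau>"
    using Q'_injective[OF p E] by fastforce
  \<comment> \<open>With \<open>w = 0\<close> the parabola is a straight chord through
    \<open>q x0\<close>, and the limit from \<open>contact\<close> is half the curvature
    alone.\<close>
  define c where "c = (\<lambda>s. h (q x0 + s *\<^sub>R \<xi> + s\<^sup>2 *\<^sub>R 0))"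
  have evW: "\<forall>\<^sub>F s in at 0. q x0 + s *\<^sub>R \<xi> + s\<^sup>2 *\<^sub>R 0 \<in> W'"
    using topological_tendstoD[OF parabola_tendsto W(4,5)] .
  have "((\<lambda>s. \<phi> (c s) / s\<^sup>2) \<longlongrightarrow>
        curv y0 z0 \<phi> x0 \<tau> / 2 + norm (grad \<phi> x0) * (- Gz G x0 y0 z0) * (0 \<bullet> m)) (at 0)"
  proof (rule lim[rule_format])
    show "c 0 = x0"
      using hx0 by (simp add: c_def)
    show "(c has_vector_derivative \<tau>) (at 0)"
      unfolding c_def h'\<xi>[symmetric] by (rule parabola_lift[OF h(3)[OF W(5)]])
    show "\<forall>\<^sub>F s in at 0. (c s, y0, z0) \<in> D \<and> Qmap G (c s) y0 z0 = Qmap G x0 y0 z0 + s *\<^sub>R \<xi> + s\<^sup>2 *\<^sub>R 0"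
      using evW
    proof eventually_elim
      case (elim s)
      from h(1)[OF this] W(2) show ?case
        unfolding c_def q_def by blast
    qed
  qed (rule \<xi>m)
  then have "\<forall>\<^sub>F s in at 0. \<phi> (c s) / s\<^sup>2 < 0"
    using neg by (intro order_tendstoD(2)) auto
  with evW have "\<forall>\<^sub>F s in at 0. q x0 + s *\<^sub>R \<xi> \<in> q ` \<Omega>"
  proof eventually_elim
    case (elim s)
    from h(1)[OF elim(1)] have *: "c s \<in> W" "q (c s) = q x0 + s *\<^sub>R \<xi>"
      by (simp_all add: c_def)
    moreover have "\<phi> (c s) < 0"
      using elim(2) by (simp add: divide_less_0_iff)
    ultimately have "c s \<in> \<Omega>"
      using in_domain_iff[OF \<phi>] W(2) by blast
    with *(2) show ?case
      by (metis imageI)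
  qed
  then obtain d where d: "d > 0" "\<And>s. s \<noteq> 0 \<Longrightarrow> \<bar>s\<bar> < d \<Longrightarrow> q x0 + s *\<^sub>R \<xi> \<in> q ` \<Omega>"
    unfolding eventually_at by (auto simp: dist_real_def)
  have "(1/2) *\<^sub>R (q x0 + (d/2) *\<^sub>R \<xi>) + (1/2) *\<^sub>R (q x0 + (- d/2) *\<^sub>R \<xi>) \<in> q ` \<Omega>"
    by (rule convexD[OF conv d(2) d(2)]) (use d(1) in auto)
  moreover have "(1/2) *\<^sub>R (q x0 + (d/2) *\<^sub>R \<xi>) + (1/2) *\<^sub>R (q x0 + (- d/2) *\<^sub>R \<xi>) = q x0"
    by (simp add: vec_eq_iff field_simps)
  ultimately show False
    using q_eq_frontier[OF x0(1)] by simp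
qed

text \<open>The condition on parabolas is checked at every boundary point near \<open>q x0\<close>,
  each with its own \<open>m\<close> from \<open>contact\<close>, while the radius and the direction
  \<open>n\<close> are chosen once at \<open>q x0\<close>.\<close>

lemma convex_boundary_at_if_curv_nonneg:
  assumes \<phi>: "defining_function \<Omega> N \<phi>" and x0: "x0 \<in> frontier \<Omega>" "x0 \<in> N"
    and curv: "\<And>x \<tau>. x \<in> frontier \<Omega> \<Longrightarrow> x \<in> N \<Longrightarrow> grad \<phi> x \<bullet> \<tau> = 0 \<Longrightarrow> curv y0 z0 \<phi> x \<tau> \<ge> 0"
  shows "convex_boundary_at (q ` \<Omega>) (q x0)"
proof -
  let ?b = "q x0"
  obtain W W' h h' where W: "open W" "W \<subseteq> V \<inter> N" "x0 \<in> W" "open W'" "q x0 \<in> W'"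
    and h': "\<forall>y\<in>W'. h y \<in> W \<and> q (h y) = y" "\<forall>x\<in>W. h (q x) = x"
      "\<forall>y\<in>W'. (h has_derivative h' y) (at y)" "\<forall>y\<in>W'. \<forall>v. q' (h y) (h' y v) = v"
      "\<forall>v. ((\<lambda>y. h' y v) \<longlongrightarrow> h' (q x0) v) (at (q x0))"
    using local_inverse[OF x0 open_N[OF \<phi>]] by (elim exE conjE) (rule that)
  note h = h'(1)[THEN bspec] h'(2)[THEN bspec] h'(3)[THEN bspec] h'(4)[THEN bspec, THEN spec] h'(5)[THEN spec]
  have WN: "x \<in> N" if "x \<in> W" for x
    using W that by blast
  have hb: "h ?b = x0"
    using h(2) W(3) .
  define \<psi> where "\<psi> = (\<lambda>y. \<phi> (h y))"
  define \<psi>' where "\<psi>' = (\<lambda>y v. grad \<phi> (h y) \<bullet> h' y v)"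
  have der: "(\<psi> has_derivative \<psi>' y) (at y)" if "y \<in> W'" for y
    unfolding \<psi>_def \<psi>'_def
    by (rule has_derivative_compose[OF h(3)[OF that] \<phi>_has_derivative[OF \<phi> WN]]) (use h(1)[OF that] in blast)
  \<comment> \<open>The image of the inward gradient: \<open>h'\<close> takes it back to
    \<open>- grad \<phi> x0\<close>, so \<open>\<psi>' n\<close> is minus the squared norm of the
    gradient at the base point, and convergence of \<open>h'\<close> keeps the sign nearby.\<close>
  define n where "n = q' x0 (- grad \<phi> x0)"
  have lin: "linear (q' x0)"
    using has_derivative_linear[OF q_has_derivative[of x0]] frontier_V[OF x0(1)] by simp
  have q'n: "q' x0 (h' ?b n) = n"
    using h(4)[OF W(5), of n] unfolding hb .
  have "q' x0 (h' ?b n - (- grad \<phi> x0)) = 0"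
    unfolding linear_diff[OF lin] q'n by (simp only: n_def[symmetric] diff_self)
  then have "h' ?b n - (- grad \<phi> x0) = 0"
    by (rule Q'_injective[OF frontier_V[OF x0(1)] det_E[OF x0(1)]])
  then have h'n: "h' ?b n = - grad \<phi> x0"
    by (rule eq_iff_diff_eq_0[THEN iffD2])
  have "((\<lambda>y. \<psi>' y n) \<longlongrightarrow> \<psi>' ?b n) (at ?b)"
  proof -
    have "isCont (\<lambda>y. grad \<phi> (h y)) ?b"
      by (rule isCont_o2[OF has_derivative_continuous[OF h(3)[OF W(5)]]])
        (simp add: hb has_derivative_continuous[OF has_derivative_grad[OF \<phi> x0(2)]])
    then have "((\<lambda>y. grad \<phi> (h y)) \<longlongrightarrow> grad \<phi> (h ?b)) (at ?b)"
      by (simp add: isCont_def)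
    then show ?thesis
      unfolding \<psi>'_def by (rule tendsto_inner) (rule h(5))
  qed
  moreover have bn: "\<psi>' ?b n < 0"
    using grad_nonzero[OF \<phi> x0(2)] by (simp add: \<psi>'_def hb h'n)
  ultimately have ev: "\<forall>\<^sub>F y in at ?b. \<psi>' y n < 0"
    by (rule order_tendstoD(2))
  obtain R1 where R1: "R1 > 0" "\<And>y. y \<in> ball ?b R1 \<Longrightarrow> \<psi>' y n < 0"
  proof -
    obtain d where d: "d > 0" "\<forall>y\<in>UNIV. y \<noteq> ?b \<and> dist y ?b < d \<longrightarrow> \<psi>' y n < 0"
      using ev unfolding eventually_at by (elim exE conjE) (rule that)
    show ?thesis
    proof (rule that[OF d(1)])
      fix y assume "y \<in> ball ?b d"
      with d(2) bn show "\<psi>' y n < 0"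
        by (cases "y = ?b") (auto simp: dist_commute)
    qed
  qed
  \<comment> \<open>The image of the part of the closure outside \<open>W\<close>. By injectivity it
    misses \<open>q x0\<close>, by compactness a whole ball around it; inside this ball the local
    inverse decides membership in the image.\<close>
  define K where "K = q ` (closure \<Omega> - W)"
  have "compact K"
    unfolding K_def using compact_closure_Omega W(1) q_cont
    by (intro compact_continuous_image compact_diff) (auto intro: continuous_on_subset)
  moreover have "?b \<notin> K"
  proof
    assume "?b \<in> K"
    then obtain w where w: "w \<in> closure \<Omega>" "w \<notin> W" "q x0 = q w"
      by (auto simp: K_def)
    from inj_on_q w(3) frontier_subset_closure[OF x0(1)] w(1) have "x0 = w"
      by (rule inj_onD)
    with w(2) W(3) show False by simp
  qed
  ultimately have "open (W' - K)" "?b \<in> W' - K"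
    using W(4,5) by (auto intro: open_Diff compact_imp_closed)
  then obtain R2 where R2: "R2 > 0" "ball ?b R2 \<subseteq> W' - K"
    using open_contains_ball by blast
  define R where "R = min R1 R2"
  have R: "R > 0" and RW: "\<And>y. y \<in> ball ?b R \<Longrightarrow> y \<in> W'" and RK: "\<And>y. y \<in> ball ?b R \<Longrightarrow> y \<notin> K"
    and Rn: "\<And>y. y \<in> ball ?b R \<Longrightarrow> \<psi>' y n < 0"
    using R1 R2 by (auto simp: R_def)
  have preimage: "h y = x" if "y \<in> ball ?b R" "y = q x" "x \<in> closure \<Omega>" for x y
  proof -
    have "x \<in> W"
      using RK[OF that(1)] that(2,3) by (auto simp: K_def)
    then show ?thesis
      using h(2) that(2) by simp
  qed
  have mem: "y \<in> q ` \<Omega> \<longleftrightarrow> \<psi> y < 0" "y \<in> closure (q ` \<Omega>) \<longleftrightarrow> \<psi> y \<le> 0" if y: "y \<in> ball ?b R" for y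
  proof -
    have hy: "h y \<in> N" "q (h y) = y"
      using h(1)[OF RW[OF y]] WN by auto
    have "y \<in> q ` \<Omega> \<longleftrightarrow> h y \<in> \<Omega>"
    proof
      assume "y \<in> q ` \<Omega>"
      then obtain x where x: "x \<in> \<Omega>" "y = q x"
        by blast
      then have "x \<in> closure \<Omega>"
        using closure_subset by blast
      with x show "h y \<in> \<Omega>"
        using preimage[OF y x(2)] by simp
    next
      assume "h y \<in> \<Omega>"
      then have "q (h y) \<in> q ` \<Omega>"
        by (rule imageI)
      then show "y \<in> q ` \<Omega>"
        unfolding hy(2) .
    qed
    then show "y \<in> q ` \<Omega> \<longleftrightarrow> \<psi> y < 0"
      using in_domain_iff[OF \<phi> hy(1)] by (simp add: \<psi>_def)
    have "y \<in> q ` closure \<Omega> \<longleftrightarrow> h y \<in> closure \<Omega>"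
    proof
      assume "y \<in> q ` closure \<Omega>"
      then obtain x where x: "x \<in> closure \<Omega>" "y = q x"
        by blast
      then show "h y \<in> closure \<Omega>"
        using preimage[OF y x(2,1)] by simp
    next
      assume "h y \<in> closure \<Omega>"
      then have "q (h y) \<in> q ` closure \<Omega>"
        by (rule imageI)
      then show "y \<in> q ` closure \<Omega>"
        unfolding hy(2) .
    qed
    then show "y \<in> closure (q ` \<Omega>) \<longleftrightarrow> \<psi> y \<le> 0"
      using in_closure_iff[OF \<phi> hy(1)] by (simp add: \<psi>_def closure_image_q)
  qed
  have second: "\<forall>\<^sub>F s in at 0. \<psi> (y + s *\<^sub>R \<xi> + s\<^sup>2 *\<^sub>R w) > 0"
    if y: "y \<in> ball ?b R" and 0: "\<psi> y = 0" and \<xi>: "\<psi>' y \<xi> = 0" and w: "\<psi>' y w > 0" for y \<xi> w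
  proof -
    define x where "x = h y"
    have yW: "y \<in> W'"
      using RW[OF y] .
    have qx: "q x = y" and xN: "x \<in> N"
      using h(1)[OF yW] WN by (auto simp: x_def)
    have xf: "x \<in> frontier \<Omega>"
      using in_frontier_iff[OF \<phi> xN] 0 by (simp add: \<psi>_def x_def)
    note p = frontier_V[OF xf] and E = det_E[OF xf]
    obtain m where a: "\<forall>v. grad \<phi> x \<bullet> v = norm (grad \<phi> x) * (- Gz G x y0 z0) * (q' x v \<bullet> m)"
    and lim: "\<forall>c \<tau> \<xi> w. c 0 = x \<longrightarrow> (c has_vector_derivative \<tau>) (at 0) \<longrightarrow> \<xi> \<bullet> m = 0 \<longrightarrow>
        (\<forall>\<^sub>F s in at 0. (c s, y0, z0) \<in> D \<and> Qmap G (c s) y0 z0 = Qmap G x y0 z0 + s *\<^sub>R \<xi> + s\<^sup>2 *\<^sub>R w)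
      \<longrightarrow> ((\<lambda>s. \<phi> (c s) / s\<^sup>2) \<longlongrightarrow>
        curv y0 z0 \<phi> x \<tau> / 2 + norm (grad \<phi> x) * (- Gz G x y0 z0) * (w \<bullet> m)) (at 0)"
    using contact[OF p E \<phi> xf xN] by (elim exE conjE) (rule that)
    have \<psi>'m: "\<psi>' y v = norm (grad \<phi> x) * (- Gz G x y0 z0) * (v \<bullet> m)" for v
      using a[rule_format, of "h' y v"] h(4)[OF yW, of v] by (simp add: \<psi>'_def x_def)
    have "Gz G x y0 z0 \<noteq> 0"
      using Gz_nonzero[OF p] Gz_eq[OF p] by simp
    then have \<xi>m: "\<xi> \<bullet> m = 0"
      using \<psi>'m[of \<xi>] \<xi> grad_nonzero[OF \<phi> xN] by simp
    define c where "c = (\<lambda>s. h (y + s *\<^sub>R \<xi> + s\<^sup>2 *\<^sub>R w))"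
    have evW: "\<forall>\<^sub>F s in at 0. y + s *\<^sub>R \<xi> + s\<^sup>2 *\<^sub>R w \<in> W'"
      using topological_tendstoD[OF parabola_tendsto W(4) yW] .
    have "((\<lambda>s. \<phi> (c s) / s\<^sup>2) \<longlongrightarrow>
          curv y0 z0 \<phi> x (h' y \<xi>) / 2 + norm (grad \<phi> x) * (- Gz G x y0 z0) * (w \<bullet> m)) (at 0)"
    proof (rule lim[rule_format])
      show "c 0 = x"
        by (simp add: c_def x_def)
      show "(c has_vector_derivative h' y \<xi>) (at 0)"
        unfolding c_def by (rule parabola_lift[OF h(3)[OF yW]])
      show "\<forall>\<^sub>F s in at 0. (c s, y0, z0) \<in> D \<and> Qmap G (c s) y0 z0 = Qmap G x y0 z0 + s *\<^sub>R \<xi> + s\<^sup>2 *\<^sub>R w"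
        using evW
      proof eventually_elim
        case (elim s)
        from h(1)[OF this] W(2) qx show ?case
          unfolding c_def q_def by blast
      qed
    qed (rule \<xi>m)
    \<comment> \<open>\<open>curv\<close> may vanish here; strict positivity of the limit comes from
      the other summand, which equals \<open>\<psi>' y w\<close>.\<close>
    moreover have "curv y0 z0 \<phi> x (h' y \<xi>) \<ge> 0"
      using \<xi> by (intro curv xf xN) (simp add: \<psi>'_def x_def)
    then have "curv y0 z0 \<phi> x (h' y \<xi>) / 2 + norm (grad \<phi> x) * (- Gz G x y0 z0) * (w \<bullet> m) > 0"
      using w \<psi>'m[of w] by simp
    ultimately have "\<forall>\<^sub>F s in at 0. \<phi> (c s) / s\<^sup>2 > 0"
      by (rule order_tendstoD(1))
    then show ?thesis
      by eventually_elim (simp add: c_def \<psi>_def zero_less_divide_iff)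
  qed
  have "\<psi> ?b = 0"
    using in_frontier_iff[OF \<phi> x0(2)] x0(1) by (simp add: \<psi>_def hb)
  then show ?thesis
    unfolding convex_boundary_at_def
    by (intro exI[of _ R] exI[of _ \<psi>] exI[of _ \<psi>'] exI[of _ n] conjI ballI allI impI R Rn mem second der RW)
qed

lemma curv_eq:
  assumes \<phi>: "defining_function \<Omega> N \<phi>" and x: "x \<in> frontier \<Omega>" "x \<in> N"
    and \<gamma>: "outer_normal_field_near \<Omega> x \<gamma>" and \<tau>: "tangent_to_boundary \<Omega> x \<tau>"
  shows "curv y0 z0 \<phi> x \<tau> = norm (grad \<phi> x) * (\<Sum>i\<in>UNIV. \<Sum>j\<in>UNIV.
    (pd i (\<lambda>w. \<gamma> w $ j) x - (\<Sum>k\<in>UNIV. Gxxp U I G i j k x y0 z0 * \<gamma> x $ k)) * \<tau> $ i * \<tau> $ j)"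
  unfolding curv_def normal_field_hess[OF \<phi> x \<gamma> \<tau>, symmetric] outer_normal_field_at[OF \<phi> x \<gamma>, symmetric]
  by (simp add: left_diff_distrib sum_subtractf right_diff_distrib)

theorem convex_image_iff:
  assumes "connected \<Omega>" and C2: "C2_boundary \<Omega>"
  shows "convex (q ` \<Omega>) \<longleftrightarrow>
    (\<forall>x\<in>frontier \<Omega>. \<forall>\<gamma> \<tau>.
      outer_normal_field_near \<Omega> x \<gamma> \<and> tangent_to_boundary \<Omega> x \<tau> \<and> norm \<tau> = 1 \<longrightarrow>
      (\<Sum>i\<in>UNIV. \<Sum>j\<in>UNIV.
         (pd i (\<lambda>w. \<gamma> w $ j) x - (\<Sum>k\<in>UNIV. Gxxp U I G i j k x y0 z0 * \<gamma> x $ k)) * \<tau> $ i * \<tau> $ j) \<ge> 0)"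
    (is "_ \<longleftrightarrow> (\<forall>x\<in>_. \<forall>\<gamma> \<tau>. _ \<longrightarrow> ?S x \<gamma> \<tau> \<ge> 0)")
proof
  assume conv: "convex (q ` \<Omega>)"
  show "\<forall>x\<in>frontier \<Omega>. \<forall>\<gamma> \<tau>. outer_normal_field_near \<Omega> x \<gamma> \<and> tangent_to_boundary \<Omega> x \<tau> \<and> norm \<tau> = 1
      \<longrightarrow> ?S x \<gamma> \<tau> \<ge> 0"
  proof (intro ballI allI impI)
    fix x \<gamma> \<tau> assume x: "x \<in> frontier \<Omega>"
      and *: "outer_normal_field_near \<Omega> x \<gamma> \<and> tangent_to_boundary \<Omega> x \<tau> \<and> norm \<tau> = 1"
    obtain N \<phi> where \<phi>: "defining_function \<Omega> N \<phi>" "x \<in> N"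
      using C2_boundary_defining_function[OF C2 x] .
    have "curv y0 z0 \<phi> x \<tau> \<ge> 0"
      using curv_nonneg_if_convex[OF conv \<phi>(1) x \<phi>(2)] orthogonal_if_tangent[OF \<phi>(1) x \<phi>(2)] * by blast
    moreover have "norm (grad \<phi> x) > 0"
      using grad_nonzero[OF \<phi>] by simp
    ultimately show "?S x \<gamma> \<tau> \<ge> 0"
      using curv_eq[OF \<phi>(1) x \<phi>(2), of \<gamma> \<tau>] * by (simp add: zero_le_mult_iff)
  qed
next
  assume S: "\<forall>x\<in>frontier \<Omega>. \<forall>\<gamma> \<tau>. outer_normal_field_near \<Omega> x \<gamma> \<and> tangent_to_boundary \<Omega> x \<tau> \<and> norm \<tau> = 1
      \<longrightarrow> ?S x \<gamma> \<tau> \<ge> 0"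
  \<comment> \<open>The condition speaks of unit tangents only; homogeneity of degree 2 extends it
    to tangents of any length, including zero.\<close>
  have curv: "curv y0 z0 \<phi> x \<tau> \<ge> 0"
    if \<phi>: "defining_function \<Omega> N \<phi>" and x: "x \<in> frontier \<Omega>" "x \<in> N" and \<tau>: "grad \<phi> x \<bullet> \<tau> = 0" for \<phi> N x \<tau>
  proof -
    have unit: "curv y0 z0 \<phi> x \<tau> \<ge> 0" if \<tau>: "grad \<phi> x \<bullet> \<tau> = 0" "norm \<tau> = 1" for \<tau>
    proof -
      let ?\<gamma> = "\<lambda>w. sgn (grad \<phi> w)"
      have \<gamma>: "outer_normal_field_near \<Omega> x ?\<gamma>"
        by (rule outer_normal_field_exists[OF \<phi> x(2)])
      have t: "tangent_to_boundary \<Omega> x \<tau>"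
        by (rule tangent_if_orthogonal[OF \<phi> x \<tau>(1)])
      have "?S x ?\<gamma> \<tau> \<ge> 0"
        using S x(1) \<gamma> t \<tau>(2) by blast
      then show ?thesis
        unfolding curv_eq[OF \<phi> x \<gamma> t] by simp
    qed
    show ?thesis
    proof (cases "\<tau> = 0")
      case True
      then show ?thesis
        using curv_scaleR[of y0 z0 \<phi> x 0 0] by simp
    next
      case False
      have "curv y0 z0 \<phi> x (norm \<tau> *\<^sub>R sgn \<tau>) \<ge> 0"
        unfolding curv_scaleR using unit[of "sgn \<tau>"] \<tau> False by (simp add: sgn_div_norm)
      with False show ?thesis
        by (simp add: sgn_div_norm)
    qed
  qed
  show "convex (q ` \<Omega>)"
  proof (rule convex_if_convex_boundary)
    show "open (q ` \<Omega>)"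
      by (rule open_image_q)
    show "connected (q ` \<Omega>)"
      using \<open>connected \<Omega>\<close> continuous_on_subset[OF q_cont closure_subset] by (rule connected_continuous_image[rotated])
    have "bounded (q ` closure \<Omega>)"
      by (intro compact_imp_bounded compact_continuous_image q_cont compact_closure_Omega)
    then show "bounded (q ` \<Omega>)"
      by (rule bounded_subset) (use closure_subset in blast)
    fix b assume "b \<in> frontier (q ` \<Omega>)"
    then obtain x where x: "x \<in> frontier \<Omega>" "q x = b"
      by (rule frontier_image_q)
    obtain N \<phi> where \<phi>: "defining_function \<Omega> N \<phi>" "x \<in> N"
      using C2_boundary_defining_function[OF C2 x(1)] .
    show "convex_boundary_at (q ` \<Omega>) b"
      unfolding x(2)[symmetric]
      by (rule convex_boundary_at_if_curv_nonneg[OF \<phi>(1) x(1) \<phi>(2)]) (rule curv[OF \<phi>(1)])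
  qed
qed

end

theorem lemma2p4:
  fixes U :: "((real^'n::finite) \<times> (real^'n)) set"
    and I :: "real set"
    and J :: "real^'n \<Rightarrow> real^'n \<Rightarrow> real set"
    and G :: "real^'n \<Rightarrow> real^'n \<Rightarrow> real \<Rightarrow> real"
    and \<Omega> :: "(real^'n) set"
    and y0 :: "real^'n" and z0 :: real
  assumes "open U"
    and "I = UNIV \<or> I = {0<..}"
    and "smooth_on (\<lambda>(x, y, z). G x y z) {(x, y, z). (x, y) \<in> U \<and> z \<in> I}"
    and "\<forall>(x, y)\<in>U. \<forall>z\<in>I. Gz G x y z < 0"
    and "condG1 U I J G" and "condG2 U J G" and "condG1star U J G"
    and "open \<Omega>" and "connected \<Omega>" and "\<Omega> \<noteq> {}" and "bounded \<Omega>"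
    and "\<Omega> \<subseteq> U1 U"
    and "C2_boundary \<Omega>"
    and "y0 \<in> (\<Inter>x\<in>\<Omega>. Ustar U x)"
    and "z0 \<in> (\<Inter>x\<in>\<Omega>. J x y0)"
    and "\<forall>x\<in>frontier \<Omega>. (x, y0, z0) \<in> Gam U J"
  shows "G_convex G \<Omega> y0 z0 \<longleftrightarrow>
    (\<forall>x\<in>frontier \<Omega>. \<forall>\<gamma> \<tau>.
      outer_normal_field_near \<Omega> x \<gamma> \<and> tangent_to_boundary \<Omega> x \<tau> \<and> norm \<tau> = 1 \<longrightarrow>
      (\<Sum>i\<in>UNIV. \<Sum>j\<in>UNIV.
         (pd i (\<lambda>w. \<gamma> w $ j) x - (\<Sum>k\<in>UNIV. Gxxp U I G i j k x y0 z0 * \<gamma> x $ k)) * \<tau> $ i * \<tau> $ j) \<ge> 0)"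
proof -
  have gf: "generating_function U I G"
    using assms(1-4) by unfold_locales auto
  \<comment> \<open>Inner points are covered by the conditions on \<open>y0\<close> and
    \<open>z0\<close>, boundary points by the assumption on the frontier. Through G1* and G2 this
    carries injectivity and the nonvanishing determinant up to the boundary.\<close>
  have Gam: "(x, y0, z0) \<in> Gam U J" if "x \<in> closure \<Omega>" for x
    using that assms(14-16) unfolding closure_Un_frontier by (auto simp: Gam_def Ustar_def)
  have JI: "J x y \<subseteq> I" if "(x, y) \<in> U" for x y
    using assms(5) that by (auto simp: condG1_def)
  have "y0 \<in> U2 U"
    using assms(10,14) by (auto simp: U2_def Ustar_def)
  then have "inj_on (\<lambda>x. Qmap G x y0 z0) {x. (x, y0, z0) \<in> Gam U J}"
    using assms(7) by (simp add: condG1star_def)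
  then have inj: "inj_on (\<lambda>x. Qmap G x y0 z0) (closure \<Omega>)"
    by (rule inj_on_subset) (use Gam in blast)
  interpret generating_domain U I G \<Omega> y0 z0
  proof (intro generating_domain.intro gf generating_domain_axioms.intro inj)
    show "(x, y0, z0) \<in> generating_function.D U I" if "x \<in> closure \<Omega>" for x
      using Gam[OF that] JI by (auto simp: generating_function.D_def[OF gf] Gam_def)
    show "det (Emat G x y0 z0) \<noteq> 0" if "x \<in> frontier \<Omega>" for x
      using assms(6,16) that by (auto simp: condG2_def)
  qed (use assms in auto)
  show ?thesis
    unfolding G_convex_def q_def[abs_def, symmetric] using assms(9,13) by (rule convex_image_iff)
qed

end
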